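(* Let $X_1,X_2,\dots$ be iid real random variables with continuous cdf $F$, let $R(x)=-\log(1-F(x))$, and suppose there exist $a_r>0$, $b_r\in\mathbb R$ and $\gamma\in\mathbb R$ such that $$rR(a_rx-b_r)\to g_\gamma(x)\quad(r\to\infty),\qquad x\in\mathrm{supp}_\gamma.$$ Let $\mathcal R_r$ be the range of the sequence $(M_n^{(r)},n\ge r)$, i.e. the set of distinct values taken, where $M_n^{(r)}$ is the $r$-th largest of $X_1,\dots,X_n$. Then, as $r\to\infty$, the point process with points $(\mathcal R_r+b_r)/a_r$ satisfies $$(\mathcal R_r+b_r)/a_r\Rightarrow \mathrm{PRM}(m_\gamma)$$ weakly in $M_+(\mathrm{supp}_\gamma)$.
   Context: For $\gamma\in\mathbb R$, $\mathrm{supp}_\gamma=\{x\in\mathbb R:1-\gamma x>0\}$, and $g_\gamma:\mathrm{supp}_\gamma\to(0,\infty)$ is $g_\gamma(x)=-\log G_\gamma(-x)$, where $G_\gamma(x)=\exp\{-(1+\gamma x)^{-1/\gamma}\}$, $1+\gamma x>0$; that is, $g_\gamma(x)=(1-\gamma x)^{-1/\gamma}$ for $\gamma\ne0$ and $g_0(x)=e^x$. $m_\gamma$ is the measure on $\mathrm{supp}_\gamma$ with density $g_\gamma'$. $M_+(\mathrm{supp}_\gamma)$ is the space of Radon measures on $\mathrm{supp}_\gamma$ with the vague topology. $\mathrm{PRM}(m)$ denotes a Poisson random measure with mean measure $m$. A set of points is identified with the point measure putting unit mass at each of its points (restricted to $\mathrm{supp}_\gamma$). $(\mathcal R_r+b_r)/a_r=\{(x+b_r)/a_r:x\in\mathcal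 R_r\}$. $R(x)=+\infty$ where $F(x)=1$.
   Formalization: For fixed r the rescaled points may accumulate inside supp_γ (e.g. F uniform), so the point process need not lie in M_+(supp_γ); the convergence is stated for every sequence of random Radon measures that, on each compact set, a.s. equals it for all large r, and such sequences are shown to exist. *)

theory Defs
  imports "HOL-Probability.Probability"
begin

definition G_gev :: "real \<Rightarrow> real \<Rightarrow> real" where
  "G_gev \<gamma> x =
     (if \<gamma> = 0 then exp (- exp (- x)) else exp (- ((1 + \<gamma> * x) powr (- 1 / \<gamma>))))"

definition supp_gev :: "real \<Rightarrow> real set" where
  "supp_gev \<gamma> = {x. 1 - \<gamma> * x > 0}"

definition g_gev :: "real \<Rightarrow> real \<Rightarrow> real" where
  "g_gev \<gamma> x = - ln (G_gev \<gamma> (- x))"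

lemma g_gev_eq:
  "g_gev \<gamma> x = (if \<gamma> = 0 then exp x else (1 - \<gamma> * x) powr (- 1 / \<gamma>))"
  by (simp add: g_gev_def G_gev_def)

definition m_gev :: "real \<Rightarrow> real measure" where
  "m_gev \<gamma> = density (restrict_space lborel (supp_gev \<gamma>)) (\<lambda>x. ennreal (deriv (g_gev \<gamma>) x))"

definition cum_hazard :: "(real \<Rightarrow> real) \<Rightarrow> real \<Rightarrow> ereal" where
  "cum_hazard F x = (if F x = 1 then \<infinity> else ereal (- ln (1 - F x)))"


(* On an open set S of reals every Borel measure that is finite on compact sets is regular,
   so local finiteness is all there is to being a Radon measure. *)
definition radon_measures :: "real set \<Rightarrow> real measure set" where
  "radon_measures S =
     {\<mu>. sets \<mu> = sets (restrict_space borel S) \<and>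
         (\<forall>K. compact K \<and> K \<subseteq> S \<longrightarrow> emeasure \<mu> K < \<infinity>)}"

definition test_functions :: "real set \<Rightarrow> (real \<Rightarrow> real) set" where
  "test_functions S =
     {f. continuous_on S f \<and> (\<forall>x\<in>S. 0 \<le> f x) \<and>
         (\<exists>K. compact K \<and> K \<subseteq> S \<and> (\<forall>x\<in>S - K. f x = 0))}"

definition vague_topology :: "real set \<Rightarrow> real measure topology" where
  "vague_topology S =
     topology_generated_by
       {{\<mu> \<in> radon_measures S. (\<integral>x. f x \<partial>\<mu>) \<in> U} | f U. f \<in> test_functions S \<and> open U}"

lemma topspace_vague_topology: "topspace (vague_topology S) = radon_measures S"
proof -
  have "(\<lambda>x. 0) \<in> test_functions S"
    by (auto simp: test_functions_def intro!: exI[of _ "{}"])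
  then have "radon_measures S \<in>
      {{\<mu> \<in> radon_measures S. (\<integral>x. f x \<partial>\<mu>) \<in> U} | f U. f \<in> test_functions S \<and> open U}"
    by (intro CollectI exI[of _ "\<lambda>x. 0"] exI[of _ UNIV]) auto
  then show ?thesis
    unfolding vague_topology_def topology_generated_by_topspace by blast
qed

definition borel_of :: "'s topology \<Rightarrow> 's measure" where
  "borel_of T = sigma (topspace T) {U. openin T U}"

definition converges_weakly ::
  "'s topology \<Rightarrow> 'a measure \<Rightarrow> (nat \<Rightarrow> 'a \<Rightarrow> 's) \<Rightarrow> 'b measure \<Rightarrow> ('b \<Rightarrow> 's) \<Rightarrow> bool" where
  "converges_weakly T M \<xi> P \<eta> \<longleftrightarrow>
     (\<forall>r. \<xi> r \<in> measurable M (borel_of T)) \<and> \<eta> \<in> measurable P (borel_of T) \<and>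
     (\<forall>h. continuous_map T euclideanreal h \<and> bounded (h ` topspace T) \<longrightarrow>
        (\<lambda>r. \<integral>\<omega>. h (\<xi> r \<omega>) \<partial>M) \<longlonglongrightarrow> (\<integral>\<omega>. h (\<eta> \<omega>) \<partial>P))"

(* The Poisson weights are written out because poisson_pmf requires a positive rate and A may
   have mean measure 0. *)
definition poisson_random_measure ::
  "real set \<Rightarrow> real measure \<Rightarrow> 'b measure \<Rightarrow> ('b \<Rightarrow> real measure) \<Rightarrow> bool" where
  "poisson_random_measure S m P \<eta> \<longleftrightarrow>
     prob_space P \<and> \<eta> \<in> measurable P (borel_of (vague_topology S)) \<and>
     (\<forall>A\<in>sets (restrict_space borel S).
        (emeasure m A < \<infinity> \<longrightarrow>
           (\<forall>k. measure P {\<omega> \<in> space P. emeasure (\<eta> \<omega>) A = of_nat k}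
                = measure m A ^ k / fact k * exp (- measure m A))) \<and>
        (emeasure m A = \<infinity> \<longrightarrow> (AE \<omega> in P. emeasure (\<eta> \<omega>) A = \<infinity>))) \<and>
     (\<forall>n A. (\<forall>i<n. A i \<in> sets (restrict_space borel S)) \<and> disjoint_family_on A {..<n} \<longrightarrow>
        prob_space.indep_vars P (\<lambda>_. borel) (\<lambda>i \<omega>. emeasure (\<eta> \<omega>) (A i)) {..<n::nat})"

definition point_measure_on :: "real set \<Rightarrow> real set \<Rightarrow> real measure" where
  "point_measure_on S Q = distr (count_space (Q \<inter> S)) (restrict_space borel S) (\<lambda>x. x)"

lemma emeasure_point_measure_on:
  assumes "A \<in> sets (restrict_space borel S)"
  shows "emeasure (point_measure_on S Q) A = emeasure (count_space UNIV) (Q \<inter> A)"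
proof -
  have "A \<subseteq> S"
    using sets.sets_into_space[OF assms] by (simp add: space_restrict_space)
  moreover have "(\<lambda>x. x) \<in> measurable (count_space (Q \<inter> S)) (restrict_space borel S)"
    by (auto simp: measurable_count_space_eq1 space_restrict_space)
  ultimately have "emeasure (point_measure_on S Q) A = emeasure (count_space (Q \<inter> S)) (Q \<inter> A)"
    using assms unfolding point_measure_on_def
    by (subst emeasure_distr) (auto intro!: arg_cong2[where f = emeasure])
  also have "\<dots> = emeasure (count_space UNIV) (Q \<inter> A)"
    using \<open>A \<subseteq> S\<close> by (subst (1 2) emeasure_count_space) auto
  finally show ?thesis .
qed


definition rth_largest :: "nat \<Rightarrow> real list \<Rightarrow> real" where
  "rth_largest r xs = rev (sort xs) ! (r - 1)"

(* The random variables are indexed from 0: x 0, ..., x (n - 1) are the first n of them. *)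
definition range_rth_maxima :: "nat \<Rightarrow> (nat \<Rightarrow> real) \<Rightarrow> real set" where
  "range_rth_maxima r x = {rth_largest r (map x [0..<n]) | n. r \<le> n}"

definition range_process ::
  "real set \<Rightarrow> (nat \<Rightarrow> real) \<Rightarrow> (nat \<Rightarrow> real) \<Rightarrow> (nat \<Rightarrow> 'a \<Rightarrow> real) \<Rightarrow> nat \<Rightarrow> 'a \<Rightarrow> real measure" where
  "range_process S a b X r \<omega> =
     point_measure_on S ((\<lambda>x. (x + b r) / a r) ` range_rth_maxima r (\<lambda>i. X i \<omega>))"

(* For a fixed r the points (range + b r) / a r can accumulate inside S, so that the point
   measure is not Radon and is not an element of the space with the vague topology.  For F
   uniform on (0,1), \<gamma> = -1, a r = 1 / r, b r = - 1 / r they accumulate at r - 1, which lies in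
   S = (-1, \<infinity>), for every r.  Only on each fixed compact subset of S, and for all large r, are
   they finitely many.  Weak convergence of such N r in the vague topology is understood for
   genuine random Radon measures \<xi> r that coincide with N r on every compact set for all
   large r (if the N r are random Radon measures themselves, \<xi> = N is allowed). *)
definition radon_version ::
  "real set \<Rightarrow> 'a measure \<Rightarrow> (nat \<Rightarrow> 'a \<Rightarrow> real measure) \<Rightarrow> (nat \<Rightarrow> 'a \<Rightarrow> real measure) \<Rightarrow> bool" where
  "radon_version S M N \<xi> \<longleftrightarrow>
     (\<forall>r. \<xi> r \<in> measurable M (borel_of (vague_topology S))) \<and>
     (\<forall>K. compact K \<and> K \<subseteq> S \<longrightarrow>
        (\<forall>\<^sub>F r in sequentially. AE \<omega> in M.
           \<forall>A\<in>sets borel. A \<subseteq> K \<longrightarrow> emeasure (\<xi> r \<omega>) A = emeasure (N r \<omega>) A))"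

lemma radon_version_refl:
  assumes "\<And>r. N r \<in> measurable M (borel_of (vague_topology S))"
  shows "radon_version S M N N"
  using assms by (simp add: radon_version_def)

definition converges_weakly_vaguely ::
  "real set \<Rightarrow> 'a measure \<Rightarrow> (nat \<Rightarrow> 'a \<Rightarrow> real measure) \<Rightarrow> 'b measure \<Rightarrow> ('b \<Rightarrow> real measure) \<Rightarrow> bool"
  where
  "converges_weakly_vaguely S M N P \<eta> \<longleftrightarrow>
     (\<exists>\<xi>. radon_version S M N \<xi>) \<and>
     (\<forall>\<xi>. radon_version S M N \<xi> \<longrightarrow> converges_weakly (vague_topology S) M \<xi> P \<eta>)"

lemma converges_weakly_vaguelyD:
  assumes "converges_weakly_vaguely S M N P \<eta>"
    and "\<And>r. N r \<in> measurable M (borel_of (vague_topology S))"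
  shows "converges_weakly (vague_topology S) M N P \<eta>"
  using assms(1) radon_version_refl[of N M S, OF assms(2)]
  unfolding converges_weakly_vaguely_def by blast

end

theory Submission
  imports Defs
begin

text \<open>
  Write \<open>hazard F x = - ln (1 - F x)\<close>. Since \<open>F\<close> is continuous, the variables
  \<open>E i = hazard F (X i)\<close> are independent and exponentially distributed with rate 1. A value
  \<open>X j\<close> belongs to the range of the sequence of \<open>r\<close>-th largest values exactly when it is among the
  \<open>r\<close> largest of its time, that is, when fewer than \<open>r\<close> earlier values exceed it: its rank can only
  grow afterwards, by steps of one, and it grows without bound
  (\<open>range_rth_maxima_eq\<close>). By the lack of memory of the exponential law, the accepted values of
  \<open>E\<close>, multiplied by \<open>r\<close>, form a homogeneous Poisson process of rate 1 on the positive half-line,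
  for every \<open>r\<close>. Hence the rescaled range is the image of a Poisson process, whose law does not
  depend on \<open>r\<close>, under the inverse of \<open>y \<mapsto> r * hazard F (a r * y - b r)\<close>. These maps converge
  to \<open>g_gev \<gamma>\<close>, and the image of the rate 1 process under the inverse of \<open>g_gev \<gamma>\<close> is
  the Poisson random measure with mean measure \<open>m_gev \<gamma>\<close>.

  The argument is carried out as a coupling. On the given probability space, \<open>accepted_sum r\<close> denotes
  integration against the process \<open>{r * E n | n accepted}\<close>. Three facts are combined.

  \<^item> The law of that process is that of the Poisson random measure read in the coordinate
    \<open>g_gev \<gamma>\<close> (\<open>law_accepted_sums\<close>). As in Renyi's theorem, it is enough to compare void
    probabilities of finite unions of dyadic cells, because a locally finite simple point measure is
    the limit of the indicators of its occupied cells. The void probabilities of the accepted values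
    come from a martingale (\<open>void_weight\<close>, \<open>void_probability\<close>).

  \<^item> By monotonicity, pointwise convergence of the hazards is locally uniform
    (\<open>uniform_coupling\<close>), so integrals of a test function against the two coupled processes differ by
    at most \<open>\<epsilon>\<close> times the number of points in a fixed compact set, whose law is fixed.

  \<^item> The vague topology is the initial topology of countably many integrals of tent functions
    (\<open>vague_open_pullback\<close>), hence pseudo-metrizable. An inf-convolution then reduces weak
    convergence to Lipschitz functions of these integrals
    (\<open>weak_convergence_from_Lipschitz\<close>), for which closeness of the coupled processes in probability
    suffices.
\<close>

section \<open>The time change and the dyadic tents\<close>

definition g_inv :: "real \<Rightarrow> real \<Rightarrow> real" where
  "g_inv \<gamma> u = (if \<gamma> = 0 then ln u else (1 - u powr (- \<gamma>)) / \<gamma>)"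

lemma g_gev_pos: "x \<in> supp_gev \<gamma> \<Longrightarrow> 0 < g_gev \<gamma> x"
  by (auto simp: g_gev_eq supp_gev_def)

lemma g_inv_in_supp: "0 < u \<Longrightarrow> g_inv \<gamma> u \<in> supp_gev \<gamma>"
  by (auto simp: g_inv_def supp_gev_def)

lemma g_gev_g_inv [simp]: "0 < u \<Longrightarrow> g_gev \<gamma> (g_inv \<gamma> u) = u"
  by (auto simp: g_inv_def g_gev_eq powr_powr)

lemma g_inv_g_gev [simp]: "x \<in> supp_gev \<gamma> \<Longrightarrow> g_inv \<gamma> (g_gev \<gamma> x) = x"
  by (auto simp: g_inv_def g_gev_eq powr_powr supp_gev_def)

lemma open_supp_gev: "open (supp_gev \<gamma>)"
  unfolding supp_gev_def by (intro open_Collect_less continuous_intros)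

lemma supp_gev_borel [measurable]: "supp_gev \<gamma> \<in> sets borel"
  using open_supp_gev by (rule borel_open)

lemma supp_gev_between:
  assumes "x \<in> supp_gev \<gamma>" "z \<in> supp_gev \<gamma>" "x \<le> y" "y \<le> z"
  shows "y \<in> supp_gev \<gamma>"
proof (cases "0 \<le> \<gamma>")
  case True
  then have "\<gamma> * y \<le> \<gamma> * z" using assms(4) by (intro mult_left_mono)
  then show ?thesis using assms(2) by (simp add: supp_gev_def)
next
  case False
  then have "\<gamma> * y \<le> \<gamma> * x" using assms(3) by (intro mult_left_mono_neg) auto
  then show ?thesis using assms(1) by (simp add: supp_gev_def)
qed

lemma g_gev_less:
  assumes "x \<in> supp_gev \<gamma>" "y \<in> supp_gev \<gamma>" "x < y"
  shows "g_gev \<gamma> x < g_gev \<gamma> y"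
proof -
  consider "\<gamma> = 0" | "0 < \<gamma>" | "\<gamma> < 0" by linarith
  then show ?thesis
  proof cases
    case 2
    then have "1 - \<gamma> * y < 1 - \<gamma> * x" using assms by simp
    then have "(1 - \<gamma> * x) powr (- 1 / \<gamma>) < (1 - \<gamma> * y) powr (- 1 / \<gamma>)"
      using 2 assms by (intro powr_less_mono2_neg) (auto simp: supp_gev_def)
    then show ?thesis using 2 by (simp add: g_gev_eq)
  next
    case 3
    then have "1 - \<gamma> * x < 1 - \<gamma> * y" using assms by simp
    then have "(1 - \<gamma> * x) powr (- 1 / \<gamma>) < (1 - \<gamma> * y) powr (- 1 / \<gamma>)"
      using 3 assms by (intro powr_less_mono2) (auto simp: supp_gev_def)
    then show ?thesis using 3 by (simp add: g_gev_eq)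
  qed (use assms in \<open>simp add: g_gev_eq\<close>)
qed

lemma g_gev_le_iff: "x \<in> supp_gev \<gamma> \<Longrightarrow> y \<in> supp_gev \<gamma> \<Longrightarrow> g_gev \<gamma> x \<le> g_gev \<gamma> y \<longleftrightarrow> x \<le> y"
  using g_gev_less by (metis linorder_le_less_linear order.asym order_le_less)

lemma g_inv_le_iff: "0 < u \<Longrightarrow> 0 < v \<Longrightarrow> g_inv \<gamma> u \<le> g_inv \<gamma> v \<longleftrightarrow> u \<le> v"
  using g_gev_le_iff[of "g_inv \<gamma> u" \<gamma> "g_inv \<gamma> v"] by (simp add: g_inv_in_supp)

lemma DERIV_g_gev:
  assumes "x \<in> supp_gev \<gamma>"
  shows "(g_gev \<gamma> has_real_derivative g_gev \<gamma> x powr (1 + \<gamma>)) (at x)"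
proof (cases "\<gamma> = 0")
  case True
  then have "g_gev \<gamma> = exp" by (auto simp: g_gev_eq)
  then show ?thesis using True by simp
next
  case False
  have pos: "0 < 1 - \<gamma> * x" using assms by (simp add: supp_gev_def)
  have "((\<lambda>x. (1 - \<gamma> * x) powr (- 1 / \<gamma>)) has_real_derivative (1 - \<gamma> * x) powr (- 1 / \<gamma> - 1)) (at x)"
    using pos False by (auto intro!: derivative_eq_intros simp: powr_diff)
  moreover have "g_gev \<gamma> = (\<lambda>x. (1 - \<gamma> * x) powr (- 1 / \<gamma>))"
    using False by (auto simp: g_gev_eq)
  moreover have "((1 - \<gamma> * x) powr (- 1 / \<gamma>)) powr (1 + \<gamma>) = (1 - \<gamma> * x) powr (- 1 / \<gamma> - 1)"
  proof -
    have "- 1 / \<gamma> * (1 + \<gamma>) = - 1 / \<gamma> - 1" using False by (simp add: field_simps)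
    then show ?thesis by (simp only: powr_powr)
  qed
  ultimately show ?thesis by simp
qed

lemma continuous_on_g_gev: "continuous_on (supp_gev \<gamma>) (g_gev \<gamma>)"
  using DERIV_g_gev DERIV_isCont by (intro continuous_at_imp_continuous_on) blast

lemma continuous_on_g_inv: "continuous_on {0<..} (g_inv \<gamma>)"
proof (cases "\<gamma> = 0")
  case True
  then have "g_inv \<gamma> = ln" by (auto simp: g_inv_def)
  then show ?thesis by (auto intro!: continuous_intros)
next
  case False
  then have "g_inv \<gamma> = (\<lambda>u. (1 - u powr (- \<gamma>)) / \<gamma>)" by (auto simp: g_inv_def)
  then show ?thesis using False by (auto intro!: continuous_intros)
qed

text \<open>For \<open>0 < \<alpha>\<close> the bands are compact, and they exhaust the support.\<close>

definition g_band :: "real \<Rightarrow> real \<Rightarrow> real \<Rightarrow> real set" where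
  "g_band \<gamma> \<alpha> \<beta> = {x \<in> supp_gev \<gamma>. \<alpha> \<le> g_gev \<gamma> x \<and> g_gev \<gamma> x \<le> \<beta>}"

lemma g_band_eq:
  assumes "0 < \<alpha>" "0 < \<beta>"
  shows "g_band \<gamma> \<alpha> \<beta> = {g_inv \<gamma> \<alpha>..g_inv \<gamma> \<beta>}"
proof -
  have "\<alpha> \<le> g_gev \<gamma> x \<longleftrightarrow> g_inv \<gamma> \<alpha> \<le> x" "g_gev \<gamma> x \<le> \<beta> \<longleftrightarrow> x \<le> g_inv \<gamma> \<beta>"
    if "x \<in> supp_gev \<gamma>" for x
    using that assms g_gev_le_iff[of "g_inv \<gamma> \<alpha>" \<gamma> x] g_gev_le_iff[of x \<gamma> "g_inv \<gamma> \<beta>"]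
    by (auto simp: g_inv_in_supp)
  moreover have "x \<in> supp_gev \<gamma>" if "g_inv \<gamma> \<alpha> \<le> x" "x \<le> g_inv \<gamma> \<beta>" for x
    using supp_gev_between[OF g_inv_in_supp g_inv_in_supp] assms that by blast
  ultimately show ?thesis by (auto simp: g_band_def)
qed

lemma compact_g_band: "0 < \<alpha> \<Longrightarrow> compact (g_band \<gamma> \<alpha> \<beta>)"
proof (cases "0 < \<beta>")
  case False
  assume "0 < \<alpha>"
  then have "g_band \<gamma> \<alpha> \<beta> = {}" using False by (auto simp: g_band_def)
  then show ?thesis by simp
qed (simp add: g_band_eq)

lemma g_band_subset: "g_band \<gamma> \<alpha> \<beta> \<subseteq> supp_gev \<gamma>"
  by (auto simp: g_band_def)

lemma compact_subset_g_band:
  assumes "compact K" "K \<subseteq> supp_gev \<gamma>"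
  obtains \<alpha> \<beta> where "0 < \<alpha>" "\<alpha> \<le> \<beta>" "K \<subseteq> g_band \<gamma> \<alpha> \<beta>"
proof (cases "K = {}")
  case True then show ?thesis using that[of 1 1] by simp
next
  case False
  have c: "continuous_on K (g_gev \<gamma>)" by (rule continuous_on_subset[OF continuous_on_g_gev assms(2)])
  obtain x where x: "x \<in> K" "\<And>y. y \<in> K \<Longrightarrow> g_gev \<gamma> x \<le> g_gev \<gamma> y"
    using continuous_attains_inf[OF assms(1) False c] by blast
  obtain z where z: "z \<in> K" "\<And>y. y \<in> K \<Longrightarrow> g_gev \<gamma> y \<le> g_gev \<gamma> z"
    using continuous_attains_sup[OF assms(1) False c] by blast
  show ?thesis
  proof (rule that)
    show "0 < g_gev \<gamma> x" using g_gev_pos x(1) assms(2) by blast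
    show "g_gev \<gamma> x \<le> g_gev \<gamma> z" using x z by blast
    show "K \<subseteq> g_band \<gamma> (g_gev \<gamma> x) (g_gev \<gamma> z)" using x z assms(2) by (auto simp: g_band_def)
  qed
qed

lemma compose_g_gev_test_function:
  assumes F: "continuous_on UNIV F" "\<And>u. 0 \<le> F u" and \<alpha>: "0 < \<alpha>"
    and supp: "\<And>u. F u \<noteq> 0 \<Longrightarrow> \<alpha> \<le> u \<and> u \<le> \<beta>"
  shows "(\<lambda>x. F (g_gev \<gamma> x)) \<in> test_functions (supp_gev \<gamma>)"
proof -
  have "continuous_on (supp_gev \<gamma>) (\<lambda>x. F (g_gev \<gamma> x))"
    using continuous_on_compose2[OF F(1) continuous_on_g_gev] by auto
  moreover have "\<forall>x\<in>supp_gev \<gamma> - g_band \<gamma> \<alpha> \<beta>. F (g_gev \<gamma> x) = 0"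
    using supp by (auto simp: g_band_def)
  ultimately show ?thesis
    using F(2) compact_g_band[OF \<alpha>, of \<gamma> \<beta>] g_band_subset[of \<gamma> \<alpha> \<beta>] unfolding test_functions_def by blast
qed

text \<open>In the coordinate \<open>g_gev \<gamma>\<close> the support becomes the positive half-line for every \<open>\<gamma>\<close>.
  Extended by 0, a test function is then a continuous function on the whole line whose support stays
  away from 0, and \<open>\<gamma>\<close> disappears from all approximation arguments.\<close>

lemma test_function_factor:
  assumes "f \<in> test_functions (supp_gev \<gamma>)"
  obtains F \<alpha> \<beta> where "continuous_on UNIV F" "\<And>u::real. (0::real) \<le> F u" "0 < \<alpha>"
    "\<And>u. F u \<noteq> 0 \<Longrightarrow> \<alpha> \<le> u \<and> u \<le> \<beta>" "\<And>x. x \<in> supp_gev \<gamma> \<Longrightarrow> f x = F (g_gev \<gamma> x)"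
proof -
  obtain K where f: "continuous_on (supp_gev \<gamma>) f" "\<And>x. x \<in> supp_gev \<gamma> \<Longrightarrow> 0 \<le> f x"
    and K: "compact K" "K \<subseteq> supp_gev \<gamma>" "\<And>x. x \<in> supp_gev \<gamma> - K \<Longrightarrow> f x = 0"
    using assms by (auto simp: test_functions_def)
  obtain \<alpha> \<beta> where \<alpha>: "0 < \<alpha>" "\<alpha> \<le> \<beta>" "K \<subseteq> g_band \<gamma> \<alpha> \<beta>"
    using compact_subset_g_band[OF K(1,2)] by blast
  define F where "F u = (if 0 < u then f (g_inv \<gamma> u) else 0)" for u
  have supp: "\<alpha> \<le> u \<and> u \<le> \<beta>" if "F u \<noteq> 0" for u
  proof -
    have u: "0 < u" "f (g_inv \<gamma> u) \<noteq> 0" using that by (auto simp: F_def split: if_splits)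
    then have "g_inv \<gamma> u \<in> K" using K(3) g_inv_in_supp by blast
    then show ?thesis using \<alpha>(3) u(1) by (auto simp: g_band_def)
  qed
  have "continuous_on {0<..} (\<lambda>u. f (g_inv \<gamma> u))"
    by (rule continuous_on_compose2[OF f(1) continuous_on_g_inv]) (auto intro: g_inv_in_supp)
  then have "continuous_on {0<..} F"
    by (rule continuous_on_eq) (simp add: F_def)
  moreover have "continuous_on {..<\<alpha>} F"
    by (rule continuous_on_eq[of _ "\<lambda>_. 0"]) (use supp in force)+
  ultimately have "continuous_on ({0<..} \<union> {..<\<alpha>}) F"
    by (intro continuous_on_open_Un) auto
  moreover have "{0<..} \<union> {..<\<alpha>} = UNIV" using \<alpha>(1) by auto
  ultimately have "continuous_on UNIV F" by simp
  moreover have "f x = F (g_gev \<gamma> x)" if "x \<in> supp_gev \<gamma>" for x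
    using that g_gev_pos by (simp add: F_def)
  moreover have "0 \<le> F u" for u using f(2) g_inv_in_supp by (simp add: F_def)
  ultimately show ?thesis using that \<alpha>(1) supp by blast
qed

lemma uniform_continuity_compact_support:
  fixes F :: "real \<Rightarrow> real"
  assumes F: "continuous_on UNIV F" and supp: "\<And>u. F u \<noteq> 0 \<Longrightarrow> \<alpha> \<le> u \<and> u \<le> \<beta>" and \<epsilon>: "0 < \<epsilon>"
  obtains \<delta> where "0 < \<delta>" "\<And>u v. \<bar>u - v\<bar> < \<delta> \<Longrightarrow> \<bar>F u - F v\<bar> < \<epsilon>"
proof -
  have "uniformly_continuous_on {\<alpha> - 1..\<beta> + 1} F"
    by (intro compact_uniformly_continuous continuous_on_subset[OF F]) auto
  then obtain d where d: "0 < d" "\<And>u v. u \<in> {\<alpha> - 1..\<beta> + 1} \<Longrightarrow> v \<in> {\<alpha> - 1..\<beta> + 1} \<Longrightarrow> \<bar>v - u\<bar> < d \<Longrightarrow> \<bar>F v - F u\<bar> < \<epsilon>"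
    using \<epsilon> unfolding uniformly_continuous_on_def dist_real_def by metis
  show ?thesis
  proof (rule that[of "min d 1"])
    fix u v :: real assume uv: "\<bar>u - v\<bar> < min d 1"
    show "\<bar>F u - F v\<bar> < \<epsilon>"
    proof (cases "F u = 0 \<and> F v = 0")
      case False
      then have "u \<in> {\<alpha> - 1..\<beta> + 1}" "v \<in> {\<alpha> - 1..\<beta> + 1}" using supp uv by force+
      then show ?thesis using d(2)[of v u] uv by auto
    qed (use \<epsilon> in simp)
  qed (use d in simp)
qed

text \<open>The dyadic hat function with peak at \<open>(k + 2) / 2 ^ m\<close>. The shift by 2 keeps the
  support away from 0, so that every tent, composed with \<open>g_gev \<gamma>\<close>, is a test function.\<close>

definition tent :: "nat \<Rightarrow> nat \<Rightarrow> real \<Rightarrow> real" where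
  "tent m k u = max 0 (1 - \<bar>2 ^ m * u - real (k + 2)\<bar>)"

lemma tent_nonneg: "0 \<le> tent m k u" and tent_le_1: "tent m k u \<le> 1"
  by (auto simp: tent_def)

lemma continuous_tent: "continuous_on A (tent m k)"
  unfolding tent_def by (intro continuous_intros)

lemma tent_nonzero: "tent m k u \<noteq> 0 \<Longrightarrow> \<bar>u - real (k + 2) / 2 ^ m\<bar> < 1 / 2 ^ m"
proof -
  assume "tent m k u \<noteq> 0"
  then have "\<bar>2 ^ m * u - real (k + 2)\<bar> < 1" by (auto simp: tent_def max_def split: if_splits)
  moreover have "u - real (k + 2) / 2 ^ m = (2 ^ m * u - real (k + 2)) / 2 ^ m" by (simp add: field_simps)
  ultimately show ?thesis by (simp add: abs_divide divide_strict_right_mono)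
qed

lemma tent_support: "tent m k u \<noteq> 0 \<Longrightarrow> 1 / 2 ^ m \<le> u \<and> u \<le> real (k + 3) / 2 ^ m"
proof -
  assume "tent m k u \<noteq> 0"
  then have "1 \<le> 2 ^ m * u" "2 ^ m * u \<le> real (k + 3)" by (auto simp: tent_def max_def split: if_splits)
  then show ?thesis by (simp add: field_simps)
qed

text \<open>Away from 0 the tents of one level are a partition of unity. The value beyond the last full
  peak is stated because the induction on \<open>N\<close> needs it.\<close>

lemma sum_tent:
  assumes "2 \<le> 2 ^ m * u"
  shows "(\<Sum>k<N. tent m k u) = (if 2 ^ m * u \<le> real (N + 1) then 1 else max 0 (real (N + 2) - 2 ^ m * u))"
  using assms by (induction N) (auto simp: tent_def max_def split: if_splits)

lemma sum_tent_eq_1: "2 \<le> 2 ^ m * u \<Longrightarrow> 2 ^ m * u \<le> real (N + 1) \<Longrightarrow> (\<Sum>k<N. tent m k u) = 1"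
  by (simp add: sum_tent)

lemma tent_cover:
  assumes "0 < \<alpha>"
  obtains m N where "\<And>m' u. m \<le> m' \<Longrightarrow> \<alpha> \<le> u \<Longrightarrow> 2 \<le> 2 ^ m' * u"
    "\<And>u. \<alpha> \<le> u \<Longrightarrow> u \<le> \<beta> \<Longrightarrow> (\<Sum>k<N. tent m k u) = 1"
proof -
  obtain m where m: "2 / \<alpha> < 2 ^ m" using real_arch_pow[of 2 "2 / \<alpha>"] by auto
  have 1: "2 \<le> 2 ^ m' * u" if "m \<le> m'" "\<alpha> \<le> u" for m' u
  proof -
    have "2 < 2 ^ m * \<alpha>" using m assms by (simp add: field_simps)
    also have "\<dots> \<le> 2 ^ m' * u" using that assms by (intro mult_mono power_increasing) auto
    finally show ?thesis by simp
  qed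
  obtain N :: nat where N: "2 ^ m * \<beta> \<le> real N" using real_arch_simple by blast
  have "(\<Sum>k<N. tent m k u) = 1" if "\<alpha> \<le> u" "u \<le> \<beta>" for u
  proof (rule sum_tent_eq_1[OF 1[OF order_refl that(1)]])
    have "2 ^ m * u \<le> 2 ^ m * \<beta>" using that by simp
    then show "2 ^ m * u \<le> real (N + 1)" using N by linarith
  qed
  then show ?thesis using that 1 by blast
qed

text \<open>The error of the piecewise linear interpolation is bounded by a multiple of one fixed sum of
  tents and not by a constant: its integral against an infinite measure is then controlled by
  finitely many tent integrals, uniformly in the accuracy.\<close>

lemma tent_approximation:
  fixes F :: "real \<Rightarrow> real"
  assumes F: "continuous_on UNIV F" and \<alpha>: "0 < \<alpha>"
    and supp: "\<And>u. F u \<noteq> 0 \<Longrightarrow> \<alpha> \<le> u \<and> u \<le> \<beta>"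
  obtains m0 N0 where "\<And>\<epsilon>. 0 < \<epsilon> \<Longrightarrow> \<exists>m N c. \<forall>u. \<bar>F u - (\<Sum>k<N. c k * tent m k u)\<bar> \<le> \<epsilon> * (\<Sum>k<N0. tent m0 k u)"
proof -
  obtain m0 N0 where 0: "\<And>m' u. m0 \<le> m' \<Longrightarrow> \<alpha> / 2 \<le> u \<Longrightarrow> 2 \<le> 2 ^ m' * u"
      "\<And>u. \<alpha> / 2 \<le> u \<Longrightarrow> u \<le> \<beta> + 1 \<Longrightarrow> (\<Sum>k<N0. tent m0 k u) = 1"
    using tent_cover[of "\<alpha> / 2" "\<beta> + 1"] \<alpha> by auto
  show ?thesis
  proof (rule that[of m0 N0])
    fix \<epsilon> :: real assume \<epsilon>: "0 < \<epsilon>"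
    obtain \<delta> where \<delta>: "0 < \<delta>" "\<And>u v. \<bar>u - v\<bar> < \<delta> \<Longrightarrow> \<bar>F u - F v\<bar> < \<epsilon>"
      using uniform_continuity_compact_support[OF F supp \<epsilon>] by blast
    obtain m1 where m1: "(1 / 2) ^ m1 < min \<delta> (min (\<alpha> / 2) 1)"
      using real_arch_pow_inv[of "min \<delta> (min (\<alpha> / 2) 1)" "1 / 2"] \<delta> \<alpha> by auto
    define m where "m = max m0 m1"
    have "(1 / 2) ^ m \<le> ((1 / 2) ^ m1 :: real)" by (intro power_decreasing) (auto simp: m_def)
    then have m: "1 / 2 ^ m < \<delta>" "1 / 2 ^ m < \<alpha> / 2" "1 / 2 ^ m < (1::real)"
      using m1 unfolding power_one_over[symmetric] by linarith+
    obtain N :: nat where N: "2 ^ m * (\<beta> + 1) \<le> real N" using real_arch_simple by blast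
    define c where "c k = F (real (k + 2) / 2 ^ m)" for k
    have "\<bar>F u - (\<Sum>k<N. c k * tent m k u)\<bar> \<le> \<epsilon> * (\<Sum>k<N0. tent m0 k u)" for u
    proof (cases "\<alpha> / 2 \<le> u \<and> u \<le> \<beta> + 1")
      case True
      have T1: "(\<Sum>k<N. tent m k u) = 1"
      proof (rule sum_tent_eq_1)
        show "2 \<le> 2 ^ m * u" using 0(1) True by (simp add: m_def)
        have "2 ^ m * u \<le> 2 ^ m * (\<beta> + 1)" using True by simp
        then show "2 ^ m * u \<le> real (N + 1)" using N by linarith
      qed
      have "F u - (\<Sum>k<N. c k * tent m k u) = (\<Sum>k<N. (F u - c k) * tent m k u)"
        using T1 by (simp add: left_diff_distrib sum_subtractf flip: sum_distrib_left)
      also have "\<bar>\<dots>\<bar> \<le> (\<Sum>k<N. \<epsilon> * tent m k u)"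
      proof (rule order_trans[OF sum_abs sum_mono])
        fix k
        show "\<bar>(F u - c k) * tent m k u\<bar> \<le> \<epsilon> * tent m k u"
        proof (cases "tent m k u = 0")
          case False
          then have "\<bar>F u - c k\<bar> < \<epsilon>" unfolding c_def using \<delta>(2) tent_nonzero m(1) by (meson less_trans)
          then show ?thesis using tent_nonneg[of m k u] by (simp add: abs_mult mult_right_mono)
        qed simp
      qed
      also have "\<dots> = \<epsilon>" using T1 by (simp flip: sum_distrib_left)
      finally show ?thesis using 0(2) True by simp
    next
      case False
      then have F0: "F u = 0" using supp[of u] \<alpha> by force
      have "c k * tent m k u = 0" for k
      proof (rule ccontr)
        assume "c k * tent m k u \<noteq> 0"
        then have "\<alpha> \<le> real (k + 2) / 2 ^ m \<and> real (k + 2) / 2 ^ m \<le> \<beta>" "\<bar>u - real (k + 2) / 2 ^ m\<bar> < 1 / 2 ^ m"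
          using supp tent_nonzero by (auto simp: c_def simp del: of_nat_add)
        then show False using False m by linarith
      qed
      then have "(\<Sum>k<N. c k * tent m k u) = 0" by (intro sum.neutral) simp
      then show ?thesis using F0 \<epsilon> tent_nonneg by (simp add: sum_nonneg)
    qed
    then show "\<exists>m N c. \<forall>u. \<bar>F u - (\<Sum>k<N. c k * tent m k u)\<bar> \<le> \<epsilon> * (\<Sum>k<N0. tent m0 k u)" by blast
  qed
qed

section \<open>The vague topology as an initial topology\<close>

lemma compact_support_bounded:
  fixes F :: "real \<Rightarrow> real"
  assumes F: "continuous_on UNIV F" and supp: "\<And>u. F u \<noteq> 0 \<Longrightarrow> \<alpha> \<le> u \<and> u \<le> \<beta>"
  obtains B where "\<And>u. \<bar>F u\<bar> \<le> B"
proof -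
  have "bounded (F ` {\<alpha>..\<beta>})"
    by (intro compact_imp_bounded compact_continuous_image continuous_on_subset[OF F]) auto
  then obtain B where B: "\<forall>u\<in>{\<alpha>..\<beta>}. \<bar>F u\<bar> \<le> B" by (auto simp: bounded_iff)
  have "\<bar>F u\<bar> \<le> max 0 B" for u
    using B supp[of u] by (cases "F u = 0") (auto simp: le_max_iff_disj)
  then show ?thesis by (rule that)
qed

lemma measurable_g_gev [measurable]: "g_gev \<gamma> \<in> borel_measurable (restrict_space borel (supp_gev \<gamma>))"
  by (rule borel_measurable_continuous_on_restrict[OF continuous_on_g_gev])

lemma measurable_g_gev_radon:
  assumes "\<mu> \<in> radon_measures (supp_gev \<gamma>)"
  shows "g_gev \<gamma> \<in> borel_measurable \<mu>"
proof -
  have "sets \<mu> = sets (restrict_space borel (supp_gev \<gamma>))" using assms by (simp add: radon_measures_def)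
  then show ?thesis using measurable_g_gev[of \<gamma>] measurable_cong_sets by blast
qed

lemma space_radon: "\<mu> \<in> radon_measures (supp_gev \<gamma>) \<Longrightarrow> space \<mu> = supp_gev \<gamma>"
  by (auto simp: radon_measures_def dest!: sets_eq_imp_space_eq simp: space_restrict_space)

lemma sets_g_band: "g_band \<gamma> \<alpha> \<beta> \<in> sets (restrict_space borel (supp_gev \<gamma>))"
proof -
  have "g_band \<gamma> \<alpha> \<beta> = {x \<in> space (restrict_space borel (supp_gev \<gamma>)). \<alpha> \<le> g_gev \<gamma> x \<and> g_gev \<gamma> x \<le> \<beta>}"
    by (auto simp: g_band_def space_restrict_space)
  also have "\<dots> \<in> sets (restrict_space borel (supp_gev \<gamma>))" by measurable
  finally show ?thesis .
qed

lemma integrable_compose_g_gev: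
  assumes \<mu>: "\<mu> \<in> radon_measures (supp_gev \<gamma>)"
    and F: "F \<in> borel_measurable borel" "\<And>u. \<bar>F u\<bar> \<le> B" and \<alpha>: "0 < \<alpha>"
    and supp: "\<And>u. F u \<noteq> 0 \<Longrightarrow> \<alpha> \<le> u \<and> u \<le> (\<beta>::real)"
  shows "integrable \<mu> (\<lambda>x. F (g_gev \<gamma> x) :: real)"
proof -
  have Fg: "(\<lambda>x. F (g_gev \<gamma> x)) \<in> borel_measurable \<mu>"
    by (rule measurable_compose[OF measurable_g_gev_radon[OF \<mu>] F(1)])
  show ?thesis
  proof (rule integrableI_bounded_set[of "g_band \<gamma> \<alpha> \<beta>"])
    show "g_band \<gamma> \<alpha> \<beta> \<in> sets \<mu>" using \<mu> sets_g_band by (simp add: radon_measures_def)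
    show "emeasure \<mu> (g_band \<gamma> \<alpha> \<beta>) < \<infinity>"
    proof -
      have "\<forall>K. compact K \<and> K \<subseteq> supp_gev \<gamma> \<longrightarrow> emeasure \<mu> K < \<infinity>" using \<mu> by (simp add: radon_measures_def)
      then show ?thesis using compact_g_band[OF \<alpha>, of \<gamma> \<beta>] g_band_subset[of \<gamma> \<alpha> \<beta>] by blast
    qed
    show "AE x in \<mu>. x \<in> g_band \<gamma> \<alpha> \<beta> \<longrightarrow> norm (F (g_gev \<gamma> x)) \<le> B" using F(2) by simp
    show "AE x in \<mu>. x \<notin> g_band \<gamma> \<alpha> \<beta> \<longrightarrow> F (g_gev \<gamma> x) = 0"
    proof (rule AE_I2, rule impI, rule ccontr)
      fix x assume "x \<in> space \<mu>" "x \<notin> g_band \<gamma> \<alpha> \<beta>" "F (g_gev \<gamma> x) \<noteq> 0"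
      then show False using supp[of "g_gev \<gamma> x"] by (auto simp: g_band_def space_radon[OF \<mu>])
    qed
  qed (rule Fg)
qed

text \<open>The countably many coordinates that generate the vague topology, as one point of a
  metrizable sequence space.\<close>

definition tent_integral :: "real \<Rightarrow> real measure \<Rightarrow> nat \<Rightarrow> real" where
  "tent_integral \<gamma> \<mu> i = (\<integral>x. tent (fst (prod_decode i)) (snd (prod_decode i)) (g_gev \<gamma> x) \<partial>\<mu>)"

lemma tent_integral_encode:
  "tent_integral \<gamma> \<mu> (prod_encode (m, k)) = (\<integral>x. tent m k (g_gev \<gamma> x) \<partial>\<mu>)"
  by (simp add: tent_integral_def)

lemma integrable_tent:
  "\<mu> \<in> radon_measures (supp_gev \<gamma>) \<Longrightarrow> integrable \<mu> (\<lambda>x. tent m k (g_gev \<gamma> x))"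
  using tent_nonneg tent_le_1 tent_support
  by (intro integrable_compose_g_gev[where F="tent m k" and B=1 and \<alpha>="1 / 2 ^ m" and \<beta>="real (k + 3) / 2 ^ m"])
     (auto intro!: borel_measurable_continuous_onI continuous_tent)

lemma tent_integral_nonneg: "0 \<le> tent_integral \<gamma> \<mu> i"
  unfolding tent_integral_def by (simp add: tent_nonneg)

lemma continuous_coordinate: "continuous_on UNIV (\<lambda>y::nat \<Rightarrow> real. y i)"
  by (rule continuous_on_product_coordinates)

text \<open>Interpolation by tents turns the integral of a test function into a finite linear
  combination of coordinates, up to an error proportional to the total of finitely many other
  coordinates. Bounding these by their value at \<open>\<mu>0\<close> plus 1 keeps the error small on a whole
  neighbourhood.\<close>

lemma test_integral_local:
  assumes f: "f \<in> test_functions (supp_gev \<gamma>)" and \<mu>0: "\<mu>0 \<in> radon_measures (supp_gev \<gamma>)" and \<epsilon>: "0 < \<epsilon>"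
  obtains W where "open W" "tent_integral \<gamma> \<mu>0 \<in> W"
    "\<And>\<mu>. \<mu> \<in> radon_measures (supp_gev \<gamma>) \<Longrightarrow> tent_integral \<gamma> \<mu> \<in> W \<Longrightarrow> \<bar>(\<integral>x. f x \<partial>\<mu>) - (\<integral>x. f x \<partial>\<mu>0)\<bar> < \<epsilon>"
proof -
  obtain F \<alpha> \<beta> where F: "continuous_on UNIV F" "0 < \<alpha>" "\<And>u. F u \<noteq> 0 \<Longrightarrow> \<alpha> \<le> u \<and> u \<le> \<beta>"
      "\<And>x. x \<in> supp_gev \<gamma> \<Longrightarrow> f x = F (g_gev \<gamma> x)"
    using test_function_factor[OF f] by metis
  obtain B where B: "\<And>u. \<bar>F u\<bar> \<le> B" using compact_support_bounded[OF F(1,3)] by blast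
  obtain m0 N0 where approx: "\<And>\<epsilon>. 0 < \<epsilon> \<Longrightarrow>
      \<exists>m N c. \<forall>u. \<bar>F u - (\<Sum>k<N. c k * tent m k u)\<bar> \<le> \<epsilon> * (\<Sum>k<N0. tent m0 k u)"
    using tent_approximation[OF F(1-3)] by blast
  define T where "T y = (\<Sum>k<N0. y (prod_encode (m0, k)))" for y :: "nat \<Rightarrow> real"
  let ?\<Phi> = "tent_integral \<gamma>"
  have T0: "0 \<le> T (?\<Phi> \<mu>)" for \<mu> by (simp add: T_def sum_nonneg tent_integral_nonneg)
  define \<epsilon>' where "\<epsilon>' = \<epsilon> / 3 / (T (?\<Phi> \<mu>0) + 1)"
  have \<epsilon>': "0 < \<epsilon>'" using \<epsilon> T0[of \<mu>0] by (simp add: \<epsilon>'_def)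
  obtain m N c where c: "\<And>u. \<bar>F u - (\<Sum>k<N. c k * tent m k u)\<bar> \<le> \<epsilon>' * (\<Sum>k<N0. tent m0 k u)"
    using approx[OF \<epsilon>'] by blast
  define G where "G y = (\<Sum>k<N. c k * y (prod_encode (m, k)))" for y :: "nat \<Rightarrow> real"
  have est: "\<bar>(\<integral>x. f x \<partial>\<mu>) - G (?\<Phi> \<mu>)\<bar> \<le> \<epsilon>' * T (?\<Phi> \<mu>)" if \<mu>: "\<mu> \<in> radon_measures (supp_gev \<gamma>)" for \<mu>
  proof -
    have fF: "(\<integral>x. f x \<partial>\<mu>) = (\<integral>x. F (g_gev \<gamma> x) \<partial>\<mu>)"
      by (intro Bochner_Integration.integral_cong) (auto simp: space_radon[OF \<mu>] F(4))
    have iF: "integrable \<mu> (\<lambda>x. F (g_gev \<gamma> x))"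
      by (rule integrable_compose_g_gev[OF \<mu> borel_measurable_continuous_onI[OF F(1)] B F(2,3)])
    have iT: "integrable \<mu> (\<lambda>x. tent m k (g_gev \<gamma> x))" for m k by (rule integrable_tent[OF \<mu>])
    have G: "G (?\<Phi> \<mu>) = (\<integral>x. (\<Sum>k<N. c k * tent m k (g_gev \<gamma> x)) \<partial>\<mu>)"
      using iT by (simp add: G_def tent_integral_encode)
    have T: "\<epsilon>' * T (?\<Phi> \<mu>) = (\<integral>x. \<epsilon>' * (\<Sum>k<N0. tent m0 k (g_gev \<gamma> x)) \<partial>\<mu>)"
      using iT by (simp add: T_def tent_integral_encode)
    have "(\<integral>x. f x \<partial>\<mu>) - G (?\<Phi> \<mu>) = (\<integral>x. F (g_gev \<gamma> x) - (\<Sum>k<N. c k * tent m k (g_gev \<gamma> x)) \<partial>\<mu>)"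
      unfolding fF G using iF iT by (intro Bochner_Integration.integral_diff[symmetric]) auto
    also have "\<bar>\<dots>\<bar> \<le> (\<integral>x. \<bar>F (g_gev \<gamma> x) - (\<Sum>k<N. c k * tent m k (g_gev \<gamma> x))\<bar> \<partial>\<mu>)"
      by (rule integral_abs_bound)
    also have "\<dots> \<le> (\<integral>x. \<epsilon>' * (\<Sum>k<N0. tent m0 k (g_gev \<gamma> x)) \<partial>\<mu>)"
      using iF iT c by (intro integral_mono) auto
    finally show ?thesis unfolding T .
  qed
  define W where "W = {y. \<bar>G y - G (?\<Phi> \<mu>0)\<bar> < \<epsilon> / 3 \<and> T y < T (?\<Phi> \<mu>0) + 1}"
  show ?thesis
  proof (rule that[of W])
    show "open W" unfolding W_def G_def T_def
      by (intro open_Collect_conj open_Collect_less continuous_intros continuous_coordinate)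
    show "?\<Phi> \<mu>0 \<in> W" using \<epsilon> by (simp add: W_def)
    fix \<mu> assume \<mu>: "\<mu> \<in> radon_measures (supp_gev \<gamma>)" and W: "?\<Phi> \<mu> \<in> W"
    have "\<epsilon>' * T (?\<Phi> \<mu>) \<le> \<epsilon>' * (T (?\<Phi> \<mu>0) + 1)" "\<epsilon>' * T (?\<Phi> \<mu>0) \<le> \<epsilon>' * (T (?\<Phi> \<mu>0) + 1)"
      using W \<epsilon>' by (auto simp: W_def intro!: mult_left_mono)
    moreover have "\<epsilon>' * (T (?\<Phi> \<mu>0) + 1) = \<epsilon> / 3"
    proof -
      have "a / D * D = a" if "D \<noteq> 0" for a D :: real using that by simp
      then show ?thesis using T0[of \<mu>0] unfolding \<epsilon>'_def by (metis add_nonneg_pos less_numeral_extra(1) less_numeral_extra(3))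
    qed
    moreover have "\<bar>G (?\<Phi> \<mu>) - G (?\<Phi> \<mu>0)\<bar> < \<epsilon> / 3" using W by (simp add: W_def)
    ultimately show "\<bar>(\<integral>x. f x \<partial>\<mu>) - (\<integral>x. f x \<partial>\<mu>0)\<bar> < \<epsilon>"
      using est[OF \<mu>] est[OF \<mu>0] by linarith
  qed
qed

text \<open>Uncountably many test functions define the vague topology, but the tents suffice: it is the
  initial topology of \<open>tent_integral \<gamma>\<close>. This yields both a countable criterion for Borel
  measurability (\<open>measurable_into_vague\<close>) and a pseudo-metric (\<open>continuous_vague_metric\<close>).\<close>

lemma vague_open_pullback:
  assumes "openin (vague_topology (supp_gev \<gamma>)) U"
  shows "\<exists>W. open W \<and> U = {\<mu> \<in> radon_measures (supp_gev \<gamma>). tent_integral \<gamma> \<mu> \<in> W}"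
proof -
  let ?A = "radon_measures (supp_gev \<gamma>)" and ?\<Phi> = "tent_integral \<gamma>"
  let ?B = "{{\<mu> \<in> ?A. (\<integral>x. f x \<partial>\<mu>) \<in> V} | f V. f \<in> test_functions (supp_gev \<gamma>) \<and> open V}"
  have "generate_topology_on ?B U"
    using assms by (simp add: vague_topology_def openin_topology_generated_by_iff)
  then show ?thesis
  proof induction
    case Empty show ?case by (intro exI[of _ "{}"]) auto
  next
    case (Int a b)
    then obtain V W where "open V" "a = {\<mu> \<in> ?A. ?\<Phi> \<mu> \<in> V}" "open W" "b = {\<mu> \<in> ?A. ?\<Phi> \<mu> \<in> W}" by blast
    then show ?case by (intro exI[of _ "V \<inter> W"]) auto
  next
    case (UN K)
    then have "\<forall>k\<in>K. \<exists>W. open W \<and> k = {\<mu> \<in> ?A. ?\<Phi> \<mu> \<in> W}" by blast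
    from bchoice[OF this] obtain W where W: "\<And>k. k \<in> K \<Longrightarrow> open (W k) \<and> k = {\<mu> \<in> ?A. ?\<Phi> \<mu> \<in> W k}"
      by (elim exE) (rule that, erule bspec)
    have "\<mu> \<in> k \<longleftrightarrow> \<mu> \<in> ?A \<and> ?\<Phi> \<mu> \<in> W k" if "k \<in> K" for \<mu> k
      using arg_cong[OF conjunct2[OF W[OF that]], of "\<lambda>s. \<mu> \<in> s"] by simp
    then have "\<Union>K = {\<mu> \<in> ?A. ?\<Phi> \<mu> \<in> (\<Union>k\<in>K. W k)}" by blast
    moreover have "open (\<Union>k\<in>K. W k)" using conjunct1[OF W] by (intro open_UN ballI)
    ultimately show ?case by (intro exI[of _ "\<Union>k\<in>K. W k"] conjI)
  next
    case (Basis s)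
    then obtain f V where s: "s = {\<mu> \<in> ?A. (\<integral>x. f x \<partial>\<mu>) \<in> V}" and f: "f \<in> test_functions (supp_gev \<gamma>)" and V: "open V"
      by auto
    let ?O = "\<Union>{W. open W \<and> {\<mu> \<in> ?A. ?\<Phi> \<mu> \<in> W} \<subseteq> s}"
    have "\<exists>W. open W \<and> ?\<Phi> \<mu>0 \<in> W \<and> {\<mu> \<in> ?A. ?\<Phi> \<mu> \<in> W} \<subseteq> s" if \<mu>0: "\<mu>0 \<in> s" for \<mu>0
    proof -
      have \<mu>A: "\<mu>0 \<in> ?A" and "(\<integral>x. f x \<partial>\<mu>0) \<in> V" using \<mu>0 s by auto
      then obtain \<epsilon> where \<epsilon>: "0 < \<epsilon>" "\<And>y. dist y (\<integral>x. f x \<partial>\<mu>0) < \<epsilon> \<Longrightarrow> y \<in> V"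
        using V unfolding open_dist by blast
      obtain W where "open W" "?\<Phi> \<mu>0 \<in> W"
        "\<And>\<mu>. \<mu> \<in> ?A \<Longrightarrow> ?\<Phi> \<mu> \<in> W \<Longrightarrow> \<bar>(\<integral>x. f x \<partial>\<mu>) - (\<integral>x. f x \<partial>\<mu>0)\<bar> < \<epsilon>"
        using test_integral_local[OF f \<mu>A \<epsilon>(1)] by blast
      then show ?thesis using \<epsilon>(2) by (intro exI[of _ W]) (auto simp: s dist_real_def)
    qed
    note nbhd = this
    have "s = {\<mu> \<in> ?A. ?\<Phi> \<mu> \<in> ?O}"
    proof (intro subset_antisym subsetI)
      fix \<mu> assume \<mu>: "\<mu> \<in> s"
      then have "\<mu> \<in> ?A" by (simp add: s)
      then show "\<mu> \<in> {\<mu> \<in> ?A. ?\<Phi> \<mu> \<in> ?O}" using nbhd[OF \<mu>] by auto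
    next
      fix \<mu> assume "\<mu> \<in> {\<mu> \<in> ?A. ?\<Phi> \<mu> \<in> ?O}"
      then obtain W where W: "\<mu> \<in> ?A" "?\<Phi> \<mu> \<in> W" "{\<mu> \<in> ?A. ?\<Phi> \<mu> \<in> W} \<subseteq> s" by auto
      show "\<mu> \<in> s" by (rule subsetD[OF W(3)]) (simp add: W)
    qed
    then show ?case by (intro exI[of _ ?O] conjI) auto
  qed
qed

lemma space_borel_of: "space (borel_of T) = topspace T"
  unfolding borel_of_def by (rule space_measure_of) (auto dest: openin_subset)

lemma openin_in_sets_borel_of: "openin T U \<Longrightarrow> U \<in> sets (borel_of T)"
  unfolding borel_of_def by (subst sets_measure_of) (auto dest: openin_subset)

lemma continuous_map_measurable_borel_of:
  assumes "continuous_map T euclidean h"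
  shows "h \<in> borel_measurable (borel_of T)"
proof (rule borel_measurableI)
  fix U :: "'b set" assume "open U"
  then have op: "openin T {x \<in> topspace T. h x \<in> U}"
    by (intro openin_continuous_map_preimage[OF assms]) (rule open_openin[THEN iffD1])
  have eq: "{x \<in> topspace T. h x \<in> U} = h -` U \<inter> space (borel_of T)"
    by (auto simp: space_borel_of)
  show "h -` U \<inter> space (borel_of T) \<in> sets (borel_of T)"
    unfolding eq[symmetric] by (rule openin_in_sets_borel_of[OF op])
qed

lemma continuous_map_test_integral:
  assumes "f \<in> test_functions S"
  shows "continuous_map (vague_topology S) euclideanreal (\<lambda>\<mu>. \<integral>x. f x \<partial>\<mu>)"
  unfolding continuous_map_def topspace_vague_topology
proof (intro conjI allI impI)
  fix U :: "real set" assume "openin euclideanreal U"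
  then have "open U" by (rule open_openin[THEN iffD2])
  then show "openin (vague_topology S) {\<mu> \<in> radon_measures S. (\<integral>x. f x \<partial>\<mu>) \<in> U}"
    unfolding vague_topology_def openin_topology_generated_by_iff
    using assms by (intro generate_topology_on.Basis) blast
qed auto

lemma tent_test_function: "(\<lambda>x. tent m k (g_gev \<gamma> x)) \<in> test_functions (supp_gev \<gamma>)"
  by (rule compose_g_gev_test_function[OF continuous_tent tent_nonneg _ tent_support]) auto

lemma measurable_tent_integral_vague:
  "(\<lambda>\<mu>. tent_integral \<gamma> \<mu>) \<in> borel_measurable (borel_of (vague_topology (supp_gev \<gamma>)))"
proof (rule measurable_coordinatewise_then_product)
  fix i show "(\<lambda>\<mu>. tent_integral \<gamma> \<mu> i) \<in> borel_measurable (borel_of (vague_topology (supp_gev \<gamma>)))"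
    unfolding tent_integral_def
    by (rule continuous_map_measurable_borel_of[OF continuous_map_test_integral[OF tent_test_function]])
qed

lemma measurable_into_vague:
  assumes \<zeta>: "\<And>\<omega>. \<omega> \<in> space M \<Longrightarrow> \<zeta> \<omega> \<in> radon_measures (supp_gev \<gamma>)"
    and coord: "\<And>m k. (\<lambda>\<omega>. \<integral>x. tent m k (g_gev \<gamma> x) \<partial>\<zeta> \<omega>) \<in> borel_measurable M"
  shows "\<zeta> \<in> measurable M (borel_of (vague_topology (supp_gev \<gamma>)))"
  unfolding borel_of_def
proof (rule measurable_measure_of)
  show "\<zeta> \<in> space M \<rightarrow> topspace (vague_topology (supp_gev \<gamma>))"
    using \<zeta> by (simp add: topspace_vague_topology)
  fix U assume "U \<in> {U. openin (vague_topology (supp_gev \<gamma>)) U}"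
  then obtain W where W: "open W" "U = {\<mu> \<in> radon_measures (supp_gev \<gamma>). tent_integral \<gamma> \<mu> \<in> W}"
    using vague_open_pullback by blast
  have "(\<lambda>\<omega>. tent_integral \<gamma> (\<zeta> \<omega>)) \<in> borel_measurable M"
    by (rule measurable_coordinatewise_then_product) (simp add: tent_integral_def coord)
  then have "(\<lambda>\<omega>. tent_integral \<gamma> (\<zeta> \<omega>)) -` W \<inter> space M \<in> sets M"
    using W(1) by (intro measurable_sets) auto
  also have "(\<lambda>\<omega>. tent_integral \<gamma> (\<zeta> \<omega>)) -` W \<inter> space M = \<zeta> -` U \<inter> space M"
    using \<zeta> by (auto simp: W(2))
  finally show "\<zeta> -` U \<inter> space M \<in> sets M" .
qed (auto dest: openin_subset)

lemma continuous_vague_metric: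
  assumes h: "continuous_map (vague_topology (supp_gev \<gamma>)) euclideanreal h"
    and \<mu>: "\<mu> \<in> radon_measures (supp_gev \<gamma>)" and \<epsilon>: "0 < \<epsilon>"
  shows "\<exists>\<delta>>0. \<forall>\<nu>\<in>radon_measures (supp_gev \<gamma>). dist (tent_integral \<gamma> \<nu>) (tent_integral \<gamma> \<mu>) < \<delta> \<longrightarrow> \<bar>h \<nu> - h \<mu>\<bar> < \<epsilon>"
proof -
  let ?A = "radon_measures (supp_gev \<gamma>)"
  have "openin (vague_topology (supp_gev \<gamma>)) {\<nu> \<in> topspace (vague_topology (supp_gev \<gamma>)). h \<nu> \<in> ball (h \<mu>) \<epsilon>}"
    by (intro openin_continuous_map_preimage[OF h] open_openin[THEN iffD1] open_ball)
  then obtain W where W: "open W" "{\<nu> \<in> ?A. h \<nu> \<in> ball (h \<mu>) \<epsilon>} = {\<nu> \<in> ?A. tent_integral \<gamma> \<nu> \<in> W}"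
    using vague_open_pullback[of \<gamma> "{\<nu> \<in> ?A. h \<nu> \<in> ball (h \<mu>) \<epsilon>}"] unfolding topspace_vague_topology by auto
  have "\<mu> \<in> {\<nu> \<in> ?A. h \<nu> \<in> ball (h \<mu>) \<epsilon>}" using \<mu> \<epsilon> by simp
  then have "tent_integral \<gamma> \<mu> \<in> W" unfolding W(2) by simp
  then obtain \<delta> where \<delta>: "0 < \<delta>" "\<And>y. dist y (tent_integral \<gamma> \<mu>) < \<delta> \<Longrightarrow> y \<in> W"
    using W(1) unfolding open_dist by blast
  have "\<bar>h \<nu> - h \<mu>\<bar> < \<epsilon>" if "\<nu> \<in> ?A" "dist (tent_integral \<gamma> \<nu>) (tent_integral \<gamma> \<mu>) < \<delta>" for \<nu>
  proof -
    have "\<nu> \<in> {\<nu> \<in> ?A. h \<nu> \<in> ball (h \<mu>) \<epsilon>}" unfolding W(2) using that \<delta>(2) by simp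
    then show ?thesis by (simp add: dist_real_def abs_minus_commute)
  qed
  then show ?thesis using \<delta>(1) by blast
qed

section \<open>Weak convergence tested on Lipschitz functions\<close>

text \<open>The Pasch-Hausdorff regularization: a bounded function that is continuous with respect to
  the pseudo-metric pulled back along \<open>\<Phi>\<close> is the increasing limit, as \<open>k\<close> grows, of functions
  that are \<open>k\<close>-Lipschitz on the whole target space. Truncation at \<open>c\<close> makes them bounded also outside the image of \<open>\<Phi>\<close>.\<close>

lemma inf_convolution:
  fixes \<Phi> :: "'s \<Rightarrow> 'm::metric_space" and h :: "'s \<Rightarrow> real"
  assumes "A \<noteq> {}" and bdd: "\<forall>\<mu>\<in>A. \<bar>h \<mu>\<bar> \<le> c" and k: "0 \<le> k"
  defines "H \<equiv> \<lambda>y. min c (INF \<mu>\<in>A. h \<mu> + k * dist (\<Phi> \<mu>) y)"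
  shows "\<And>y z. \<bar>H y - H z\<bar> \<le> k * dist y z"
    and "\<And>y. \<bar>H y\<bar> \<le> c"
    and "\<And>\<mu>. \<mu> \<in> A \<Longrightarrow> H (\<Phi> \<mu>) \<le> h \<mu>"
    and "\<And>\<mu> \<epsilon> \<delta>. \<mu> \<in> A \<Longrightarrow> 0 \<le> \<epsilon> \<Longrightarrow> (\<And>\<nu>. \<nu> \<in> A \<Longrightarrow> dist (\<Phi> \<nu>) (\<Phi> \<mu>) < \<delta> \<Longrightarrow> h \<mu> - \<epsilon> \<le> h \<nu>) \<Longrightarrow>
           2 * c \<le> k * \<delta> \<Longrightarrow> h \<mu> - \<epsilon> \<le> H (\<Phi> \<mu>)"
proof -
  let ?I = "\<lambda>y. INF \<mu>\<in>A. h \<mu> + k * dist (\<Phi> \<mu>) y"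
  have lower: "- c \<le> h \<mu> + k * dist (\<Phi> \<mu>) y" if "\<mu> \<in> A" for \<mu> y
    using bspec[OF bdd that] k by (smt (verit) mult_nonneg_nonneg zero_le_dist)
  have bb: "bdd_below ((\<lambda>\<mu>. h \<mu> + k * dist (\<Phi> \<mu>) y) ` A)" for y
    using lower by (auto intro!: bdd_belowI2)
  have I_le: "?I y \<le> h \<mu> + k * dist (\<Phi> \<mu>) y" if "\<mu> \<in> A" for \<mu> y
    by (rule cINF_lower[OF bb that])
  have step: "?I y \<le> ?I z + k * dist y z" for y z
  proof -
    have "?I y - k * dist y z \<le> ?I z"
    proof (rule cINF_greatest[OF \<open>A \<noteq> {}\<close>])
      fix \<mu> assume "\<mu> \<in> A"
      have "dist (\<Phi> \<mu>) y \<le> dist (\<Phi> \<mu>) z + dist y z" by (metis dist_commute dist_triangle2)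
      then have "k * dist (\<Phi> \<mu>) y \<le> k * dist (\<Phi> \<mu>) z + k * dist y z"
        using k by (metis distrib_left mult_left_mono)
      then show "?I y - k * dist y z \<le> h \<mu> + k * dist (\<Phi> \<mu>) z"
        using I_le[OF \<open>\<mu> \<in> A\<close>, of y] by linarith
    qed
    then show ?thesis by simp
  qed
  show "\<bar>H y - H z\<bar> \<le> k * dist y z" for y z
    using step[of y z] step[of z y] by (simp add: H_def dist_commute min_def abs_if)
  have "- c \<le> ?I y" for y using \<open>A \<noteq> {}\<close> lower by (intro cINF_greatest) auto
  moreover have "0 \<le> c" using \<open>A \<noteq> {}\<close> bdd by force
  moreover have "\<bar>min c x\<bar> \<le> c" if "- c \<le> x" "0 \<le> c" for x :: real
    using that by linarith
  ultimately show "\<bar>H y\<bar> \<le> c" for y unfolding H_def by blast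
  show "H (\<Phi> \<mu>) \<le> h \<mu>" if "\<mu> \<in> A" for \<mu>
    using I_le[OF that, of "\<Phi> \<mu>"] by (simp add: H_def)
  show "h \<mu> - \<epsilon> \<le> H (\<Phi> \<mu>)"
    if "\<mu> \<in> A" "0 \<le> \<epsilon>" "\<And>\<nu>. \<nu> \<in> A \<Longrightarrow> dist (\<Phi> \<nu>) (\<Phi> \<mu>) < \<delta> \<Longrightarrow> h \<mu> - \<epsilon> \<le> h \<nu>" "2 * c \<le> k * \<delta>" for \<mu> \<epsilon> \<delta>
  proof -
    have "h \<mu> - \<epsilon> \<le> ?I (\<Phi> \<mu>)"
    proof (rule cINF_greatest[OF \<open>A \<noteq> {}\<close>])
      fix \<nu> assume \<nu>: "\<nu> \<in> A"
      show "h \<mu> - \<epsilon> \<le> h \<nu> + k * dist (\<Phi> \<nu>) (\<Phi> \<mu>)"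
      proof (cases "dist (\<Phi> \<nu>) (\<Phi> \<mu>) < \<delta>")
        case True
        then show ?thesis using that(3)[OF \<nu>] k by (smt (verit) mult_nonneg_nonneg zero_le_dist)
      next
        case False
        then have "k * \<delta> \<le> k * dist (\<Phi> \<nu>) (\<Phi> \<mu>)" using k by (intro mult_left_mono) auto
        then show ?thesis using that bspec[OF bdd \<nu>] bspec[OF bdd that(1)] by linarith
      qed
    qed
    then show ?thesis using bspec[OF bdd that(1)] that(2) by (simp add: H_def)
  qed
qed

text \<open>Lower bounds by Lipschitz functions give the lower half of the convergence; applied to
  \<open>- h\<close> they give the upper half.\<close>

lemma weak_liminf_from_Lipschitz:
  fixes \<Phi> :: "'s \<Rightarrow> 'm::metric_space" and h :: "'s \<Rightarrow> real"
  assumes M: "prob_space M" and P: "prob_space P"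
    and \<xi>A: "\<And>r \<omega>. \<omega> \<in> space M \<Longrightarrow> \<xi> r \<omega> \<in> A" and \<eta>A: "\<And>\<omega>. \<omega> \<in> space P \<Longrightarrow> \<eta> \<omega> \<in> A"
    and h\<xi>: "\<And>r. (\<lambda>\<omega>. h (\<xi> r \<omega>)) \<in> borel_measurable M" and h\<eta>: "(\<lambda>\<omega>. h (\<eta> \<omega>)) \<in> borel_measurable P"
    and \<Phi>\<xi>: "\<And>r. (\<lambda>\<omega>. \<Phi> (\<xi> r \<omega>)) \<in> borel_measurable M"
    and \<Phi>\<eta>: "(\<lambda>\<omega>. \<Phi> (\<eta> \<omega>)) \<in> borel_measurable P"
    and cont: "\<And>\<mu> \<epsilon>. \<mu> \<in> A \<Longrightarrow> 0 < \<epsilon> \<Longrightarrow> \<exists>\<delta>>0. \<forall>\<nu>\<in>A. dist (\<Phi> \<nu>) (\<Phi> \<mu>) < \<delta> \<longrightarrow> \<bar>h \<nu> - h \<mu>\<bar> < \<epsilon>"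
    and bdd: "\<And>\<mu>. \<mu> \<in> A \<Longrightarrow> \<bar>h \<mu>\<bar> \<le> c"
    and Lip: "\<And>H L B. (\<And>y z. \<bar>H y - H z\<bar> \<le> L * dist y z) \<Longrightarrow> (\<And>y. \<bar>H y\<bar> \<le> B) \<Longrightarrow>
      (\<lambda>r. \<integral>\<omega>. H (\<Phi> (\<xi> r \<omega>)) \<partial>M) \<longlonglongrightarrow> (\<integral>\<omega>. H (\<Phi> (\<eta> \<omega>)) \<partial>P)"
    and e: "0 < e"
  shows "\<forall>\<^sub>F r in sequentially. (\<integral>\<omega>. h (\<eta> \<omega>) \<partial>P) - e < (\<integral>\<omega>. h (\<xi> r \<omega>) \<partial>M)"
proof -
  interpret M: prob_space M by fact
  interpret P: prob_space P by fact
  have A: "A \<noteq> {}" using \<xi>A M.not_empty by blast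
  define H where "H k y = min c (INF \<mu>\<in>A. h \<mu> + real k * dist (\<Phi> \<mu>) y)" for k y
  have bdd': "\<forall>\<mu>\<in>A. \<bar>h \<mu>\<bar> \<le> c" using bdd by blast
  note HL = inf_convolution[where \<Phi>=\<Phi> and h=h and A=A and c=c, OF A bdd' of_nat_0_le_iff, folded H_def]
  have Hcont: "continuous_on UNIV (H k)" for k
  proof (unfold continuous_on_iff, intro ballI allI impI)
    fix y and \<epsilon> :: real assume "0 < \<epsilon>"
    show "\<exists>d>0. \<forall>z\<in>UNIV. dist z y < d \<longrightarrow> dist (H k z) (H k y) < \<epsilon>"
    proof (intro exI[of _ "\<epsilon> / (real k + 1)"] conjI ballI impI)
      show "0 < \<epsilon> / (real k + 1)" using \<open>0 < \<epsilon>\<close> by simp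
      fix z assume "dist z y < \<epsilon> / (real k + 1)"
      then have "(real k + 1) * dist z y < \<epsilon>" by (simp add: field_simps)
      moreover have "real k * dist z y \<le> (real k + 1) * dist z y" by (simp add: distrib_right)
      ultimately show "dist (H k z) (H k y) < \<epsilon>"
        using HL(1)[of k z y] by (simp add: dist_real_def)
    qed
  qed
  have Hm: "(\<lambda>\<omega>. H k (f \<omega>)) \<in> borel_measurable N" if "f \<in> borel_measurable N" for k f and N :: "'x measure"
    by (rule measurable_compose[OF that borel_measurable_continuous_onI[OF Hcont]])
  have "(\<lambda>k. \<integral>\<omega>. H k (\<Phi> (\<eta> \<omega>)) \<partial>P) \<longlonglongrightarrow> (\<integral>\<omega>. h (\<eta> \<omega>) \<partial>P)"
  proof (rule integral_dominated_convergence[where w="\<lambda>_. c"])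
    show "AE \<omega> in P. (\<lambda>k. H k (\<Phi> (\<eta> \<omega>))) \<longlonglongrightarrow> h (\<eta> \<omega>)"
    proof (rule AE_I2)
      fix \<omega> assume "\<omega> \<in> space P"
      then have \<mu>: "\<eta> \<omega> \<in> A" by (rule \<eta>A)
      show "(\<lambda>k. H k (\<Phi> (\<eta> \<omega>))) \<longlonglongrightarrow> h (\<eta> \<omega>)"
      proof (rule LIMSEQ_I)
        fix \<epsilon> :: real assume \<epsilon>: "0 < \<epsilon>"
        obtain \<delta> where \<delta>: "0 < \<delta>" "\<And>\<nu>. \<nu> \<in> A \<Longrightarrow> dist (\<Phi> \<nu>) (\<Phi> (\<eta> \<omega>)) < \<delta> \<Longrightarrow> \<bar>h \<nu> - h (\<eta> \<omega>)\<bar> < \<epsilon> / 2"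
          using cont[OF \<mu>, of "\<epsilon> / 2"] \<epsilon> by auto
        have near: "h (\<eta> \<omega>) - \<epsilon> / 2 \<le> h \<nu>" if "\<nu> \<in> A" "dist (\<Phi> \<nu>) (\<Phi> (\<eta> \<omega>)) < \<delta>" for \<nu>
          using \<delta>(2)[OF that] by linarith
        \<comment> \<open>Beyond distance \<open>\<delta>\<close> the penalty outweighs the oscillation of \<open>h\<close>, which is at most \<open>2 * c\<close>.\<close>
        obtain K :: nat where K: "2 * c / \<delta> \<le> real K" using real_arch_simple by blast
        show "\<exists>no. \<forall>n\<ge>no. norm (H n (\<Phi> (\<eta> \<omega>)) - h (\<eta> \<omega>)) < \<epsilon>"
        proof (intro exI allI impI)
          fix n assume "K \<le> n"
          then have "2 * c / \<delta> \<le> real n" using K by linarith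
          then have "2 * c \<le> real n * \<delta>" using \<delta>(1) by (simp add: field_simps)
          then have "h (\<eta> \<omega>) - \<epsilon> / 2 \<le> H n (\<Phi> (\<eta> \<omega>))"
            using \<epsilon> near by (intro HL(4)[OF \<mu>, where \<delta>=\<delta>]) auto
          then show "norm (H n (\<Phi> (\<eta> \<omega>)) - h (\<eta> \<omega>)) < \<epsilon>"
            using HL(3)[OF \<mu>, of n] \<epsilon> by (auto simp: abs_if)
        qed
      qed
    qed
    show "AE \<omega> in P. norm (H k (\<Phi> (\<eta> \<omega>))) \<le> c" for k using HL(2) by auto
  qed (auto intro!: Hm h\<eta> \<Phi>\<eta>)
  then have "\<forall>\<^sub>F k in sequentially. (\<integral>\<omega>. h (\<eta> \<omega>) \<partial>P) - e < (\<integral>\<omega>. H k (\<Phi> (\<eta> \<omega>)) \<partial>P)"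
    using e by (intro order_tendstoD) auto
  then obtain k where k: "(\<integral>\<omega>. h (\<eta> \<omega>) \<partial>P) - e < (\<integral>\<omega>. H k (\<Phi> (\<eta> \<omega>)) \<partial>P)"
    by (auto simp: eventually_sequentially)
  have "(\<lambda>r. \<integral>\<omega>. H k (\<Phi> (\<xi> r \<omega>)) \<partial>M) \<longlonglongrightarrow> (\<integral>\<omega>. H k (\<Phi> (\<eta> \<omega>)) \<partial>P)"
    by (rule Lip[OF HL(1) HL(2)])
  from order_tendstoD(1)[OF this k] show ?thesis
  proof eventually_elim
    case (elim r)
    have "(\<integral>\<omega>. H k (\<Phi> (\<xi> r \<omega>)) \<partial>M) \<le> (\<integral>\<omega>. h (\<xi> r \<omega>) \<partial>M)"
    proof (rule integral_mono)
      show "integrable M (\<lambda>\<omega>. H k (\<Phi> (\<xi> r \<omega>)))"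
        using HL(2) by (intro M.integrable_const_bound[of _ c]) (auto intro!: Hm \<Phi>\<xi>)
      show "integrable M (\<lambda>\<omega>. h (\<xi> r \<omega>))"
        using bdd \<xi>A by (intro M.integrable_const_bound[of _ c]) (auto intro!: h\<xi>)
    qed (use HL(3) \<xi>A in auto)
    then show ?case using elim by linarith
  qed
qed

lemma weak_convergence_from_Lipschitz:
  fixes \<Phi> :: "'s \<Rightarrow> 'm::metric_space" and h :: "'s \<Rightarrow> real"
  assumes M: "prob_space M" and P: "prob_space P"
    and \<xi>A: "\<And>r \<omega>. \<omega> \<in> space M \<Longrightarrow> \<xi> r \<omega> \<in> A" and \<eta>A: "\<And>\<omega>. \<omega> \<in> space P \<Longrightarrow> \<eta> \<omega> \<in> A"
    and h\<xi>: "\<And>r. (\<lambda>\<omega>. h (\<xi> r \<omega>)) \<in> borel_measurable M" and h\<eta>: "(\<lambda>\<omega>. h (\<eta> \<omega>)) \<in> borel_measurable P"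
    and \<Phi>\<xi>: "\<And>r. (\<lambda>\<omega>. \<Phi> (\<xi> r \<omega>)) \<in> borel_measurable M"
    and \<Phi>\<eta>: "(\<lambda>\<omega>. \<Phi> (\<eta> \<omega>)) \<in> borel_measurable P"
    and cont: "\<And>\<mu> \<epsilon>. \<mu> \<in> A \<Longrightarrow> 0 < \<epsilon> \<Longrightarrow> \<exists>\<delta>>0. \<forall>\<nu>\<in>A. dist (\<Phi> \<nu>) (\<Phi> \<mu>) < \<delta> \<longrightarrow> \<bar>h \<nu> - h \<mu>\<bar> < \<epsilon>"
    and bdd: "\<And>\<mu>. \<mu> \<in> A \<Longrightarrow> \<bar>h \<mu>\<bar> \<le> c"
    and Lip: "\<And>H L B. (\<And>y z. \<bar>H y - H z\<bar> \<le> L * dist y z) \<Longrightarrow> (\<And>y. \<bar>H y\<bar> \<le> B) \<Longrightarrow>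
      (\<lambda>r. \<integral>\<omega>. H (\<Phi> (\<xi> r \<omega>)) \<partial>M) \<longlonglongrightarrow> (\<integral>\<omega>. H (\<Phi> (\<eta> \<omega>)) \<partial>P)"
  shows "(\<lambda>r. \<integral>\<omega>. h (\<xi> r \<omega>) \<partial>M) \<longlonglongrightarrow> (\<integral>\<omega>. h (\<eta> \<omega>) \<partial>P)"
proof (rule LIMSEQ_I)
  fix e :: real assume e: "0 < e"
  have 1: "\<forall>\<^sub>F r in sequentially. (\<integral>\<omega>. h (\<eta> \<omega>) \<partial>P) - e < (\<integral>\<omega>. h (\<xi> r \<omega>) \<partial>M)"
    by (rule weak_liminf_from_Lipschitz[where A=A and \<Phi>=\<Phi> and c=c, OF assms(1-11) e])
  have 2: "\<forall>\<^sub>F r in sequentially. (\<integral>\<omega>. - h (\<eta> \<omega>) \<partial>P) - e < (\<integral>\<omega>. - h (\<xi> r \<omega>) \<partial>M)"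
    by (rule weak_liminf_from_Lipschitz[where A=A and \<Phi>=\<Phi> and c=c, OF assms(1-4) _ _ assms(7,8) _ _ Lip e])
       (use bdd h\<xi> h\<eta> cont in \<open>auto simp: abs_minus_commute\<close>)
  from 1 2 have "\<forall>\<^sub>F r in sequentially. norm ((\<integral>\<omega>. h (\<xi> r \<omega>) \<partial>M) - (\<integral>\<omega>. h (\<eta> \<omega>) \<partial>P)) < e"
    by eventually_elim auto
  then show "\<exists>no. \<forall>n\<ge>no. norm ((\<integral>\<omega>. h (\<xi> n \<omega>) \<partial>M) - (\<integral>\<omega>. h (\<eta> \<omega>) \<partial>P)) < e"
    by (simp add: eventually_sequentially)
qed

section \<open>Void probabilities of the accepted values\<close>

definition exceed :: "(nat \<Rightarrow> real) \<Rightarrow> nat \<Rightarrow> real \<Rightarrow> nat" where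
  "exceed e n t = card {i. i < n \<and> t < e i}"

lemma exceed_0 [simp]: "exceed e 0 t = 0"
  by (simp add: exceed_def)

lemma exceed_Suc: "exceed e (Suc n) t = exceed e n t + (if t < e n then 1 else 0)"
proof -
  have "{i. i < Suc n \<and> t < e i} = {i. i < n \<and> t < e i} \<union> (if t < e n then {n} else {})"
    by (auto simp: less_Suc_eq)
  then show ?thesis by (auto simp: exceed_def card_Un_disjoint)
qed

lemma exceed_mono: "m \<le> n \<Longrightarrow> exceed e m t \<le> exceed e n t"
  unfolding exceed_def by (intro card_mono) auto

lemma exceed_antimono: "s \<le> t \<Longrightarrow> exceed e n t \<le> exceed e n s"
  unfolding exceed_def by (intro card_mono) auto

lemma exceed_cong: "(\<And>i. i < n \<Longrightarrow> e i = e' i) \<Longrightarrow> exceed e n t = exceed e' n t"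
  unfolding exceed_def by (rule arg_cong[where f=card]) auto

text \<open>The times at which the new value is among the \<open>r\<close> largest so far.\<close>

definition accepted :: "nat \<Rightarrow> (nat \<Rightarrow> real) \<Rightarrow> nat set" where
  "accepted r e = {n. exceed e n (e n) < r}"

text \<open>For the first value in an interval, the earlier values that exceed it are those beyond the
  right end point. Whether the interval is free of accepted values can therefore be decided from
  counts at right end points only.\<close>

lemma no_accepted_iff:
  assumes "s \<le> t"
  shows "(\<forall>n\<in>accepted r e. e n \<notin> {s<..t}) \<longleftrightarrow> (\<forall>n. e n \<in> {s<..t} \<longrightarrow> r \<le> exceed e n t)"
proof (intro iffI allI ballI impI notI)
  fix n assume L: "\<forall>n\<in>accepted r e. e n \<notin> {s<..t}" and n: "e n \<in> {s<..t}"
  define m where "m = (LEAST m. e m \<in> {s<..t})"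
  have m: "e m \<in> {s<..t}" unfolding m_def by (rule LeastI[of _ n]) (rule n)
  have "m \<le> n" unfolding m_def by (rule Least_le) (rule n)
  have before: "e i \<notin> {s<..t}" if "i < m" for i
    using not_less_Least that unfolding m_def by blast
  have "{i. i < m \<and> e m < e i} = {i. i < m \<and> t < e i}"
    using before m by force
  moreover have "m \<notin> accepted r e" using L m by blast
  ultimately have "r \<le> exceed e m t" by (simp add: accepted_def exceed_def)
  then show "r \<le> exceed e n t" using exceed_mono[OF \<open>m \<le> n\<close>, of e t] by simp
next
  fix n assume R: "\<forall>n. e n \<in> {s<..t} \<longrightarrow> r \<le> exceed e n t" and n: "n \<in> accepted r e" "e n \<in> {s<..t}"
  then have "r \<le> exceed e n t" by blast
  also have "\<dots> \<le> exceed e n (e n)" using n by (intro exceed_antimono) auto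
  finally show False using n by (simp add: accepted_def)
qed

lemma measurable_exceed [measurable]:
  assumes [measurable]: "\<And>i. i < n \<Longrightarrow> (\<lambda>x. e x i) \<in> borel_measurable N" "t \<in> borel_measurable N"
  shows "(\<lambda>x. exceed (e x) n (t x)) \<in> measurable N (count_space UNIV)"
proof -
  have "(\<lambda>x. exceed (e x) m (t x)) \<in> measurable N (count_space UNIV)" if "m \<le> n" for m
    using that
  proof (induction m)
    case (Suc m)
    then have [measurable]: "(\<lambda>x. e x m) \<in> borel_measurable N"
       "(\<lambda>x. exceed (e x) m (t x)) \<in> measurable N (count_space UNIV)" by auto
    show ?case unfolding exceed_Suc by measurable
  qed simp
  then show ?thesis by simp
qed

text \<open>The factor by which \<open>void_weight\<close> changes when the value \<open>x\<close> is observed and the cells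
  \<open>j \<ge> l\<close> are those whose right end point has been exceeded fewer than \<open>r\<close> times.\<close>

definition cell_weight :: "real \<Rightarrow> nat set \<Rightarrow> nat \<Rightarrow> real \<Rightarrow> real" where
  "cell_weight w J l x =
     (if \<exists>j\<in>J. l \<le> j \<and> x \<in> {real j * w<..real (Suc j) * w} then 0
      else exp (w * real (card {j\<in>J. l \<le> j \<and> real (Suc j) * w < x})))"

lemma cell_weight_measurable [measurable]:
  "finite J \<Longrightarrow> cell_weight w J l \<in> borel_measurable borel"
proof -
  assume J: "finite J"
  have "card {j\<in>J. l \<le> j \<and> real (Suc j) * w < x} = (\<Sum>j\<in>J. if l \<le> j \<and> real (Suc j) * w < x then 1 else 0)" for x
    using J by (simp add: sum.If_cases Int_def conj_ac)
  with J show ?thesis unfolding cell_weight_def[abs_def] by (simp only:) measurable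
qed

text \<open>Downward induction on \<open>l\<close>. Passing from \<open>Suc l\<close> to \<open>l\<close> with \<open>l \<in> J\<close>, the weight is set
  to 0 on the cell and is multiplied by \<open>exp w\<close> beyond it; for an exponential variable the two
  changes compensate, because leaving the cell on the right, given that its left end point is
  exceeded, has probability \<open>exp (- w)\<close>.\<close>

lemma (in prob_space) expectation_cell_weight:
  assumes X [measurable]: "X \<in> borel_measurable M"
    and tail: "\<And>t. 0 \<le> t \<Longrightarrow> prob {\<omega>\<in>space M. t < X \<omega>} = exp (- t)"
    and w: "0 < w" and J: "finite J"
  shows "expectation (\<lambda>\<omega>. cell_weight w J l (X \<omega>)) = 1"
proof -
  obtain K where K: "\<And>j. j \<in> J \<Longrightarrow> j < K"
    using J by (meson finite_nat_set_iff_bounded)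
  let ?\<phi> = "cell_weight w J"
  have [measurable]: "?\<phi> l \<in> borel_measurable borel" for l using J by simp
  have bnd: "0 \<le> ?\<phi> l x" "?\<phi> l x \<le> exp (w * real (card J))" for l x
    using w J by (auto simp: cell_weight_def intro!: mult_left_mono card_mono)
  have int: "integrable M (\<lambda>\<omega>. ?\<phi> l (X \<omega>))" for l
    using bnd by (intro integrable_const_bound[of _ "exp (w * real (card J))"]) auto
  have far: "?\<phi> l x = 1" if "K \<le> l" for l x
  proof -
    have "\<And>j. j \<in> J \<Longrightarrow> \<not> l \<le> j" using K that by fastforce
    then have "{j \<in> J. l \<le> j \<and> real (Suc j) * w < x} = {}" by auto
    moreover have "\<not> (\<exists>j\<in>J. l \<le> j \<and> x \<in> {real j * w<..real (Suc j) * w})"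
      using \<open>\<And>j. j \<in> J \<Longrightarrow> \<not> l \<le> j\<close> by auto
    ultimately show ?thesis unfolding cell_weight_def by (simp only: if_False) simp
  qed
  have below: "?\<phi> l x = 1" if "x \<le> real l * w" for l x
  proof -
    have *: "real l * w \<le> real j * w" if "l \<le> j" for j using that w by simp
    have **: "real l * w \<le> real (Suc j) * w" if "l \<le> j" for j using that w by (intro mult_right_mono) auto
    have "{j \<in> J. l \<le> j \<and> real (Suc j) * w < x} = {}"
      using ** \<open>x \<le> real l * w\<close> by (auto simp del: of_nat_Suc dest: order_trans leD)
    moreover have "\<not> (\<exists>j\<in>J. l \<le> j \<and> x \<in> {real j * w<..real (Suc j) * w})"
      using * \<open>x \<le> real l * w\<close> by force
    ultimately show ?thesis unfolding cell_weight_def by (simp only: if_False) simp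
  qed
  show ?thesis
  proof (cases "K \<le> l")
    case True then show ?thesis by (simp add: far prob_space)
  next
    case False
    then have "l \<le> K" by simp
    then show ?thesis
    proof (induction rule: inc_induct)
      case base show ?case by (simp add: far prob_space)
    next
      case (step l)
      show ?case
      proof (cases "l \<in> J")
        case False
        have "l \<le> j \<longleftrightarrow> Suc l \<le> j" if "j \<in> J" for j using that False by (metis Suc_leI Suc_leD le_neq_implies_less)
        then have "?\<phi> l = ?\<phi> (Suc l)"
          unfolding cell_weight_def fun_eq_iff by (metis (no_types, lifting) Collect_cong)
        then show ?thesis using step.IH by simp
      next
        case True
        let ?s = "real l * w" and ?t = "real (Suc l) * w"
        have st: "0 \<le> ?s" "?s \<le> ?t" "?t = ?s + w" using w by (auto simp: distrib_right)
        have gt: "?\<phi> l x = exp w * ?\<phi> (Suc l) x" if "?t < x" for x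
        proof -
          have "{j \<in> J. l \<le> j \<and> real (Suc j) * w < x} = insert l {j \<in> J. Suc l \<le> j \<and> real (Suc j) * w < x}"
            using that True by (auto simp: Suc_le_eq le_less)
          then have c: "card {j \<in> J. l \<le> j \<and> real (Suc j) * w < x} = Suc (card {j \<in> J. Suc l \<le> j \<and> real (Suc j) * w < x})"
            using J by simp
          have e: "(\<exists>j\<in>J. l \<le> j \<and> x \<in> {real j * w<..real (Suc j) * w}) \<longleftrightarrow>
                (\<exists>j\<in>J. Suc l \<le> j \<and> x \<in> {real j * w<..real (Suc j) * w})"
            using that by (metis Suc_leD Suc_leI greaterThanAtMost_iff le_neq_implies_less not_less)
          show ?thesis unfolding cell_weight_def c e by (auto simp add: exp_add[symmetric] distrib_left)
        qed
        have mid: "?\<phi> l x = 0" if "?s < x" "x \<le> ?t" for x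
          using that True by (auto simp: cell_weight_def)
        \<comment> \<open>Below the cell both weights are 1, on it the new one is 0, beyond it they differ by a factor.\<close>
        have decomp: "?\<phi> l x = (1 - indicator {?s<..} x) + exp w * (?\<phi> (Suc l) x - (1 - indicator {?t<..} x))" for x
          using gt[of x] mid[of x] below[of x l] below[of x "Suc l"] st(2)
          by (auto simp: indicator_def not_less not_le)
        have P: "expectation (\<lambda>\<omega>. indicator {a<..} (X \<omega>)) = exp (- a)" if "0 \<le> a" for a
        proof -
          have "expectation (\<lambda>\<omega>. indicator {a<..} (X \<omega>)) = expectation (indicat_real {\<omega>\<in>space M. a < X \<omega>})"
            by (intro Bochner_Integration.integral_cong) (auto simp: indicator_def)
          also have "\<dots> = prob {\<omega>\<in>space M. a < X \<omega>}"
            by (simp add: Int_absorb2)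
          finally show ?thesis using tail[OF that] by simp
        qed
        have I: "integrable M (\<lambda>\<omega>. indicator {a<..} (X \<omega>) :: real)" for a
          by (intro integrable_const_bound[of _ 1]) auto
        have "expectation (\<lambda>\<omega>. ?\<phi> l (X \<omega>)) =
            (1 - exp (- ?s)) + exp w * (1 - (1 - exp (- ?t)))"
          unfolding decomp using st int[of "Suc l"]
          by (simp add: I P step.IH prob_space)
        also have "\<dots> = 1" by (simp add: exp_add[symmetric] algebra_simps)
        finally show ?thesis .
      qed
    qed
  qed
qed

text \<open>The conditional probability, given the first \<open>n\<close> values, that no value in the cells of \<open>J\<close> is
  ever accepted. While its right end point has been exceeded \<open>c < r\<close> times, a cell has to be jumped
  over \<open>r - c\<close> more times, each time with probability \<open>exp (- w)\<close>; once \<open>c \<ge> r\<close>, truncated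
  subtraction makes the factor 1.\<close>

definition void_weight :: "real \<Rightarrow> nat set \<Rightarrow> nat \<Rightarrow> nat \<Rightarrow> (nat \<Rightarrow> real) \<Rightarrow> real" where
  "void_weight w J r n e =
     (if \<forall>m<n. \<forall>j\<in>J. e m \<in> {real j * w<..real (Suc j) * w} \<longrightarrow> r \<le> exceed e m (real (Suc j) * w)
      then exp (- w * (\<Sum>j\<in>J. real (r - exceed e n (real (Suc j) * w)))) else 0)"

text \<open>The counts decrease from left to right, so the cells that can still receive an accepted
  value are those from some index \<open>l\<close> on. The last conjunct makes \<open>l\<close> unique: \<open>l\<close> lies in \<open>J\<close>, or it is
  an index beyond \<open>J\<close> if there is no such cell.\<close>

definition active :: "real \<Rightarrow> nat set \<Rightarrow> nat \<Rightarrow> nat \<Rightarrow> (nat \<Rightarrow> real) \<Rightarrow> nat \<Rightarrow> bool" where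
  "active w J r n e l \<longleftrightarrow> (\<forall>j\<in>J. l \<le> j \<longleftrightarrow> exceed e n (real (Suc j) * w) < r) \<and> (l \<in> J \<or> l = Suc (Max (insert 0 J)))"

lemma ex1_active:
  assumes w: "0 < w" and J: "finite J"
  shows "\<exists>!l. active w J r n e l"
proof -
  let ?K = "Suc (Max (insert 0 J))"
  let ?L = "\<lambda>j. exceed e n (real (Suc j) * w) < r"
  have up: "?L k" if "?L j" "j \<le> k" for j k
  proof -
    have "real (Suc j) * w \<le> real (Suc k) * w" using that(2) w by (intro mult_right_mono) auto
    from exceed_antimono[OF this, of e n] show ?thesis using that(1) by linarith
  qed
  have K: "j < ?K" if "j \<in> J" for j using J that by (simp add: less_Suc_eq_le)
  show ?thesis
  proof (cases "\<exists>j\<in>J. ?L j")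
    case True
    define l where "l = (LEAST j. j \<in> J \<and> ?L j)"
    have l: "l \<in> J" "?L l" using LeastI_ex[of "\<lambda>j. j \<in> J \<and> ?L j"] True unfolding l_def by blast+
    have least: "l \<le> j" if "j \<in> J" "?L j" for j unfolding l_def using that by (intro Least_le) auto
    show ?thesis
    proof (rule ex1I[of _ l])
      show "active w J r n e l" unfolding active_def using l up least by blast
      fix l' assume "active w J r n e l'"
      then show "l' = l" unfolding active_def using l K[OF l(1)] least by (metis le_antisym linorder_not_le order_refl)
    qed
  next
    case False
    show ?thesis
    proof (rule ex1I[of _ ?K])
      show "active w J r n e ?K" unfolding active_def using False K by (meson leD)
    qed (use False in \<open>auto simp: active_def\<close>)
  qed
qed

lemma void_weight_Suc:
  assumes w: "0 < w" and J: "finite J" and l: "active w J r n e l"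
  shows "void_weight w J r (Suc n) e = void_weight w J r n e * cell_weight w J l (e n)"
proof -
  let ?t = "\<lambda>j. real (Suc j) * w"
  let ?c = "\<lambda>j. {real j * w<..?t j}"
  let ?ok = "\<lambda>n. \<forall>m<n. \<forall>j\<in>J. e m \<in> ?c j \<longrightarrow> r \<le> exceed e m (?t j)"
  have L: "l \<le> j \<longleftrightarrow> exceed e n (?t j) < r" if "j \<in> J" for j
    using l that by (simp add: active_def)
  have ok_Suc: "?ok (Suc n) \<longleftrightarrow> ?ok n \<and> \<not> (\<exists>j\<in>J. l \<le> j \<and> e n \<in> ?c j)"
  proof -
    have "\<not> l \<le> j \<longleftrightarrow> r \<le> exceed e n (?t j)" if "j \<in> J" for j using L[OF that] by linarith
    then show ?thesis unfolding All_less_Suc by blast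
  qed
  have "(\<Sum>j\<in>J. real (r - exceed e n (?t j))) =
        (\<Sum>j\<in>J. real (r - exceed e (Suc n) (?t j)) + (if l \<le> j \<and> ?t j < e n then 1 else 0))"
  proof (rule sum.cong)
    fix j assume "j \<in> J"
    from L[OF this] show "real (r - exceed e n (?t j)) =
        real (r - exceed e (Suc n) (?t j)) + (if l \<le> j \<and> ?t j < e n then 1 else 0)"
      by (auto simp: exceed_Suc simp del: of_nat_Suc)
  qed simp
  also have "\<dots> = (\<Sum>j\<in>J. real (r - exceed e (Suc n) (?t j))) + real (card {j\<in>J. l \<le> j \<and> ?t j < e n})"
    using J by (simp add: sum.distrib sum.If_cases Int_def conj_ac del: of_nat_Suc)
  finally have s: "(\<Sum>j\<in>J. real (r - exceed e n (?t j))) = \<dots>" .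
  show ?thesis
    unfolding void_weight_def cell_weight_def ok_Suc s
    by (auto simp add: exp_add[symmetric] algebra_simps simp del: of_nat_Suc)
qed

lemma void_weight_cong:
  assumes "\<And>i. i < n \<Longrightarrow> e i = e' i"
  shows "void_weight w J r n e = void_weight w J r n e'"
proof -
  have "exceed e m t = exceed e' m t" if "m \<le> n" for m t
    using assms that by (intro exceed_cong) auto
  then show ?thesis using assms unfolding void_weight_def by (simp cong: conj_cong)
qed

lemma active_cong:
  assumes "\<And>i. i < n \<Longrightarrow> e i = e' i"
  shows "active w J r n e l = active w J r n e' l"
proof -
  have "exceed e n t = exceed e' n t" for t
    using assms by (intro exceed_cong) auto
  then show ?thesis unfolding active_def by simp
qed

lemma measurable_void_weight [measurable]:
  assumes [measurable]: "\<And>i. i < n \<Longrightarrow> (\<lambda>x. e x i) \<in> borel_measurable N" and J: "finite J"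
  shows "(\<lambda>x. void_weight w J r n (e x)) \<in> borel_measurable N"
proof -
  have [measurable]: "(\<lambda>x. e x m) \<in> borel_measurable N" if "m \<in> {..<n}" for m using that by auto
  have [measurable]: "(\<lambda>x. exceed (e x) m t) \<in> measurable N (count_space UNIV)" if "m \<in> {..<n}" for m t
    using that by (intro measurable_exceed) auto
  have *: "(\<forall>m<n. Q m) \<longleftrightarrow> (\<forall>m\<in>{..<n}. Q m)" for Q by auto
  show ?thesis unfolding void_weight_def * using J by measurable
qed

lemma measurable_active [measurable]:
  assumes [measurable]: "\<And>i. i < n \<Longrightarrow> (\<lambda>x. e x i) \<in> borel_measurable N" and J: "finite J"
  shows "Measurable.pred N (\<lambda>x. active w J r n (e x) l)"
  unfolding active_def using J by measurable

lemma void_weight_bounds: "0 < w \<Longrightarrow> 0 \<le> void_weight w J r n e \<and> void_weight w J r n e \<le> 1"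
  by (auto simp: void_weight_def intro!: sum_nonneg mult_nonneg_nonneg)

text \<open>The martingale property, unconditioned: \<open>void_weight\<close> at \<open>n\<close> and the position of the active cells
  depend on the first \<open>n\<close> values, the new factor on the next one.\<close>

lemma (in prob_space) expectation_void_weight:
  fixes E :: "nat \<Rightarrow> 'a \<Rightarrow> real"
  assumes ind: "indep_vars (\<lambda>_. borel) E UNIV"
    and tail: "\<And>i t. 0 \<le> t \<Longrightarrow> prob {\<omega>\<in>space M. t < E i \<omega>} = exp (- t)"
    and w: "0 < w" and J: "finite J"
  shows "expectation (\<lambda>\<omega>. void_weight w J r n (\<lambda>i. E i \<omega>)) = exp (- w * real r * real (card J))"
proof (induction n)
  case 0 show ?case by (simp add: void_weight_def prob_space algebra_simps)
next
  case (Suc n)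
  have [measurable]: "E i \<in> borel_measurable M" for i
    using ind by (auto simp: indep_vars_def)
  let ?W = "\<lambda>e. void_weight w J r n e"
  let ?L = "insert (Suc (Max (insert 0 J))) J"
  let ?A = "\<lambda>l e. if active w J r n e l then ?W e else 0"
  have fL: "finite ?L" using J by simp
  have "void_weight w J r (Suc n) e = (\<Sum>l\<in>?L. ?A l e * cell_weight w J l (e n))" for e
  proof -
    obtain l where l: "active w J r n e l" and iff: "\<And>l'. active w J r n e l' \<longleftrightarrow> l' = l"
      using ex1_active[OF w J, of r n e] by metis
    then have "l \<in> ?L" by (auto simp: active_def)
    have "(\<Sum>l'\<in>?L. ?A l' e * cell_weight w J l' (e n)) = (\<Sum>l'\<in>?L. if l' = l then ?W e * cell_weight w J l (e n) else 0)"
      by (intro sum.cong) (auto simp: iff)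
    also have "\<dots> = ?W e * cell_weight w J l (e n)" using fL \<open>l \<in> ?L\<close> by (simp add: sum.delta del: insert_iff)
    finally show ?thesis using void_weight_Suc[OF w J l] by simp
  qed
  note decomp = this
  have sumA: "(\<Sum>l\<in>?L. ?A l e) = ?W e" for e
  proof -
    obtain l where l: "active w J r n e l" and iff: "\<And>l'. active w J r n e l' \<longleftrightarrow> l' = l"
      using ex1_active[OF w J, of r n e] by metis
    then have "l \<in> ?L" by (auto simp: active_def)
    have "(\<Sum>l'\<in>?L. ?A l' e) = (\<Sum>l'\<in>?L. if l' = l then ?W e else 0)"
      by (intro sum.cong) (auto simp: iff)
    also have "\<dots> = ?W e" using fL \<open>l \<in> ?L\<close> by (simp add: sum.delta del: insert_iff)
    finally show ?thesis .
  qed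
  have intA: "integrable M (\<lambda>\<omega>. ?A l (\<lambda>i. E i \<omega>))" for l
    using void_weight_bounds[OF w] J by (intro integrable_const_bound[of _ 1]) (auto simp: abs_le_iff)
  have intC: "integrable M (\<lambda>\<omega>. cell_weight w J l (E n \<omega>))" for l
    using w J by (intro integrable_const_bound[of _ "exp (w * real (card J))"])
       (auto simp: cell_weight_def intro!: mult_left_mono card_mono)
  have prod: "expectation (\<lambda>\<omega>. ?A l (\<lambda>i. E i \<omega>) * cell_weight w J l (E n \<omega>)) = expectation (\<lambda>\<omega>. ?A l (\<lambda>i. E i \<omega>))"
    and intP: "integrable M (\<lambda>\<omega>. ?A l (\<lambda>i. E i \<omega>) * cell_weight w J l (E n \<omega>))" for l
  proof -
    have 1: "(\<lambda>e. ?A l e) \<in> borel_measurable (PiM {..<n} (\<lambda>_. borel))"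
      using J by measurable
    have 2: "(\<lambda>e. cell_weight w J l (e n)) \<in> borel_measurable (PiM {n} (\<lambda>_. borel))"
      using J by measurable
    have "indep_var borel ((\<lambda>e. ?A l e) \<circ> (\<lambda>\<omega>. restrict (\<lambda>i. E i \<omega>) {..<n}))
            borel ((\<lambda>e. cell_weight w J l (e n)) \<circ> (\<lambda>\<omega>. restrict (\<lambda>i. E i \<omega>) {n}))"
      by (rule indep_var_compose[OF indep_var_restrict[OF ind] 1 2]) auto
    also have "(\<lambda>e. ?A l e) \<circ> (\<lambda>\<omega>. restrict (\<lambda>i. E i \<omega>) {..<n}) = (\<lambda>\<omega>. ?A l (\<lambda>i. E i \<omega>))"
      unfolding comp_def by (intro ext if_cong active_cong void_weight_cong) auto
    also have "(\<lambda>e. cell_weight w J l (e n)) \<circ> (\<lambda>\<omega>. restrict (\<lambda>i. E i \<omega>) {n}) = (\<lambda>\<omega>. cell_weight w J l (E n \<omega>))"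
      by (auto simp: comp_def)
    finally have iv: "indep_var borel (\<lambda>\<omega>. ?A l (\<lambda>i. E i \<omega>)) borel (\<lambda>\<omega>. cell_weight w J l (E n \<omega>))" .
    show "expectation (\<lambda>\<omega>. ?A l (\<lambda>i. E i \<omega>) * cell_weight w J l (E n \<omega>)) = expectation (\<lambda>\<omega>. ?A l (\<lambda>i. E i \<omega>))"
      using indep_var_lebesgue_integral[OF iv intA intC] expectation_cell_weight[OF _ tail w J] by simp
    show "integrable M (\<lambda>\<omega>. ?A l (\<lambda>i. E i \<omega>) * cell_weight w J l (E n \<omega>))"
      by (rule indep_var_integrable[OF iv intA intC])
  qed
  have "expectation (\<lambda>\<omega>. void_weight w J r (Suc n) (\<lambda>i. E i \<omega>)) =
     (\<Sum>l\<in>?L. expectation (\<lambda>\<omega>. ?A l (\<lambda>i. E i \<omega>) * cell_weight w J l (E n \<omega>)))"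
    unfolding decomp by (rule Bochner_Integration.integral_sum[OF intP])
  also have "\<dots> = (\<Sum>l\<in>?L. expectation (\<lambda>\<omega>. ?A l (\<lambda>i. E i \<omega>)))"
    by (simp only: prod)
  also have "\<dots> = expectation (\<lambda>\<omega>. \<Sum>l\<in>?L. ?A l (\<lambda>i. E i \<omega>))"
    by (rule Bochner_Integration.integral_sum[OF intA, symmetric])
  also have "\<dots> = expectation (\<lambda>\<omega>. ?W (\<lambda>i. E i \<omega>))" unfolding sumA ..
  finally show ?case using Suc by simp
qed

text \<open>Almost surely all counts reach \<open>r\<close>; from then on the martingale is the indicator of the event.\<close>

lemma (in prob_space) void_probability:
  fixes E :: "nat \<Rightarrow> 'a \<Rightarrow> real"
  assumes ind: "indep_vars (\<lambda>_. borel) E UNIV"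
    and tail: "\<And>i t. 0 \<le> t \<Longrightarrow> prob {\<omega>\<in>space M. t < E i \<omega>} = exp (- t)"
    and io: "AE \<omega> in M. \<forall>t. \<exists>n. r \<le> exceed (\<lambda>i. E i \<omega>) n t"
    and w: "0 < w" and J: "finite J"
  shows "prob {\<omega>\<in>space M. \<forall>j\<in>J. \<forall>n\<in>accepted r (\<lambda>i. E i \<omega>). E n \<omega> \<notin> {real j * w<..real (Suc j) * w}}
    = exp (- w * real r * real (card J))"
proof -
  have [measurable]: "E i \<in> borel_measurable M" for i
    using ind by (auto simp: indep_vars_def)
  let ?e = "\<lambda>\<omega> i. E i \<omega>"
  let ?t = "\<lambda>j. real (Suc j) * w"
  let ?c = "\<lambda>j. {real j * w<..?t j}"
  let ?V = "{\<omega>\<in>space M. \<forall>n. \<forall>j\<in>J. E n \<omega> \<in> ?c j \<longrightarrow> r \<le> exceed (?e \<omega>) n (?t j)}"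
  have V: "{\<omega>\<in>space M. \<forall>j\<in>J. \<forall>n\<in>accepted r (?e \<omega>). E n \<omega> \<notin> ?c j} = ?V"
  proof -
    have "(\<forall>n\<in>accepted r (?e \<omega>). E n \<omega> \<notin> ?c j) \<longleftrightarrow>
        (\<forall>n. E n \<omega> \<in> ?c j \<longrightarrow> r \<le> exceed (?e \<omega>) n (?t j))" for j \<omega>
      by (rule no_accepted_iff) (use w in simp)
    then show ?thesis by (simp only:) blast
  qed
  have Vm: "?V \<in> sets M" using J by measurable
  have "(\<lambda>n. expectation (\<lambda>\<omega>. void_weight w J r n (?e \<omega>))) \<longlonglongrightarrow> expectation (indicator ?V)"
  proof (rule integral_dominated_convergence[where w="\<lambda>_. 1"])
    show "AE \<omega> in M. (\<lambda>n. void_weight w J r n (?e \<omega>)) \<longlonglongrightarrow> indicator ?V \<omega>"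
      using io AE_space
    proof (eventually_elim, intro tendsto_eventually)
      fix \<omega> assume "\<omega> \<in> space M" and "\<forall>t. \<exists>n. r \<le> exceed (?e \<omega>) n t"
      then have ex: "\<forall>j\<in>J. \<forall>\<^sub>F n in sequentially. r \<le> exceed (?e \<omega>) n (?t j)"
        unfolding eventually_sequentially using exceed_mono order_trans by meson
      have ok: "\<forall>\<^sub>F n in sequentially. (\<forall>m<n. \<forall>j\<in>J. E m \<omega> \<in> ?c j \<longrightarrow> r \<le> exceed (?e \<omega>) m (?t j)) \<longleftrightarrow>
          (\<forall>m. \<forall>j\<in>J. E m \<omega> \<in> ?c j \<longrightarrow> r \<le> exceed (?e \<omega>) m (?t j))"
      proof (cases "\<forall>m. \<forall>j\<in>J. E m \<omega> \<in> ?c j \<longrightarrow> r \<le> exceed (?e \<omega>) m (?t j)")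
        case False
        then obtain m where m: "\<not> (\<forall>j\<in>J. E m \<omega> \<in> ?c j \<longrightarrow> r \<le> exceed (?e \<omega>) m (?t j))" by blast
        show ?thesis using eventually_gt_at_top[of m]
          by eventually_elim (use False m in blast)
      qed simp
      show "\<forall>\<^sub>F n in sequentially. void_weight w J r n (?e \<omega>) = indicator ?V \<omega>"
        using eventually_ball_finite[OF J ex] ok
      proof eventually_elim
        case (elim n)
        have "(\<Sum>j\<in>J. real (r - exceed (?e \<omega>) n (?t j))) = 0"
          using elim(1) by (intro sum.neutral) simp
        then show ?case using elim(2) \<open>\<omega> \<in> space M\<close> by (simp add: void_weight_def indicator_def del: of_nat_Suc)
      qed
    qed
    show "AE \<omega> in M. norm (void_weight w J r n (?e \<omega>)) \<le> 1" for n
      using void_weight_bounds[OF w] by (simp add: abs_le_iff)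
  qed (use Vm J in measurable)
  then have "(\<lambda>n::nat. exp (- w * real r * real (card J))) \<longlonglongrightarrow> prob ?V"
    using expectation_void_weight[OF ind tail w J, of r] Vm by simp
  then show ?thesis unfolding V by (simp add: LIMSEQ_const_iff)
qed

section \<open>The range of the r-th largest values\<close>

lemma exceed_strict:
  assumes "i < n" "e j < e i"
  shows "exceed e n (e i) < exceed e n (e j)"
  unfolding exceed_def
proof (rule psubset_card_mono)
  show "{k. k < n \<and> e i < e k} \<subset> {k. k < n \<and> e j < e k}" using assms by force
qed simp

lemma rth_largest_value:
  assumes x: "inj x" and r: "1 \<le> r" "r \<le> n"
  obtains j where "j < n" "rth_largest r (map x [0..<n]) = x j" "exceed x n (x j) = r - 1"
proof -
  define s where "s = sort (map x [0..<n])"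
  have len: "length s = n" by (simp add: s_def)
  have set: "set s = x ` {..<n}" by (simp add: s_def lessThan_atLeast0)
  have dist: "distinct s" using x by (simp add: s_def distinct_map inj_on_subset[OF x])
  have sorted: "sorted s" by (simp add: s_def)
  have rth: "rth_largest r (map x [0..<n]) = s ! (n - r)"
    using r len by (simp add: rth_largest_def s_def[symmetric] rev_nth)
  have lt: "n - r < length s" using r len by simp
  then obtain j where j: "j < n" "s ! (n - r) = x j" using nth_mem[OF lt] set by auto
  have "{i. i < n \<and> x j < x i} = x -` (nth s ` {n - r<..<n})"
  proof (intro set_eqI iffI)
    fix i assume "i \<in> {i. i < n \<and> x j < x i}"
    then have i: "i < n" "x j < x i" by auto
    then obtain k where k: "k < n" "s ! k = x i" using set len by (metis image_eqI in_set_conv_nth lessThan_iff)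
    have "n - r < k"
    proof (rule ccontr)
      assume "\<not> n - r < k"
      then have "s ! k \<le> s ! (n - r)" using sorted lt by (intro sorted_nth_mono) auto
      then show False using i k j by simp
    qed
    then show "i \<in> x -` (nth s ` {n - r<..<n})" using k by (auto intro!: image_eqI[of _ _ k])
  next
    fix i assume "i \<in> x -` (nth s ` {n - r<..<n})"
    then obtain k where k: "n - r < k" "k < n" "x i = s ! k" by auto
    then have "x i \<in> set s" using len by simp
    then have "i < n" using set x by (auto dest: injD)
    moreover have "s ! (n - r) \<le> s ! k" using sorted k len by (intro sorted_nth_mono) auto
    moreover have "s ! (n - r) \<noteq> s ! k" using dist k len lt by (simp add: nth_eq_iff_index_eq)
    ultimately show "i \<in> {i. i < n \<and> x j < x i}" using k j by simp
  qed
  moreover have "card (x -` (nth s ` {n - r<..<n})) = card (nth s ` {n - r<..<n})"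
  proof (rule card_vimage_inj[OF x])
    show "nth s ` {n - r<..<n} \<subseteq> range x" using set len by (force dest: nth_mem)
  qed
  moreover have "card (nth s ` {n - r<..<n}) = r - 1"
  proof -
    have "inj_on (nth s) {n - r<..<n}" using dist len by (intro inj_on_nth) auto
    then show ?thesis using r by (simp add: card_image)
  qed
  ultimately have "exceed x n (x j) = r - 1" by (simp add: exceed_def)
  with j rth that show ?thesis by metis
qed

text \<open>If fewer than \<open>r\<close> earlier values exceed \<open>x j\<close>, then the number of larger values grows by steps
  of one beyond any bound, so at some time it equals \<open>r - 1\<close>, and then \<open>x j\<close> is the \<open>r\<close>-th largest.
  Conversely the \<open>r\<close>-th largest value had at most \<open>r - 1\<close> larger ones before it.\<close>

lemma range_rth_maxima_eq:
  assumes x: "inj x" and r: "1 \<le> r" and io: "\<And>j. \<exists>n. r \<le> exceed x n (x j)"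
  shows "range_rth_maxima r x = x ` accepted r x"
proof (intro subset_antisym subsetI)
  fix v assume "v \<in> range_rth_maxima r x"
  then obtain n where n: "r \<le> n" "v = rth_largest r (map x [0..<n])" by (auto simp: range_rth_maxima_def)
  obtain j where j: "j < n" "v = x j" "exceed x n (x j) = r - 1"
    using rth_largest_value[OF x r n(1)] n(2) by metis
  then have "exceed x j (x j) < r" using exceed_mono[of j n x "x j"] r by simp
  then show "v \<in> x ` accepted r x" using j by (simp add: accepted_def)
next
  fix v assume "v \<in> x ` accepted r x"
  then obtain j where j: "v = x j" "exceed x j (x j) < r" by (auto simp: accepted_def)
  define n where "n = (LEAST n. r \<le> exceed x n (x j))"
  have n: "r \<le> exceed x n (x j)" unfolding n_def by (rule LeastI_ex[OF io])
  then obtain m where m: "n = Suc m" using r by (cases n) auto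
  have "\<not> r \<le> exceed x m (x j)" using m unfolding n_def by (metis lessI not_less_Least)
  with n m have rm: "exceed x m (x j) = r - 1" "x j < x m" by (auto simp: exceed_Suc split: if_splits)
  have "j < m"
  proof (rule ccontr)
    assume "\<not> j < m"
    then have "m \<le> j" by simp
    moreover have "m \<noteq> j" using rm by auto
    ultimately have "n \<le> j" using m by simp
    then show False using exceed_mono[of n j x "x j"] n j by simp
  qed
  have "{i. i < m \<and> x j < x i} \<subseteq> {..<m} - {j}" by auto
  then have "exceed x m (x j) \<le> card ({..<m} - {j})" unfolding exceed_def by (intro card_mono) auto
  then have "r \<le> m" using rm \<open>j < m\<close> by simp
  obtain k where k: "k < m" "rth_largest r (map x [0..<m]) = x k" "exceed x m (x k) = r - 1"
    using rth_largest_value[OF x r \<open>r \<le> m\<close>] by metis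
  have "x k = x j"
    using exceed_strict[of k m x j] exceed_strict[of j m x k] k \<open>j < m\<close> rm by (metis less_irrefl linorder_neqE_linordered_idom)
  then have "v = rth_largest r (map x [0..<m])" using k j by simp
  then show "v \<in> range_rth_maxima r x" using \<open>r \<le> m\<close> by (auto simp: range_rth_maxima_def)
qed

lemma finite_accepted_below:
  assumes "r \<le> exceed e N t"
  shows "finite {n \<in> accepted r e. e n \<le> t}"
proof (rule finite_subset)
  show "{n \<in> accepted r e. e n \<le> t} \<subseteq> {..<N}"
  proof
    fix n assume "n \<in> {n \<in> accepted r e. e n \<le> t}"
    then have n: "exceed e n (e n) < r" "e n \<le> t" by (auto simp: accepted_def)
    then have "exceed e n t < r" using exceed_antimono[of "e n" t e n] by simp
    then show "n \<in> {..<N}" using assms exceed_mono[of N n e t] by (auto simp: not_less[symmetric])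
  qed
qed simp

lemma accepted_cong:
  assumes "\<And>i j. e i < e j \<longleftrightarrow> x i < x j"
  shows "accepted r e = accepted r x"
  using assms by (simp add: accepted_def exceed_def)

section \<open>Point measures and occupied dyadic cells\<close>

definition g_cell :: "real \<Rightarrow> nat \<Rightarrow> nat \<Rightarrow> real set" where
  "g_cell \<gamma> m j = {x \<in> supp_gev \<gamma>. real j / 2 ^ m < g_gev \<gamma> x \<and> g_gev \<gamma> x \<le> real (Suc j) / 2 ^ m}"

lemma sets_g_cell: "g_cell \<gamma> m j \<in> sets (restrict_space borel (supp_gev \<gamma>))"
proof -
  have "g_cell \<gamma> m j = {x \<in> space (restrict_space borel (supp_gev \<gamma>)). real j / 2 ^ m < g_gev \<gamma> x \<and> g_gev \<gamma> x \<le> real (Suc j) / 2 ^ m}"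
    by (auto simp: g_cell_def space_restrict_space)
  also have "\<dots> \<in> sets (restrict_space borel (supp_gev \<gamma>))" by measurable
  finally show ?thesis .
qed

lemma g_cell_iff:
  assumes "x \<in> supp_gev \<gamma>"
  shows "x \<in> g_cell \<gamma> m j \<longleftrightarrow> j = nat (\<lceil>2 ^ m * g_gev \<gamma> x\<rceil> - 1)"
proof -
  have "0 < 2 ^ m * g_gev \<gamma> x" using g_gev_pos[OF assms] by simp
  then have c: "1 \<le> \<lceil>2 ^ m * g_gev \<gamma> x\<rceil>" by linarith
  have "x \<in> g_cell \<gamma> m j \<longleftrightarrow> real j < 2 ^ m * g_gev \<gamma> x \<and> 2 ^ m * g_gev \<gamma> x \<le> real (Suc j)"
    using assms by (auto simp: g_cell_def field_simps)
  also have "\<dots> \<longleftrightarrow> \<lceil>2 ^ m * g_gev \<gamma> x\<rceil> = int j + 1" by linarith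
  also have "\<dots> \<longleftrightarrow> j = nat (\<lceil>2 ^ m * g_gev \<gamma> x\<rceil> - 1)" using c by linarith
  finally show ?thesis .
qed

text \<open>All cells in a bounded range hold mass 0 or 1 once they are fine enough. For a point
  measure this says that the points are simple, in a form that the counts of a Poisson random
  measure verify directly.\<close>

definition eventually_simple :: "real \<Rightarrow> real measure \<Rightarrow> bool" where
  "eventually_simple \<gamma> \<mu> \<longleftrightarrow> (\<forall>N::nat. \<forall>\<^sub>F m in sequentially. \<forall>j\<in>{1..<N * 2 ^ m}.
     emeasure \<mu> (g_cell \<gamma> m j) = 0 \<or> emeasure \<mu> (g_cell \<gamma> m j) = 1)"

text \<open>Once the cells are fine, the sum over occupied cells is the integral of a step function, and
  the step functions converge boundedly to \<open>F \<circ> g_gev \<gamma>\<close> on a common compact set.\<close>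

lemma occupied_cells_limit:
  assumes \<mu>: "\<mu> \<in> radon_measures (supp_gev \<gamma>)" and simple: "eventually_simple \<gamma> \<mu>"
    and F: "continuous_on UNIV F" and \<alpha>: "0 < \<alpha>" and supp: "\<And>u. F u \<noteq> (0::real) \<Longrightarrow> \<alpha> \<le> u \<and> u \<le> (\<beta>::real)"
  shows "(\<lambda>m. \<Sum>j\<in>{1..<m * 2 ^ m}. if emeasure \<mu> (g_cell \<gamma> m j) = 0 then 0 else F (real j / 2 ^ m))
    \<longlonglongrightarrow> (\<integral>x. F (g_gev \<gamma> x) \<partial>\<mu>)"
proof -
  obtain B where B: "\<And>u. \<bar>F u\<bar> \<le> B" using compact_support_bounded[OF F supp] by blast
  have B0: "0 \<le> B" using B[of 0] by linarith
  have sets\<mu>: "sets \<mu> = sets (restrict_space borel (supp_gev \<gamma>))" using \<mu> by (simp add: radon_measures_def)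
  have cell: "g_cell \<gamma> m j \<in> sets \<mu>" for m j using sets\<mu> sets_g_cell by simp
  obtain N :: nat where N: "\<beta> + 1 \<le> real N" using real_arch_simple by blast
  let ?f = "\<lambda>m x. \<Sum>j\<in>{1..<m * 2 ^ m}. F (real j / 2 ^ m) * indicator (g_cell \<gamma> m j) x"
  let ?J = "\<lambda>m x. nat (\<lceil>2 ^ m * g_gev \<gamma> x\<rceil> - 1)"
  have f: "?f m x = (if ?J m x \<in> {1..<m * 2 ^ m} then F (real (?J m x) / 2 ^ m) else 0)" if "x \<in> supp_gev \<gamma>" for m x
  proof -
    have "?f m x = (\<Sum>j\<in>{1..<m * 2 ^ m}. if j = ?J m x then F (real j / 2 ^ m) else 0)"
      using that by (intro sum.cong) (auto simp: indicator_def g_cell_iff)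
    then show ?thesis by (simp add: sum.delta)
  qed
  have J: "\<bar>real (?J m x) / 2 ^ m - g_gev \<gamma> x\<bar> \<le> 1 / 2 ^ m" if "x \<in> supp_gev \<gamma>" for m x
  proof -
    have "0 < 2 ^ m * g_gev \<gamma> x" using g_gev_pos[OF that] by simp
    then have "\<bar>real (?J m x) - 2 ^ m * g_gev \<gamma> x\<bar> \<le> 1" by linarith
    moreover have "real (?J m x) / 2 ^ m - g_gev \<gamma> x = (real (?J m x) - 2 ^ m * g_gev \<gamma> x) / 2 ^ m"
      by (simp add: field_simps)
    ultimately show ?thesis by (simp add: abs_divide divide_right_mono)
  qed
  have half: "(\<lambda>m. 1 / 2 ^ m :: real) \<longlonglongrightarrow> 0"
    using LIMSEQ_realpow_zero[of "1 / 2 :: real"] by (simp add: power_divide)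
  have lim: "(\<lambda>m. ?f m x) \<longlonglongrightarrow> F (g_gev \<gamma> x)" if x: "x \<in> supp_gev \<gamma>" for x
  proof -
    have "(\<lambda>m. real (?J m x) / 2 ^ m - g_gev \<gamma> x) \<longlonglongrightarrow> 0"
      by (rule Lim_null_comparison[OF _ half]) (use J[OF x] in simp)
    then have "(\<lambda>m. real (?J m x) / 2 ^ m) \<longlonglongrightarrow> g_gev \<gamma> x" by (simp add: LIM_zero_iff)
    then have 1: "(\<lambda>m. F (real (?J m x) / 2 ^ m)) \<longlonglongrightarrow> F (g_gev \<gamma> x)"
      using F by (intro isCont_tendsto_compose[of _ F]) (auto simp: continuous_on_eq_continuous_at)
    obtain K :: nat where K: "g_gev \<gamma> x < real K" using reals_Archimedean2 by blast
    have "\<forall>\<^sub>F m in sequentially. F (real (?J m x) / 2 ^ m) = ?f m x"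
      using eventually_ge_at_top[of K]
    proof eventually_elim
      case (elim m)
      have "?J m x < m * 2 ^ m"
      proof -
        have "2 ^ m * g_gev \<gamma> x \<le> 2 ^ m * real m" using K elim by (intro mult_left_mono) auto
        then have "2 ^ m * g_gev \<gamma> x \<le> real (m * 2 ^ m)" by (simp add: mult.commute)
        moreover have "0 < 2 ^ m * g_gev \<gamma> x" using g_gev_pos[OF x] by simp
        ultimately show ?thesis by linarith
      qed
      have "F 0 = 0" using supp[of 0] \<alpha> by auto
      then have gen: "F (real k / 2 ^ m) = (if k \<in> {1..<m * 2 ^ m} then F (real k / 2 ^ m) else 0)" if "k < m * 2 ^ m" for k
        using that by (cases "k = 0") auto
      show ?case unfolding f[OF x] by (rule gen) fact
    qed
    from Lim_transform_eventually[OF 1 this] show ?thesis .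
  qed
  have "(\<lambda>m. \<integral>x. ?f m x \<partial>\<mu>) \<longlonglongrightarrow> (\<integral>x. F (g_gev \<gamma> x) \<partial>\<mu>)"
  proof (rule integral_dominated_convergence[where w="\<lambda>x. B * indicator (g_band \<gamma> \<alpha> (\<beta> + 1)) x"])
    show "(\<lambda>x. F (g_gev \<gamma> x)) \<in> borel_measurable \<mu>"
      by (rule measurable_compose[OF measurable_g_gev_radon[OF \<mu>] borel_measurable_continuous_onI[OF F]])
    show "?f m \<in> borel_measurable \<mu>" for m
      by (intro borel_measurable_sum borel_measurable_times borel_measurable_const borel_measurable_indicator cell)
    have band: "g_band \<gamma> \<alpha> (\<beta> + 1) \<in> sets \<mu>" using sets\<mu> sets_g_band by simp
    have "\<forall>K. compact K \<and> K \<subseteq> supp_gev \<gamma> \<longrightarrow> emeasure \<mu> K < \<infinity>" using \<mu> by (simp add: radon_measures_def)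
    then have "emeasure \<mu> (g_band \<gamma> \<alpha> (\<beta> + 1)) < \<infinity>"
      using compact_g_band[OF \<alpha>, of \<gamma> "\<beta> + 1"] g_band_subset[of \<gamma> \<alpha> "\<beta> + 1"] by blast
    then show "integrable \<mu> (\<lambda>x. B * indicator (g_band \<gamma> \<alpha> (\<beta> + 1)) x)"
      using band by (intro integrable_mult_right integrable_real_indicator)
    show "AE x in \<mu>. (\<lambda>m. ?f m x) \<longlonglongrightarrow> F (g_gev \<gamma> x)"
      by (rule AE_I2) (use lim in \<open>simp add: space_radon[OF \<mu>]\<close>)
    show "AE x in \<mu>. norm (?f m x) \<le> B * indicator (g_band \<gamma> \<alpha> (\<beta> + 1)) x" for m
    proof (rule AE_I2)
      fix x assume "x \<in> space \<mu>"
      then have x: "x \<in> supp_gev \<gamma>" by (simp add: space_radon[OF \<mu>])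
      show "norm (?f m x) \<le> B * indicator (g_band \<gamma> \<alpha> (\<beta> + 1)) x"
      proof (cases "F (real (?J m x) / 2 ^ m) = 0")
        case True then show ?thesis unfolding f[OF x] using B0 by simp
      next
        case False
        have "x \<in> g_cell \<gamma> m (?J m x)" unfolding g_cell_iff[OF x] ..
        moreover have "real j / 2 ^ m < g_gev \<gamma> x \<and> g_gev \<gamma> x \<le> real j / 2 ^ m + 1 / 2 ^ m"
          if "x \<in> g_cell \<gamma> m j" for j
          using that by (simp add: g_cell_def add_divide_distrib)
        ultimately have "real (?J m x) / 2 ^ m < g_gev \<gamma> x" "g_gev \<gamma> x \<le> real (?J m x) / 2 ^ m + 1 / 2 ^ m"
          by blast+
        moreover have "1 / 2 ^ m \<le> (1::real)" by simp
        ultimately have "\<alpha> \<le> g_gev \<gamma> x \<and> g_gev \<gamma> x \<le> \<beta> + 1" using supp[OF False] by linarith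
        then have "x \<in> g_band \<gamma> \<alpha> (\<beta> + 1)" using x unfolding g_band_def by blast
        then show ?thesis unfolding f[OF x] using B B0 by simp
      qed
    qed
  qed
  moreover have "\<forall>\<^sub>F m in sequentially. (\<integral>x. ?f m x \<partial>\<mu>) =
      (\<Sum>j\<in>{1..<m * 2 ^ m}. if emeasure \<mu> (g_cell \<gamma> m j) = 0 then 0 else F (real j / 2 ^ m))"
    using simple[unfolded eventually_simple_def, rule_format, of N]
  proof eventually_elim
    case (elim m)
    have one: "emeasure \<mu> (g_cell \<gamma> m j) = 0 \<or> emeasure \<mu> (g_cell \<gamma> m j) = 1"
      if "F (real j / 2 ^ m) \<noteq> 0" for j
    proof -
      have "\<alpha> \<le> real j / 2 ^ m" "real j / 2 ^ m \<le> \<beta>" using supp[OF that] by auto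
      moreover from this(1) \<alpha> have "j \<noteq> 0" by (intro notI) simp
      moreover have "real j < real N * 2 ^ m"
      proof -
        have "real j / 2 ^ m < real N" using \<open>real j / 2 ^ m \<le> \<beta>\<close> N by linarith
        then show ?thesis by (simp add: field_simps)
      qed
      then have "real j < real (N * 2 ^ m)" by simp
      then have "j < N * 2 ^ m" by (simp only: of_nat_less_iff)
      ultimately have "j \<in> {1..<N * 2 ^ m}" by simp
      then show ?thesis by (rule bspec[OF elim])
    qed
    have int: "integrable \<mu> (\<lambda>x. F (real j / 2 ^ m) * indicator (g_cell \<gamma> m j) x)" for j
    proof (cases "F (real j / 2 ^ m) = 0")
      case False
      then have "emeasure \<mu> (g_cell \<gamma> m j) < \<infinity>" using one[OF False] by auto
      then show ?thesis by (intro integrable_mult_right integrable_real_indicator cell)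
    qed simp
    have "(\<integral>x. ?f m x \<partial>\<mu>) = (\<Sum>j\<in>{1..<m * 2 ^ m}. \<integral>x. F (real j / 2 ^ m) * indicator (g_cell \<gamma> m j) x \<partial>\<mu>)"
      by (rule Bochner_Integration.integral_sum[OF int])
    also have "\<dots> = (\<Sum>j\<in>{1..<m * 2 ^ m}. if emeasure \<mu> (g_cell \<gamma> m j) = 0 then 0 else F (real j / 2 ^ m))"
    proof (rule sum.cong[OF refl])
      fix j
      have "(\<integral>x. F (real j / 2 ^ m) * indicator (g_cell \<gamma> m j) x \<partial>\<mu>) = F (real j / 2 ^ m) * measure \<mu> (g_cell \<gamma> m j)"
        using sets.sets_into_space[OF cell[of m j]] by (simp add: Int_absorb2)
      also have "\<dots> = (if emeasure \<mu> (g_cell \<gamma> m j) = 0 then 0 else F (real j / 2 ^ m))"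
        using one[of j] by (cases "F (real j / 2 ^ m) = 0") (auto simp: measure_def)
      finally show "(\<integral>x. F (real j / 2 ^ m) * indicator (g_cell \<gamma> m j) x \<partial>\<mu>) =
          (if emeasure \<mu> (g_cell \<gamma> m j) = 0 then 0 else F (real j / 2 ^ m))" .
    qed
    finally show ?case .
  qed
  ultimately show ?thesis by (rule Lim_transform_eventually)
qed

lemma point_measure_radon:
  assumes "\<And>\<alpha> \<beta>. 0 < \<alpha> \<Longrightarrow> finite (Q \<inter> g_band \<gamma> \<alpha> \<beta>)"
  shows "point_measure_on (supp_gev \<gamma>) Q \<in> radon_measures (supp_gev \<gamma>)"
  unfolding radon_measures_def
proof (intro CollectI conjI allI impI)
  show "sets (point_measure_on (supp_gev \<gamma>) Q) = sets (restrict_space borel (supp_gev \<gamma>))"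
    by (simp add: point_measure_on_def)
  fix K assume K: "compact K \<and> K \<subseteq> supp_gev \<gamma>"
  then obtain \<alpha> \<beta> where "0 < \<alpha>" "K \<subseteq> g_band \<gamma> \<alpha> \<beta>" using compact_subset_g_band by metis
  then have "finite (Q \<inter> K)" using assms[of \<alpha> \<beta>] by (meson Int_mono finite_subset order_refl)
  moreover have "K \<in> sets (restrict_space borel (supp_gev \<gamma>))"
    using K by (auto simp: sets_restrict_space_iff compact_imp_closed borel_closed)
  ultimately show "emeasure (point_measure_on (supp_gev \<gamma>) Q) K < \<infinity>"
    by (simp add: emeasure_point_measure_on emeasure_count_space less_top[symmetric])
qed

lemma integral_point_measure:
  assumes Q: "Q \<subseteq> S" and f: "f \<in> borel_measurable (restrict_space borel S)" and fin: "finite {x \<in> Q. f x \<noteq> 0}"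
  shows "(\<integral>x. f x \<partial>point_measure_on S Q) = (\<Sum>x\<in>{x \<in> Q. f x \<noteq> (0::real)}. f x)"
proof -
  have QS: "Q \<inter> S = Q" using Q by auto
  have "(\<lambda>x. x) \<in> measurable (count_space (Q \<inter> S)) (restrict_space borel S)"
    by (auto simp: measurable_count_space_eq1 space_restrict_space)
  then have "(\<integral>x. f x \<partial>point_measure_on S Q) = (\<integral>x. f x \<partial>count_space Q)"
    unfolding point_measure_on_def using f QS by (subst integral_distr) auto
  also have "\<dots> = (\<Sum>x\<in>{x \<in> Q. f x \<noteq> 0}. f x)"
    using lebesgue_integral_count_space_finite_support[OF fin] by simp
  finally show ?thesis .
qed

lemma eventually_simple_point_measure:
  assumes fin: "\<And>t. finite {x \<in> Q. g_gev \<gamma> x \<le> t}" and Q: "Q \<subseteq> supp_gev \<gamma>"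
  shows "eventually_simple \<gamma> (point_measure_on (supp_gev \<gamma>) Q)"
  unfolding eventually_simple_def
proof
  fix N :: nat
  let ?A = "{x \<in> Q. g_gev \<gamma> x \<le> real N}"
  let ?D = "{\<bar>g_gev \<gamma> x - g_gev \<gamma> y\<bar> | x y. x \<in> ?A \<and> y \<in> ?A \<and> x \<noteq> y}"
  have "?D = (\<lambda>(x, y). \<bar>g_gev \<gamma> x - g_gev \<gamma> y\<bar>) ` {(x, y) \<in> ?A \<times> ?A. x \<noteq> y}" by auto
  moreover have "finite {(x, y) \<in> ?A \<times> ?A. x \<noteq> y}"
    by (rule finite_subset[of _ "?A \<times> ?A"]) (use fin in auto)
  ultimately have finD: "finite ?D" by simp
  have pos: "0 < d" if "d \<in> ?D" for d
    using that Q g_gev_less by (auto simp: subset_iff) (metis linorder_neq_iff order_less_irrefl)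
  define \<delta> where "\<delta> = Min (insert 1 ?D)"
  have \<delta>: "0 < \<delta>" unfolding \<delta>_def using finD pos by (subst Min_gr_iff) auto
  have \<delta>D: "\<delta> \<le> \<bar>g_gev \<gamma> x - g_gev \<gamma> y\<bar>" if "x \<in> ?A" "y \<in> ?A" "x \<noteq> y" for x y
    unfolding \<delta>_def using finD that by (intro Min_le) auto
  have "(\<lambda>m. 1 / 2 ^ m :: real) \<longlonglongrightarrow> 0"
    using LIMSEQ_realpow_zero[of "1 / 2 :: real"] by (simp add: power_divide)
  from order_tendstoD(2)[OF this \<delta>]
  show "\<forall>\<^sub>F m in sequentially. \<forall>j\<in>{1..<N * 2 ^ m}.
     emeasure (point_measure_on (supp_gev \<gamma>) Q) (g_cell \<gamma> m j) = 0 \<or> emeasure (point_measure_on (supp_gev \<gamma>) Q) (g_cell \<gamma> m j) = 1"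
  proof (eventually_elim, intro ballI)
    fix m j assume m: "1 / 2 ^ m < \<delta>" and j: "j \<in> {1..<N * 2 ^ m}"
    have "real (Suc j) \<le> real (N * 2 ^ m)" using j by (intro of_nat_mono) simp
    then have le: "real (Suc j) / 2 ^ m \<le> real N" by (simp add: field_simps)
    have uniq: "x = y" if "x \<in> Q \<inter> g_cell \<gamma> m j" "y \<in> Q \<inter> g_cell \<gamma> m j" for x y
    proof (rule ccontr)
      assume "x \<noteq> y"
      have "x \<in> ?A" "y \<in> ?A" using that le by (auto simp: g_cell_def simp del: of_nat_Suc)
      from \<delta>D[OF this \<open>x \<noteq> y\<close>] have "\<delta> \<le> \<bar>g_gev \<gamma> x - g_gev \<gamma> y\<bar>" .
      moreover have "\<bar>g_gev \<gamma> x - g_gev \<gamma> y\<bar> \<le> 1 / 2 ^ m"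
        using that by (auto simp: g_cell_def add_divide_distrib abs_le_iff)
      ultimately show False using m by linarith
    qed
    show "emeasure (point_measure_on (supp_gev \<gamma>) Q) (g_cell \<gamma> m j) = 0 \<or> emeasure (point_measure_on (supp_gev \<gamma>) Q) (g_cell \<gamma> m j) = 1"
    proof (cases "Q \<inter> g_cell \<gamma> m j = {}")
      case False
      then obtain x where "x \<in> Q \<inter> g_cell \<gamma> m j" by blast
      then have "Q \<inter> g_cell \<gamma> m j = {x}" using uniq by blast
      then show ?thesis by (simp add: emeasure_point_measure_on[OF sets_g_cell])
    qed (simp add: emeasure_point_measure_on[OF sets_g_cell])
  qed
qed

section \<open>Void probabilities determine the law\<close>

lemma LIMSEQ_componentwise:
  fixes f :: "nat \<Rightarrow> 'i \<Rightarrow> 'b::topological_space"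
  assumes "\<And>i. (\<lambda>m. f m i) \<longlonglongrightarrow> l i"
  shows "f \<longlonglongrightarrow> l"
proof -
  have "limitin (product_topology (\<lambda>_. euclidean) UNIV) f l sequentially"
    unfolding limitin_componentwise using assms by simp
  then show ?thesis unfolding euclidean_product_topology limitin_canonical_iff .
qed

text \<open>Inclusion and exclusion, one event at a time.\<close>

lemma pattern_probability_eq:
  assumes M: "prob_space M" and P: "prob_space P"
    and V: "\<And>j. j \<in> I \<Longrightarrow> V j \<in> sets M" and U: "\<And>j. j \<in> I \<Longrightarrow> U j \<in> sets P"
    and I: "finite I"
    and eq: "\<And>J. J \<subseteq> I \<Longrightarrow> measure M {x\<in>space M. \<forall>j\<in>J. x \<in> V j} = measure P {x\<in>space P. \<forall>j\<in>J. x \<in> U j}"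
    and L: "finite L" "L \<subseteq> I" "J \<subseteq> I"
  shows "measure M {x\<in>space M. (\<forall>j\<in>J. x \<in> V j) \<and> (\<forall>j\<in>L. x \<notin> V j)} =
         measure P {x\<in>space P. (\<forall>j\<in>J. x \<in> U j) \<and> (\<forall>j\<in>L. x \<notin> U j)}"
  using L
proof (induction L arbitrary: J rule: finite_induct)
  case empty then show ?case using eq by simp
next
  case (insert i L)
  interpret M: prob_space M by fact
  interpret P: prob_space P by fact
  have meas: "{x\<in>space N. (\<forall>j\<in>J. x \<in> W j) \<and> (\<forall>j\<in>L. x \<notin> W j)} \<in> sets N"
    if "\<And>j. j \<in> I \<Longrightarrow> W j \<in> sets N" "J \<subseteq> I" "L \<subseteq> I" for N :: "'x measure" and W J L
  proof -
    have "finite J" "finite L" using that I finite_subset by blast+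
    have [measurable]: "W j \<in> sets N" if "j \<in> J" for j using that \<open>J \<subseteq> I\<close> \<open>\<And>j. j \<in> I \<Longrightarrow> W j \<in> sets N\<close> by blast
    have [measurable]: "W j \<in> sets N" if "j \<in> L" for j using that \<open>L \<subseteq> I\<close> \<open>\<And>j. j \<in> I \<Longrightarrow> W j \<in> sets N\<close> by blast
    show ?thesis using \<open>finite J\<close> \<open>finite L\<close> by measurable
  qed
  have split: "measure N {x\<in>space N. (\<forall>j\<in>J. x \<in> W j) \<and> (\<forall>j\<in>insert i L. x \<notin> W j)} =
      measure N {x\<in>space N. (\<forall>j\<in>J. x \<in> W j) \<and> (\<forall>j\<in>L. x \<notin> W j)} -
      measure N {x\<in>space N. (\<forall>j\<in>insert i J. x \<in> W j) \<and> (\<forall>j\<in>L. x \<notin> W j)}"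
    if W: "\<And>j. j \<in> I \<Longrightarrow> W j \<in> sets N" and N: "finite_measure N" for N :: "'x measure" and W
  proof -
    have "{x\<in>space N. (\<forall>j\<in>J. x \<in> W j) \<and> (\<forall>j\<in>insert i L. x \<notin> W j)} =
       {x\<in>space N. (\<forall>j\<in>J. x \<in> W j) \<and> (\<forall>j\<in>L. x \<notin> W j)} -
       {x\<in>space N. (\<forall>j\<in>insert i J. x \<in> W j) \<and> (\<forall>j\<in>L. x \<notin> W j)}" by auto
    then show ?thesis
      using insert.prems by (simp only:) (intro finite_measure.finite_measure_Diff[OF N] meas W, auto)
  qed
  have 1: "measure M {x\<in>space M. (\<forall>j\<in>J. x \<in> V j) \<and> (\<forall>j\<in>insert i L. x \<notin> V j)} =
      measure M {x\<in>space M. (\<forall>j\<in>J. x \<in> V j) \<and> (\<forall>j\<in>L. x \<notin> V j)} -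
      measure M {x\<in>space M. (\<forall>j\<in>insert i J. x \<in> V j) \<and> (\<forall>j\<in>L. x \<notin> V j)}"
    by (rule split[OF V M.finite_measure_axioms])
  have 2: "measure P {x\<in>space P. (\<forall>j\<in>J. x \<in> U j) \<and> (\<forall>j\<in>insert i L. x \<notin> U j)} =
      measure P {x\<in>space P. (\<forall>j\<in>J. x \<in> U j) \<and> (\<forall>j\<in>L. x \<notin> U j)} -
      measure P {x\<in>space P. (\<forall>j\<in>insert i J. x \<in> U j) \<and> (\<forall>j\<in>L. x \<notin> U j)}"
    by (rule split[OF U P.finite_measure_axioms])
  have sub: "L \<subseteq> I" "J \<subseteq> I" "insert i J \<subseteq> I" using insert.prems by auto
  show ?case unfolding 1 2 insert.IH[OF sub(1,2)] insert.IH[OF sub(1,3)] ..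
qed

text \<open>At level \<open>m\<close> a point process is recorded by its occupied cells below \<open>m\<close>, with mass 1 at
  the left end point of each. This discretization takes finitely many values with probabilities
  given by the void probabilities. If integrals against it converge to \<open>Y\<close> and to \<open>Z\<close>, these have
  the same law. Cell 0 is omitted: it reaches the end
  of the half-line at which the tents vanish.\<close>

lemma equal_expectation_from_voids:
  fixes V :: "nat \<Rightarrow> nat \<Rightarrow> 'a set" and U :: "nat \<Rightarrow> nat \<Rightarrow> 'b set"
    and Y :: "'a \<Rightarrow> nat \<Rightarrow> real" and Z :: "'b \<Rightarrow> nat \<Rightarrow> real"
    and \<tau> :: "nat \<Rightarrow> real \<Rightarrow> real" and H :: "(nat \<Rightarrow> real) \<Rightarrow> real"
  assumes M: "prob_space M" and P: "prob_space P"
    and V: "\<And>m j. 1 \<le> j \<Longrightarrow> V m j \<in> sets M" and U: "\<And>m j. 1 \<le> j \<Longrightarrow> U m j \<in> sets P"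
    and eq: "\<And>m J. finite J \<Longrightarrow> J \<subseteq> {1..} \<Longrightarrow>
       measure M {x\<in>space M. \<forall>j\<in>J. x \<in> V m j} = measure P {x\<in>space P. \<forall>j\<in>J. x \<in> U m j}"
    and Y: "Y \<in> borel_measurable M" and Z: "Z \<in> borel_measurable P"
    and limY: "AE x in M. \<forall>i. (\<lambda>m. \<Sum>j\<in>{1..<m * 2^m}. if x \<in> V m j then 0 else \<tau> i (real j / 2^m)) \<longlonglongrightarrow> Y x i"
    and limZ: "AE x in P. \<forall>i. (\<lambda>m. \<Sum>j\<in>{1..<m * 2^m}. if x \<in> U m j then 0 else \<tau> i (real j / 2^m)) \<longlonglongrightarrow> Z x i"
    and H: "continuous_on UNIV H" "\<And>y. \<bar>H y\<bar> \<le> B"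
  shows "(\<integral>x. H (Y x) \<partial>M) = (\<integral>x. H (Z x) \<partial>P)"
proof -
  let ?I = "\<lambda>m. {1..<m * 2^m} :: nat set"
  define G where "G m A = H (\<lambda>i. \<Sum>j\<in>A. \<tau> i (real j / 2^m))" for m :: nat and A :: "nat set"
  define pV where "pV m x = {j\<in>?I m. x \<notin> V m j}" for m x
  define pU where "pU m x = {j\<in>?I m. x \<notin> U m j}" for m x
  have sumV: "(\<Sum>j\<in>?I m. if x \<in> V m j then 0 else \<tau> i (real j / 2^m)) = (\<Sum>j\<in>pV m x. \<tau> i (real j / 2^m))" for m x i
    unfolding pV_def by (subst sum.inter_filter) (auto intro!: sum.cong)
  have sumU: "(\<Sum>j\<in>?I m. if x \<in> U m j then 0 else \<tau> i (real j / 2^m)) = (\<Sum>j\<in>pU m x. \<tau> i (real j / 2^m))" for m x i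
    unfolding pU_def by (subst sum.inter_filter) (auto intro!: sum.cong)
  have key: "(\<lambda>m. \<integral>x. G m (p m x) \<partial>N) \<longlonglongrightarrow> (\<integral>x. H (W x) \<partial>N)"
      and fin: "\<And>m. (\<integral>x. G m (p m x) \<partial>N) = (\<Sum>A\<in>Pow (?I m). G m A * measure N
         {x\<in>space N. (\<forall>j\<in>?I m - A. x \<in> Q m j) \<and> (\<forall>j\<in>A. x \<notin> Q m j)})"
    if N: "prob_space N" and Q: "\<And>m j. 1 \<le> j \<Longrightarrow> Q m j \<in> sets N" and p: "\<And>m x. p m x = {j\<in>?I m. x \<notin> Q m j}"
      and W: "W \<in> borel_measurable N"
      and lim: "AE x in N. \<forall>i. (\<lambda>m. \<Sum>j\<in>p m x. \<tau> i (real j / 2^m)) \<longlonglongrightarrow> W x i"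
    for N :: "'x measure" and Q :: "nat \<Rightarrow> nat \<Rightarrow> 'x set" and W p
  proof -
    interpret N: prob_space N by fact
    let ?S = "\<lambda>m A. {x\<in>space N. (\<forall>j\<in>?I m - A. x \<in> Q m j) \<and> (\<forall>j\<in>A. x \<notin> Q m j)}"
    have S: "?S m A \<in> sets N" if "A \<subseteq> ?I m" for m A
    proof -
      have "?S m A = (space N \<inter> (\<Inter>j\<in>?I m - A. Q m j \<inter> space N)) - (\<Union>j\<in>A. Q m j)"
        using sets.sets_into_space[OF Q] by (cases "?I m - A = {}") auto
      moreover have "space N \<inter> (\<Inter>j\<in>?I m - A. Q m j \<inter> space N) \<in> sets N"
        using Q by (cases "?I m - A = {}") (auto intro!: sets.Int sets.finite_INT)
      moreover have "(\<Union>j\<in>A. Q m j) \<in> sets N"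
        using that finite_subset[OF that] Q by (intro sets.finite_UN) force+
      ultimately show ?thesis by simp
    qed
    have GS: "G m (p m x) = (\<Sum>A\<in>Pow (?I m). G m A * indicator (?S m A) x)" if x: "x \<in> space N" for m x
    proof -
      have "indicator (?S m A) x = (if A = p m x then 1 else 0 :: real)" if "A \<in> Pow (?I m)" for A
        using that x p by (auto simp: indicator_def)
      then have "(\<Sum>A\<in>Pow (?I m). G m A * indicator (?S m A) x) = (\<Sum>A\<in>Pow (?I m). if A = p m x then G m A else 0)"
        by (intro sum.cong) auto
      also have "\<dots> = G m (p m x)" using p by (subst sum.delta) auto
      finally show ?thesis ..
    qed
    have Gm: "(\<lambda>x. G m (p m x)) \<in> borel_measurable N" for m
    proof (subst measurable_cong[OF GS])
      show "(\<lambda>x. \<Sum>A\<in>Pow (?I m). G m A * indicator (?S m A) x) \<in> borel_measurable N"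
        by (intro borel_measurable_sum borel_measurable_times borel_measurable_const borel_measurable_indicator S) blast
    qed
    show "(\<lambda>m. \<integral>x. G m (p m x) \<partial>N) \<longlonglongrightarrow> (\<integral>x. H (W x) \<partial>N)"
    proof (rule integral_dominated_convergence[where w="\<lambda>_. B"])
      show "AE x in N. (\<lambda>m. G m (p m x)) \<longlonglongrightarrow> H (W x)"
        using lim
      proof eventually_elim
        case (elim x)
        have "((\<lambda>m i. \<Sum>j\<in>p m x. \<tau> i (real j / 2^m)) \<longlongrightarrow> W x) sequentially"
          using elim by (intro LIMSEQ_componentwise) simp
        with H(1) show ?case unfolding G_def
          by (auto simp: continuous_on_eq_continuous_at continuous_at_sequentially comp_def isCont_tendsto_compose)
      qed
      show "(\<lambda>x. H (W x)) \<in> borel_measurable N"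
        by (rule measurable_compose[OF W borel_measurable_continuous_onI[OF H(1)]])
    qed (use Gm H(2) in \<open>auto simp: G_def\<close>)
    show "(\<integral>x. G m (p m x) \<partial>N) = (\<Sum>A\<in>Pow (?I m). G m A * measure N (?S m A))" for m
    proof -
      have "(\<integral>x. G m (p m x) \<partial>N) = (\<integral>x. (\<Sum>A\<in>Pow (?I m). G m A * indicator (?S m A) x) \<partial>N)"
        by (intro Bochner_Integration.integral_cong GS) auto
      also have "\<dots> = (\<Sum>A\<in>Pow (?I m). (\<integral>x. G m A * indicator (?S m A) x \<partial>N))"
        using S by (intro Bochner_Integration.integral_sum integrable_mult_right integrable_real_indicator) (auto simp: N.emeasure_eq_measure)
      also have "\<dots> = (\<Sum>A\<in>Pow (?I m). G m A * measure N (?S m A))"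
        using S by (intro sum.cong) auto
      finally show ?thesis .
    qed
  qed
  have 1: "(\<lambda>m. \<integral>x. G m (pV m x) \<partial>M) \<longlonglongrightarrow> (\<integral>x. H (Y x) \<partial>M)"
    by (rule key(1)[OF M V pV_def Y limY[unfolded sumV]])
  have 2: "(\<lambda>m. \<integral>x. G m (pU m x) \<partial>P) \<longlonglongrightarrow> (\<integral>x. H (Z x) \<partial>P)"
    by (rule key(1)[OF P U pU_def Z limZ[unfolded sumU]])
  have "(\<integral>x. G m (pV m x) \<partial>M) = (\<integral>x. G m (pU m x) \<partial>P)" for m
  proof -
    have a: "(\<integral>x. G m (pV m x) \<partial>M) = (\<Sum>A\<in>Pow (?I m). G m A * measure M
         {x\<in>space M. (\<forall>j\<in>?I m - A. x \<in> V m j) \<and> (\<forall>j\<in>A. x \<notin> V m j)})"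
      by (rule fin[OF M V pV_def Y limY[unfolded sumV]])
    have b: "(\<integral>x. G m (pU m x) \<partial>P) = (\<Sum>A\<in>Pow (?I m). G m A * measure P
         {x\<in>space P. (\<forall>j\<in>?I m - A. x \<in> U m j) \<and> (\<forall>j\<in>A. x \<notin> U m j)})"
      by (rule fin[OF P U pU_def Z limZ[unfolded sumU]])
    show ?thesis unfolding a b
    proof (rule sum.cong[OF refl], rule arg_cong2[where f="(*)", OF refl])
      fix A assume "A \<in> Pow (?I m)"
      then show "measure M {x\<in>space M. (\<forall>j\<in>?I m - A. x \<in> V m j) \<and> (\<forall>j\<in>A. x \<notin> V m j)} =
          measure P {x\<in>space P. (\<forall>j\<in>?I m - A. x \<in> U m j) \<and> (\<forall>j\<in>A. x \<notin> U m j)}"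
        by (intro pattern_probability_eq[OF M P, where I="?I m"] V U eq) (auto intro: finite_subset)
    qed
  qed
  with 1 2 show ?thesis using LIMSEQ_unique by simp
qed

section \<open>Dyadic cells under the Poisson random measure\<close>

lemma emeasure_m_gev_between:
  assumes s: "0 < s" "s \<le> t"
  shows "emeasure (m_gev \<gamma>) {x \<in> supp_gev \<gamma>. s < g_gev \<gamma> x \<and> g_gev \<gamma> x \<le> t} = ennreal (t - s)"
proof -
  let ?S = "supp_gev \<gamma>" and ?g = "g_gev \<gamma>"
  let ?C = "{x \<in> ?S. s < ?g x \<and> ?g x \<le> t}"
  let ?a = "g_inv \<gamma> s" and ?b = "g_inv \<gamma> t"
  have t: "0 < t" using s by linarith
  have inS: "x \<in> ?S" if "x \<in> {?a..?b}" for x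
    using g_band_subset[of \<gamma> s t] that unfolding g_band_eq[OF s(1) t] by blast
  have C: "?C = {?a<..?b}"
  proof -
    have "?C = g_band \<gamma> s t - {x \<in> ?S. ?g x = s}" by (auto simp: g_band_def)
    also have "{x \<in> ?S. ?g x = s} = {?a}" using s(1) g_inv_in_supp by force
    also have "g_band \<gamma> s t - {?a} = {?a<..?b}" unfolding g_band_eq[OF s(1) t] by auto
    finally show ?thesis .
  qed
  define f where "f x = (if x \<in> ?S then ?g x powr (1 + \<gamma>) else 0)" for x
  have gm [measurable]: "?g \<in> borel_measurable borel"
    unfolding g_gev_eq[abs_def] by measurable
  have fm [measurable]: "f \<in> borel_measurable borel" unfolding f_def[abs_def] by measurable
  have df: "deriv ?g x = f x" if "x \<in> ?S" for x
    using DERIV_imp_deriv[OF DERIV_g_gev[OF that]] that by (simp add: f_def)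
  have dm: "(\<lambda>x. ennreal (deriv ?g x)) \<in> borel_measurable (restrict_space lborel ?S)"
  proof (subst measurable_cong[where g="\<lambda>x. ennreal (f x)"])
    show "(\<lambda>x. ennreal (f x)) \<in> borel_measurable (restrict_space lborel ?S)"
      by (rule measurable_restrict_space1) measurable
  qed (auto simp: space_restrict_space df)
  have Cm: "?C \<in> sets (restrict_space lborel ?S)"
    unfolding C using C by (subst sets_restrict_space_iff) auto
  have "emeasure (m_gev \<gamma>) ?C = (\<integral>\<^sup>+x. ennreal (deriv ?g x) * indicator ?C x \<partial>restrict_space lborel ?S)"
    unfolding m_gev_def by (rule emeasure_density[OF dm Cm])
  also have "\<dots> = (\<integral>\<^sup>+x. ennreal (deriv ?g x) * indicator ?C x * indicator ?S x \<partial>lborel)"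
    by (subst nn_integral_restrict_space) auto
  also have "\<dots> = (\<integral>\<^sup>+x. ennreal (f x) * indicator {?a..?b} x \<partial>lborel)"
  proof (rule nn_integral_cong_AE)
    have "AE x in lborel. x \<noteq> ?a" by (rule AE_lborel_singleton)
    then show "AE x in lborel. ennreal (deriv ?g x) * indicator ?C x * indicator ?S x = ennreal (f x) * indicator {?a..?b} x"
    proof eventually_elim
      case (elim x)
      show ?case
      proof (cases "x \<in> {?a..?b}")
        case True
        then have "x \<in> ?S" "x \<in> ?C" using inS C elim by auto
        then show ?thesis using True df by simp
      next
        case False
        then have "x \<notin> ?C" unfolding C by auto
        then show ?thesis using False by simp
      qed
    qed
  qed
  also have "\<dots> = ennreal (?g ?b - ?g ?a)"
  proof (rule nn_integral_FTC_Icc)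
    show "?a \<le> ?b" using g_inv_le_iff[OF s(1) t] s(2) by simp
    show "f \<in> borel_measurable borel" by (rule fm)
    fix x assume "x \<in> {?a..?b}"
    then have x: "x \<in> ?S" by (rule inS)
    show "DERIV ?g x :> f x" using DERIV_g_gev[OF x] x by (simp add: f_def)
    show "0 \<le> f x" by (simp add: f_def)
  qed
  also have "\<dots> = ennreal (t - s)" using s t by simp
  finally show ?thesis .
qed

lemma emeasure_m_gev_cell: "1 \<le> j \<Longrightarrow> emeasure (m_gev \<gamma>) (g_cell \<gamma> m j) = ennreal (1 / 2 ^ m)"
  using emeasure_m_gev_between[of "real j / 2 ^ m" "real (Suc j) / 2 ^ m" \<gamma>]
  by (simp add: g_cell_def divide_right_mono diff_divide_distrib[symmetric])

lemma disjoint_g_cell: "disjoint_family_on (g_cell \<gamma> m) A"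
  unfolding disjoint_family_on_def
proof (intro ballI impI)
  fix i j :: nat assume "i \<noteq> j"
  moreover have "i = j" if "x \<in> g_cell \<gamma> m i" "x \<in> g_cell \<gamma> m j" for x
  proof -
    have "x \<in> supp_gev \<gamma>" using that(1) by (simp add: g_cell_def)
    show ?thesis
      by (rule trans[OF iffD1[OF g_cell_iff[OF \<open>x \<in> supp_gev \<gamma>\<close>] that(1)]
            sym[OF iffD1[OF g_cell_iff[OF \<open>x \<in> supp_gev \<gamma>\<close>] that(2)]]])
  qed
  ultimately show "g_cell \<gamma> m i \<inter> g_cell \<gamma> m j = {}" by blast
qed

context
  fixes \<gamma> :: real and P :: "'b measure" and \<eta> :: "'b \<Rightarrow> real measure"
  assumes PRM: "poisson_random_measure (supp_gev \<gamma>) (m_gev \<gamma>) P \<eta>"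
begin

lemmas PRM_unfolded = PRM[unfolded poisson_random_measure_def, THEN conjunct1]
  PRM[unfolded poisson_random_measure_def, THEN conjunct2, THEN conjunct1]
  PRM[unfolded poisson_random_measure_def, THEN conjunct2, THEN conjunct2, THEN conjunct1]
  PRM[unfolded poisson_random_measure_def, THEN conjunct2, THEN conjunct2, THEN conjunct2]

lemma PRM_radon: "\<omega> \<in> space P \<Longrightarrow> \<eta> \<omega> \<in> radon_measures (supp_gev \<gamma>)"
proof -
  assume "\<omega> \<in> space P"
  with PRM_unfolded(2) have "\<eta> \<omega> \<in> space (borel_of (vague_topology (supp_gev \<gamma>)))" by (rule measurable_space)
  then show ?thesis by (simp add: space_borel_of topspace_vague_topology)
qed

lemma PRM_prob_space: "prob_space P"
  by (rule PRM_unfolded(1))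

lemma PRM_indep: "prob_space.indep_vars P (\<lambda>_. borel) (\<lambda>j \<omega>. emeasure (\<eta> \<omega>) (g_cell \<gamma> m j)) {..<n::nat}"
  by (rule PRM_unfolded(4)[rule_format]) (simp add: sets_g_cell disjoint_g_cell)

lemma PRM_measurable: "(\<lambda>\<omega>. emeasure (\<eta> \<omega>) (g_cell \<gamma> m j)) \<in> borel_measurable P"
  using PRM_indep[of m "Suc j"] unfolding prob_space.indep_vars_def[OF PRM_prob_space] by blast

lemma PRM_cell_prob:
  assumes "1 \<le> j"
  shows "measure P {\<omega>\<in>space P. emeasure (\<eta> \<omega>) (g_cell \<gamma> m j) = of_nat k} = (1 / 2 ^ m) ^ k / fact k * exp (- (1 / 2 ^ m))"
proof -
  have m: "measure (m_gev \<gamma>) (g_cell \<gamma> m j) = 1 / 2 ^ m"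
    by (simp add: measure_def emeasure_m_gev_cell[OF assms])
  have fin: "emeasure (m_gev \<gamma>) (g_cell \<gamma> m j) < \<infinity>" by (simp add: emeasure_m_gev_cell[OF assms])
  from conjunct1[OF bspec[OF PRM_unfolded(3) sets_g_cell], rule_format, OF fin, of k] show ?thesis unfolding m .
qed

lemma PRM_void_probability:
  assumes J: "finite J" "J \<subseteq> {1..}"
  shows "measure P {\<omega>\<in>space P. \<forall>j\<in>J. emeasure (\<eta> \<omega>) (g_cell \<gamma> m j) = 0} = exp (- real (card J) / 2 ^ m)"
proof -
  interpret P: prob_space P by (rule PRM_prob_space)
  show ?thesis
  proof (cases "J = {}")
    case True then show ?thesis by (simp add: P.prob_space)
  next
    case False
    let ?X = "\<lambda>j \<omega>. emeasure (\<eta> \<omega>) (g_cell \<gamma> m j)"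
    have "J \<subseteq> {..<Suc (Max J)}" using J by (auto simp: less_Suc_eq_le)
    then have "P.prob (\<Inter>j\<in>J. ?X j -` {0} \<inter> space P) = (\<Prod>j\<in>J. P.prob (?X j -` {0} \<inter> space P))"
      using False J by (intro P.indep_varsD[OF PRM_indep]) auto
    also have "\<dots> = (\<Prod>j\<in>J. exp (- (1 / 2 ^ m)))"
    proof (rule prod.cong[OF refl])
      fix j assume "j \<in> J"
      then have "1 \<le> j" using J by auto
      have "?X j -` {0} \<inter> space P = {\<omega>\<in>space P. ?X j \<omega> = of_nat 0}" by auto
      then show "P.prob (?X j -` {0} \<inter> space P) = exp (- (1 / 2 ^ m))"
        using PRM_cell_prob[OF \<open>1 \<le> j\<close>, of m 0] by simp
    qed
    also have "\<dots> = exp (- real (card J) / 2 ^ m)" by (simp add: exp_of_nat_mult[symmetric])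
    also have "(\<Inter>j\<in>J. ?X j -` {0} \<inter> space P) = {\<omega>\<in>space P. \<forall>j\<in>J. ?X j \<omega> = 0}" using False by auto
    finally show ?thesis .
  qed
qed

text \<open>A cell of mass \<open>h = 1 / 2 ^ m\<close> holds at least two points with probability at most
  \<open>h ^ 2\<close>; there are \<open>N * 2 ^ m\<close> cells, so the failure probabilities are summable.\<close>

lemma PRM_eventually_simple: "AE \<omega> in P. eventually_simple \<gamma> (\<eta> \<omega>)"
  unfolding eventually_simple_def AE_all_countable
proof
  fix N :: nat
  interpret P: prob_space P by (rule PRM_prob_space)
  let ?X = "\<lambda>m j \<omega>. emeasure (\<eta> \<omega>) (g_cell \<gamma> m j)"
  let ?B = "\<lambda>m j. {\<omega>\<in>space P. \<not> (?X m j \<omega> = 0 \<or> ?X m j \<omega> = 1)}"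
  have [measurable]: "(\<lambda>\<omega>. ?X m j \<omega>) \<in> borel_measurable P" for m j by (rule PRM_measurable)
  have B: "P.prob (?B m j) \<le> (1 / 2 ^ m) ^ 2" if "1 \<le> j" for m j
  proof -
    let ?h = "1 / 2 ^ m :: real"
    let ?A0 = "{\<omega>\<in>space P. ?X m j \<omega> = 0}" and ?A1 = "{\<omega>\<in>space P. ?X m j \<omega> = 1}"
    have "?B m j = space P - (?A0 \<union> ?A1)" by auto
    then have "P.prob (?B m j) = 1 - P.prob (?A0 \<union> ?A1)" by (simp add: P.prob_compl)
    also have "P.prob (?A0 \<union> ?A1) = P.prob ?A0 + P.prob ?A1"
      by (rule P.finite_measure_Union) auto
    also have "\<dots> = exp (- ?h) + ?h * exp (- ?h)"
      using PRM_cell_prob[OF that, of m 0] PRM_cell_prob[OF that, of m 1] by simp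
    also have "1 - \<dots> \<le> ?h ^ 2"
    proof -
      have "(1 - ?h) * (1 + ?h) \<le> exp (- ?h) * (1 + ?h)"
        using exp_ge_add_one_self[of "- ?h"] by (intro mult_right_mono) auto
      then show ?thesis by (simp add: algebra_simps power2_eq_square)
    qed
    finally show ?thesis .
  qed
  let ?A = "\<lambda>m. \<Union>j\<in>{1..<N * 2 ^ m}. ?B m j"
  have A: "P.prob (?A m) \<le> real N * (1 / 2) ^ m" for m
  proof -
    have "P.prob (?A m) \<le> (\<Sum>j\<in>{1..<N * 2 ^ m}. P.prob (?B m j))"
      by (rule P.finite_measure_subadditive_finite) auto
    also have "\<dots> \<le> (\<Sum>j\<in>{1..<N * 2 ^ m}. (1 / 2 ^ m) ^ 2)" by (intro sum_mono B) simp
    also have "\<dots> = real (N * 2 ^ m - 1) * (1 / 2 ^ m) ^ 2" by simp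
    also have "\<dots> \<le> real (N * 2 ^ m) * (1 / 2 ^ m) ^ 2"
      by (intro mult_right_mono of_nat_mono diff_le_self) simp
    also have "\<dots> = real N * (1 / 2) ^ m" by (simp add: power2_eq_square power_divide)
    finally show ?thesis .
  qed
  have "AE \<omega> in P. \<forall>\<^sub>F m in sequentially. \<omega> \<in> space P - ?A m"
  proof (rule borel_cantelli_AE1)
    show "summable (\<lambda>m. P.prob (?A m))"
    proof (rule summable_comparison_test'[of "\<lambda>m. real N * (1 / 2) ^ m"])
      show "summable (\<lambda>m. real N * (1 / 2 :: real) ^ m)" by (intro summable_mult summable_geometric) simp
    qed (use A in simp)
  qed (auto simp: P.emeasure_eq_measure)
  then show "AE \<omega> in P. \<forall>\<^sub>F m in sequentially. \<forall>j\<in>{1..<N * 2 ^ m}. ?X m j \<omega> = 0 \<or> ?X m j \<omega> = 1"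
  proof eventually_elim
    case (elim \<omega>)
    then show ?case by eventually_elim auto
  qed
qed

end

section \<open>The exponential sample\<close>

definition hazard :: "(real \<Rightarrow> real) \<Rightarrow> real \<Rightarrow> real" where
  "hazard F x = - ln (1 - F x)"

text \<open>The almost sure properties of a sample on which all pathwise arguments rely. The last one says
  that every level is exceeded infinitely often.\<close>

definition regular_sample :: "(real \<Rightarrow> real) \<Rightarrow> (nat \<Rightarrow> real) \<Rightarrow> bool" where
  "regular_sample F x \<longleftrightarrow> inj (\<lambda>i. hazard F (x i)) \<and> (\<forall>i. F (x i) < 1) \<and> (\<forall>i. 0 < hazard F (x i)) \<and>
     (\<forall>t r. \<exists>n. r \<le> exceed (\<lambda>i. hazard F (x i)) n t)"

lemma exceed_unbounded:
  assumes "\<And>n. \<exists>i\<ge>n. t < e i"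
  shows "\<exists>n. r \<le> exceed e n t"
proof (induction r)
  case (Suc r)
  then obtain n where n: "r \<le> exceed e n t" by blast
  obtain i where i: "n \<le> i" "t < e i" using assms by blast
  have "exceed e n t \<le> exceed e i t" by (rule exceed_mono[OF i(1)])
  then have "Suc r \<le> exceed e (Suc i) t" using n i by (simp add: exceed_Suc)
  then show ?case by blast
qed simp

context prob_space
begin

text \<open>The probability integral transform. Continuity makes \<open>{x. F x \<le> u}\<close> a closed half-line on whose
  end point \<open>F\<close> equals \<open>u\<close>.\<close>

lemma prob_cdf_transform:
  assumes X: "X \<in> borel_measurable M" and F: "cdf (distr M borel X) = F" and cont: "continuous_on UNIV F"
    and u: "0 \<le> u" "u < 1"
  shows "prob {\<omega>\<in>space M. F (X \<omega>) \<le> u} = u"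
proof -
  let ?D = "distr M borel X"
  interpret D: real_distribution ?D using X by (rule real_distribution_distr)
  have mono: "F x \<le> F y" if "x \<le> y" for x y using D.cdf_nondecreasing[OF that] F by simp
  let ?A = "{x. F x \<le> u}"
  have closed: "closed ?A" using cont by (intro closed_Collect_le continuous_intros)
  have eq: "prob {\<omega>\<in>space M. F (X \<omega>) \<le> u} = measure ?D ?A"
  proof -
    have "{\<omega>\<in>space M. F (X \<omega>) \<le> u} = X -` ?A \<inter> space M" by auto
    then show ?thesis using X closed by (simp add: measure_distr borel_closed)
  qed
  show ?thesis
  proof (cases "?A = {}")
    case True
    have "u = 0"
    proof (rule ccontr)
      assume "u \<noteq> 0"
      then have "0 < u" using u by simp
      have "(F \<longlongrightarrow> 0) at_bot" using D.cdf_lim_at_bot F by simp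
      from order_tendstoD(2)[OF this \<open>0 < u\<close>] obtain x where "F x < u"
        by (auto simp: eventually_at_bot_linorder)
      then show False using True by (metis (mono_tags) empty_iff less_imp_le mem_Collect_eq)
    qed
    with True eq show ?thesis by simp
  next
    case False
    have "(F \<longlongrightarrow> 1) at_top" using D.cdf_lim_at_top_prob F by simp
    from order_tendstoD(1)[OF this u(2)] obtain y where y: "u < F y"
      by (auto simp: eventually_at_top_linorder)
    have ub: "x \<le> y" if "x \<in> ?A" for x
    proof (rule ccontr)
      assume "\<not> x \<le> y" then show False using mono[of y x] y that by simp
    qed
    then have bdd: "bdd_above ?A" by (rule bdd_aboveI)
    define s where "s = Sup ?A"
    have s: "s \<in> ?A" unfolding s_def by (rule closed_contains_Sup[OF False bdd closed])
    have A: "?A = {..s}"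
    proof (intro subset_antisym subsetI)
      fix x assume "x \<in> ?A" then show "x \<in> {..s}" unfolding s_def using cSup_upper[OF _ bdd] by simp
    next
      fix x assume "x \<in> {..s}" then show "x \<in> ?A" using mono[of x s] s by simp
    qed
    have "F s = u"
    proof (rule ccontr)
      assume "F s \<noteq> u"
      then have "F s < u" using s by simp
      have "(F \<longlongrightarrow> F s) (at_right s)"
        using cont by (auto simp: continuous_on_def intro: tendsto_within_subset)
      from order_tendstoD(2)[OF this \<open>F s < u\<close>] obtain b where b: "s < b" "\<And>y. s < y \<Longrightarrow> y < b \<Longrightarrow> F y < u"
        unfolding eventually_at_right_field by blast
      then obtain y where "s < y" "y < b" using dense by blast
      then have "y \<in> ?A" using b(2) by (auto intro: less_imp_le)
      then show False using A \<open>s < y\<close> by auto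
    qed
    moreover have "measure ?D {..s} = F s" unfolding F[symmetric] cdf_def ..
    ultimately show ?thesis using eq A by simp
  qed
qed

lemma AE_cdf_transform_less_1:
  assumes X: "X \<in> borel_measurable M" and F: "cdf (distr M borel X) = F" and cont: "continuous_on UNIV F"
  shows "AE \<omega> in M. F (X \<omega>) < 1"
proof -
  have [measurable]: "F \<in> borel_measurable borel" by (rule borel_measurable_continuous_onI[OF cont])
  note X[measurable]
  have "u \<le> prob {\<omega>\<in>space M. F (X \<omega>) < 1}" if "0 \<le> u" "u < 1" for u
  proof -
    have "prob {\<omega>\<in>space M. F (X \<omega>) \<le> u} \<le> prob {\<omega>\<in>space M. F (X \<omega>) < 1}"
      using that by (intro finite_measure_mono) auto
    then show ?thesis using prob_cdf_transform[OF X F cont that] by simp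
  qed
  then have "1 \<le> prob {\<omega>\<in>space M. F (X \<omega>) < 1}"
    by (intro dense_le_bounded[of 0 1]) auto
  then have "prob {\<omega>\<in>space M. F (X \<omega>) < 1} = 1" by (intro antisym) auto
  then have "AE \<omega> in M. \<omega> \<in> {\<omega>\<in>space M. F (X \<omega>) < 1}" by (intro AE_prob_1)
  then show ?thesis by auto
qed

lemma prob_hazard_greater:
  assumes X: "X \<in> borel_measurable M" and F: "cdf (distr M borel X) = F" and cont: "continuous_on UNIV F"
    and t: "0 \<le> t"
  shows "prob {\<omega>\<in>space M. t < hazard F (X \<omega>)} = exp (- t)"
proof -
  have [measurable]: "F \<in> borel_measurable borel" by (rule borel_measurable_continuous_onI[OF cont])
  note X[measurable]
  have "prob {\<omega>\<in>space M. t < hazard F (X \<omega>)} = prob {\<omega>\<in>space M. \<not> F (X \<omega>) \<le> 1 - exp (- t)}"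
  proof (rule measure_eq_AE)
    show "AE \<omega> in M. \<omega> \<in> {\<omega>\<in>space M. t < hazard F (X \<omega>)} \<longleftrightarrow> \<omega> \<in> {\<omega>\<in>space M. \<not> F (X \<omega>) \<le> 1 - exp (- t)}"
      using AE_cdf_transform_less_1[OF X F cont]
    proof eventually_elim
      case (elim \<omega>)
      have "t < hazard F (X \<omega>) \<longleftrightarrow> ln (1 - F (X \<omega>)) < - t" by (auto simp: hazard_def)
      also have "\<dots> \<longleftrightarrow> 1 - F (X \<omega>) < exp (- t)" using elim by (metis diff_gt_0_iff_gt exp_less_cancel_iff exp_ln)
      finally show ?case by auto
    qed
  qed (unfold hazard_def, measurable)
  also have "\<dots> = 1 - prob {\<omega>\<in>space M. F (X \<omega>) \<le> 1 - exp (- t)}" by (rule prob_neg) measurable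
  also have "\<dots> = exp (- t)" using prob_cdf_transform[OF X F cont, of "1 - exp (- t)"] t by simp
  finally show ?thesis .
qed

lemma AE_exceed_unbounded:
  fixes E :: "nat \<Rightarrow> 'a \<Rightarrow> real"
  assumes ind: "indep_vars (\<lambda>_. borel) E UNIV"
    and tail: "\<And>i t. 0 \<le> t \<Longrightarrow> prob {\<omega>\<in>space M. t < E i \<omega>} = exp (- t)"
  shows "AE \<omega> in M. \<forall>t r. \<exists>n. r \<le> exceed (\<lambda>i. E i \<omega>) n t"
proof -
  have [measurable]: "E i \<in> borel_measurable M" for i using ind by (auto simp: indep_vars_def)
  have "AE \<omega> in M. \<exists>i\<ge>n. real k < E i \<omega>" for n k :: nat
  proof -
    let ?B = "{\<omega>\<in>space M. \<forall>i\<ge>n. E i \<omega> \<le> real k}"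
    have "prob ?B \<le> (1 - exp (- real k)) ^ Suc m" for m
    proof -
      have "prob ?B \<le> prob (\<Inter>i\<in>{n..n + m}. E i -` {..real k} \<inter> space M)"
        by (intro finite_measure_mono sets.finite_INT) auto
      also have "\<dots> = (\<Prod>i\<in>{n..n + m}. prob (E i -` {..real k} \<inter> space M))"
        by (intro indep_varsD[OF ind]) auto
      also have "\<dots> = (\<Prod>i\<in>{n..n + m}. 1 - exp (- real k))"
      proof (rule prod.cong[OF refl])
        fix i
        have "E i -` {..real k} \<inter> space M = space M - {\<omega>\<in>space M. real k < E i \<omega>}" by auto
        then show "prob (E i -` {..real k} \<inter> space M) = 1 - exp (- real k)"
          using tail[of "real k" i] by (simp add: prob_compl)
      qed
      also have "\<dots> = (1 - exp (- real k)) ^ Suc m" by simp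
      finally show ?thesis .
    qed
    moreover have "(\<lambda>m. (1 - exp (- real k)) ^ Suc m) \<longlonglongrightarrow> 0"
      by (intro LIMSEQ_Suc LIMSEQ_realpow_zero) auto
    ultimately have "prob ?B \<le> 0" by (intro LIMSEQ_le_const) auto
    then have "prob ?B = 0" using measure_nonneg[of M ?B] by linarith
    then have "?B \<in> null_sets M" by (auto simp: emeasure_eq_measure)
    then have "AE \<omega> in M. \<omega> \<notin> ?B" by (rule AE_not_in)
    then show ?thesis using AE_space by eventually_elim (auto simp: not_le)
  qed
  then have "AE \<omega> in M. \<forall>n k::nat. \<exists>i\<ge>n. real k < E i \<omega>" by (simp add: AE_all_countable)
  then show ?thesis
  proof eventually_elim
    case (elim \<omega>)
    show ?case
    proof (intro allI exceed_unbounded)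
      fix t n
      obtain k :: nat where "t \<le> real k" using real_arch_simple by blast
      then show "\<exists>i\<ge>n. t < E i \<omega>" using elim[rule_format, of n k] by force
    qed
  qed
qed

lemma AE_distinct:
  fixes E :: "nat \<Rightarrow> 'a \<Rightarrow> real"
  assumes ind: "indep_vars (\<lambda>_. borel) E UNIV"
    and tail: "\<And>i t. 0 \<le> t \<Longrightarrow> prob {\<omega>\<in>space M. t < E i \<omega>} = exp (- t)"
  shows "AE \<omega> in M. inj (\<lambda>i. E i \<omega>)"
proof -
  have [measurable]: "E i \<in> borel_measurable M" for i using ind by (auto simp: indep_vars_def)
  have atom: "prob {\<omega>\<in>space M. E i \<omega> = x} = 0" for i x
  proof (cases "0 < x")
    case False
    have "prob {\<omega>\<in>space M. E i \<omega> = x} \<le> prob (space M - {\<omega>\<in>space M. 0 < E i \<omega>})"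
      using False by (intro finite_measure_mono) auto
    also have "\<dots> = 0" using tail[of 0 i] by (simp add: prob_compl)
    finally show ?thesis using measure_nonneg[of M "{\<omega>\<in>space M. E i \<omega> = x}"] by linarith
  next
    case True
    have le: "prob {\<omega>\<in>space M. E i \<omega> = x} \<le> exp (- s) - exp (- x)" if "0 \<le> s" "s < x" for s
    proof -
      have "prob {\<omega>\<in>space M. E i \<omega> = x} \<le> prob ({\<omega>\<in>space M. s < E i \<omega>} - {\<omega>\<in>space M. x < E i \<omega>})"
        using that by (intro finite_measure_mono) auto
      also have "\<dots> = prob {\<omega>\<in>space M. s < E i \<omega>} - prob {\<omega>\<in>space M. x < E i \<omega>}"
        using that by (intro finite_measure_Diff) auto
      finally show ?thesis using tail that by simp
    qed
    have "((\<lambda>s. exp (- s) - exp (- x)) \<longlongrightarrow> exp (- x) - exp (- x)) (at_left x)" by (intro tendsto_intros)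
    moreover have "\<forall>\<^sub>F s in at_left x. prob {\<omega>\<in>space M. E i \<omega> = x} \<le> exp (- s) - exp (- x)"
      using eventually_at_left_real[OF True] by eventually_elim (use le in simp)
    ultimately have "prob {\<omega>\<in>space M. E i \<omega> = x} \<le> exp (- x) - exp (- x)"
      by (rule tendsto_lowerbound) simp
    then show ?thesis using measure_nonneg[of M "{\<omega>\<in>space M. E i \<omega> = x}"] by linarith
  qed
  have ne: "AE \<omega> in M. E i \<omega> \<noteq> E j \<omega>" if "i \<noteq> j" for i j
  proof -
    have iv: "indep_var borel (E i) borel (E j)"
    proof -
      have "indep_var borel ((\<lambda>f. f i) \<circ> (\<lambda>\<omega>. restrict (\<lambda>k. E k \<omega>) {i})) borel ((\<lambda>f. f j) \<circ> (\<lambda>\<omega>. restrict (\<lambda>k. E k \<omega>) {j}))"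
        using that by (intro indep_var_compose[OF indep_var_restrict[OF ind]]) auto
      then show ?thesis by (simp add: comp_def)
    qed
    let ?Di = "distr M borel (E i)" and ?Dj = "distr M borel (E j)"
    interpret Dj: prob_space ?Dj by (rule prob_space_distr) simp
    interpret Di: prob_space ?Di by (rule prob_space_distr) simp
    let ?D = "{p \<in> space (borel \<Otimes>\<^sub>M borel). fst p = (snd p :: real)}"
    have Dm: "?D \<in> sets (borel \<Otimes>\<^sub>M borel)" by measurable
    have "emeasure M {\<omega>\<in>space M. E i \<omega> = E j \<omega>} = emeasure (distr M (borel \<Otimes>\<^sub>M borel) (\<lambda>\<omega>. (E i \<omega>, E j \<omega>))) ?D"
      using Dm by (subst emeasure_distr) (auto intro!: arg_cong2[where f=emeasure] simp: space_pair_measure)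
    also have "distr M (borel \<Otimes>\<^sub>M borel) (\<lambda>\<omega>. (E i \<omega>, E j \<omega>)) = ?Di \<Otimes>\<^sub>M ?Dj"
      using iv by (simp add: indep_var_distribution_eq)
    also have "emeasure (?Di \<Otimes>\<^sub>M ?Dj) ?D = (\<integral>\<^sup>+x. emeasure ?Dj (Pair x -` ?D) \<partial>?Di)"
      using Dm by (intro Dj.emeasure_pair_measure_alt) simp
    also have "\<dots> = (\<integral>\<^sup>+x. 0 \<partial>?Di)"
    proof (rule nn_integral_cong)
      fix x :: real
      have "Pair x -` ?D = {x}" by (auto simp: space_pair_measure)
      then have "emeasure ?Dj (Pair x -` ?D) = emeasure M {\<omega>\<in>space M. E j \<omega> = x}"
        by (simp add: emeasure_distr vimage_def Int_def conj_commute)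
      then show "emeasure ?Dj (Pair x -` ?D) = 0" using atom[of j x] by (simp add: emeasure_eq_measure)
    qed
    finally have "emeasure M {\<omega>\<in>space M. E i \<omega> = E j \<omega>} = 0" by simp
    then have "{\<omega>\<in>space M. E i \<omega> = E j \<omega>} \<in> null_sets M" by auto
    from AE_not_in[OF this] AE_space show ?thesis by eventually_elim auto
  qed
  have "AE \<omega> in M. \<forall>i j. i \<noteq> j \<longrightarrow> E i \<omega> \<noteq> E j \<omega>"
    unfolding AE_all_countable using ne by auto
  then show ?thesis by eventually_elim (auto simp: inj_def)
qed

end

section \<open>The coupling with a Poisson process of fixed law\<close>

lemma hazard_mono:
  assumes "\<And>x y. x \<le> y \<Longrightarrow> F x \<le> F y" "x \<le> y" "F y < 1"
  shows "hazard F x \<le> hazard F y"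
  using assms(1)[OF assms(2)] assms(3) by (simp add: hazard_def)

lemma cum_hazard_limit_bounds:
  assumes F1: "\<And>x. F x \<le> 1"
    and lim: "(\<lambda>r. ereal (real r) * cum_hazard F (z r)) \<longlonglongrightarrow> ereal u" and \<delta>: "0 < \<delta>"
  shows "\<forall>\<^sub>F r in sequentially. F (z r) < 1 \<and> \<bar>real r * hazard F (z r) - u\<bar> < \<delta>"
proof -
  have "\<forall>\<^sub>F r in sequentially. ereal (u - \<delta>) < ereal (real r) * cum_hazard F (z r)"
    by (rule order_tendstoD(1)[OF lim]) (use \<delta> in simp)
  moreover have "\<forall>\<^sub>F r in sequentially. ereal (real r) * cum_hazard F (z r) < ereal (u + \<delta>)"
    by (rule order_tendstoD(2)[OF lim]) (use \<delta> in simp)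
  ultimately show ?thesis using eventually_gt_at_top[of 0]
  proof eventually_elim
    case (elim r)
    have "F (z r) \<noteq> 1"
    proof
      assume "F (z r) = 1"
      then have "ereal (real r) * cum_hazard F (z r) = \<infinity>" using elim(3) by (simp add: cum_hazard_def)
      then show False using elim(2) by simp
    qed
    then have "F (z r) < 1" using F1[of "z r"] by simp
    moreover have "ereal (real r) * cum_hazard F (z r) = ereal (real r * hazard F (z r))"
      using \<open>F (z r) \<noteq> 1\<close> by (simp add: cum_hazard_def hazard_def)
    ultimately show ?case using elim(1,2) by (auto simp: abs_less_iff)
  qed
qed

text \<open>Polya's argument: a pointwise limit of monotone functions that is continuous is locally uniform.
  On a finite grid in the coordinate \<open>g_gev \<gamma>\<close> the hazards are close to their limits, and monotonicity
  extends this between the grid points and keeps points outside the grid away from the support of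
  \<open>T\<close>. Arguments outside \<open>supp_gev \<gamma>\<close> are included, since points of the rescaled range may
  lie there.\<close>

lemma uniform_coupling:
  fixes F T :: "real \<Rightarrow> real" and a b :: "nat \<Rightarrow> real"
  assumes mono: "\<And>x y. x \<le> y \<Longrightarrow> F x \<le> F y" and F1: "\<And>x. F x \<le> 1"
    and a: "\<And>r. 1 \<le> r \<Longrightarrow> 0 < a r"
    and lim: "\<And>x. x \<in> supp_gev \<gamma> \<Longrightarrow>
           (\<lambda>r. ereal (real r) * cum_hazard F (a r * x - b r)) \<longlonglongrightarrow> ereal (g_gev \<gamma> x)"
    and T: "continuous_on UNIV T" and \<alpha>: "0 < \<alpha>" and supp: "\<And>u. T u \<noteq> 0 \<Longrightarrow> \<alpha> \<le> u \<and> u \<le> \<beta>"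
    and \<epsilon>: "0 < \<epsilon>"
  shows "\<forall>\<^sub>F r in sequentially. \<forall>y. F (a r * y - b r) < 1 \<longrightarrow>
    \<bar>(if y \<in> supp_gev \<gamma> then T (g_gev \<gamma> y) else 0) - T (real r * hazard F (a r * y - b r))\<bar>
      \<le> \<epsilon> * indicator {\<alpha> / 2..\<beta> + 1} (real r * hazard F (a r * y - b r))"
proof -
  obtain \<delta> where \<delta>: "0 < \<delta>" "\<And>u v. \<bar>u - v\<bar> < \<delta> \<Longrightarrow> \<bar>T u - T v\<bar> < \<epsilon>"
    using uniform_continuity_compact_support[OF T supp \<epsilon>] by blast
  \<comment> \<open>The mesh of the grid; the grid starts at \<open>\<alpha> - 2 * \<eta>\<close>, which is positive.\<close>
  define \<eta> where "\<eta> = min (\<delta> / 3) (min (\<alpha> / 4) (1 / 2))"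
  have \<eta>: "0 < \<eta>" "2 * \<eta> < \<delta>" "2 * \<eta> \<le> \<alpha> / 2" "2 * \<eta> \<le> 1" using \<delta>(1) \<alpha> by (auto simp: \<eta>_def min_def)
  define u where "u i = \<alpha> - 2 * \<eta> + real i * \<eta>" for i
  have u0: "0 < u i" for i
  proof -
    have "0 \<le> real i * \<eta>" using \<eta>(1) by simp
    then show ?thesis using \<eta>(3) \<alpha> unfolding u_def by linarith
  qed
  have u_Suc: "u (Suc i) = u i + \<eta>" for i by (simp add: u_def algebra_simps)
  obtain K :: nat where K: "(\<beta> + \<eta> - (\<alpha> - 2 * \<eta>)) / \<eta> \<le> real K" using real_arch_simple by blast
  then have uK: "\<beta> + \<eta> \<le> u K" using \<eta>(1) by (simp add: u_def field_simps)
  let ?y = "\<lambda>i. g_inv \<gamma> (u i)"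
  have "\<forall>\<^sub>F r in sequentially. \<forall>i\<in>{..Suc K}. F (a r * ?y i - b r) < 1 \<and> \<bar>real r * hazard F (a r * ?y i - b r) - u i\<bar> < \<eta>"
  proof (rule eventually_ball_finite, simp, rule ballI)
    fix i
    have "(\<lambda>r. ereal (real r) * cum_hazard F (a r * ?y i - b r)) \<longlonglongrightarrow> ereal (u i)"
      using lim[OF g_inv_in_supp[OF u0]] u0 by simp
    from cum_hazard_limit_bounds[OF F1 this \<eta>(1)]
    show "\<forall>\<^sub>F r in sequentially. F (a r * ?y i - b r) < 1 \<and> \<bar>real r * hazard F (a r * ?y i - b r) - u i\<bar> < \<eta>" .
  qed
  then show ?thesis using eventually_ge_at_top[of 1]
  proof (eventually_elim, intro allI impI)
    fix r :: nat and y :: real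
    let ?z = "\<lambda>y. a r * y - b r"
    let ?\<rho> = "\<lambda>y. real r * hazard F (?z y)"
    assume grid: "\<forall>i\<in>{..Suc K}. F (?z (?y i)) < 1 \<and> \<bar>?\<rho> (?y i) - u i\<bar> < \<eta>"
      and r: "1 \<le> r" and Fy: "F (?z y) < 1"
    have ar: "0 < a r" using a[OF r] .
    have \<rho>mono: "?\<rho> v \<le> ?\<rho> w" if "v \<le> w" "F (?z w) < 1" for v w
    proof -
      have "?z v \<le> ?z w" using that(1) ar by simp
      from hazard_mono[of F, OF mono this that(2)] show ?thesis by (intro mult_left_mono) auto
    qed
    have close: "\<bar>?\<rho> y - g_gev \<gamma> y\<bar> \<le> 2 * \<eta>" if y: "y \<in> supp_gev \<gamma>" "u 0 \<le> g_gev \<gamma> y" "g_gev \<gamma> y \<le> u K"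
    proof -
      define i where "i = nat \<lfloor>(g_gev \<gamma> y - u 0) / \<eta>\<rfloor>"
      have "0 \<le> (g_gev \<gamma> y - u 0) / \<eta>" using y \<eta>(1) by simp
      then have "real i \<le> (g_gev \<gamma> y - u 0) / \<eta>" "(g_gev \<gamma> y - u 0) / \<eta> < real i + 1"
        unfolding i_def by linarith+
      then have i: "u i \<le> g_gev \<gamma> y" "g_gev \<gamma> y \<le> u (Suc i)"
        using \<eta>(1) by (auto simp: u_def field_simps)
      have "real i * \<eta> \<le> real K * \<eta>" using i(1) y(3) by (simp add: u_def)
      then have "i \<le> K" using \<eta>(1) by simp
      have "?y i \<le> y" "y \<le> ?y (Suc i)"
        using i g_gev_le_iff[OF g_inv_in_supp[OF u0[of i]] y(1)] g_gev_le_iff[OF y(1) g_inv_in_supp[OF u0[of "Suc i"]]] u0[of i] u0[of "Suc i"]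
        by auto
      then have "?\<rho> (?y i) \<le> ?\<rho> y" "?\<rho> y \<le> ?\<rho> (?y (Suc i))"
        using \<rho>mono[OF _ Fy] \<rho>mono[of y "?y (Suc i)"] grid \<open>i \<le> K\<close> by auto
      moreover have "\<bar>?\<rho> (?y i) - u i\<bar> < \<eta>" "\<bar>?\<rho> (?y (Suc i)) - u (Suc i)\<bar> < \<eta>"
        using grid \<open>i \<le> K\<close> by auto
      ultimately show ?thesis using i u_Suc[of i] by linarith
    qed
    show "\<bar>(if y \<in> supp_gev \<gamma> then T (g_gev \<gamma> y) else 0) - T (?\<rho> y)\<bar> \<le> \<epsilon> * indicator {\<alpha> / 2..\<beta> + 1} (?\<rho> y)"
    proof (cases "y \<in> supp_gev \<gamma> \<and> u 0 \<le> g_gev \<gamma> y \<and> g_gev \<gamma> y \<le> u K")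
      case True
      then have c: "\<bar>?\<rho> y - g_gev \<gamma> y\<bar> \<le> 2 * \<eta>" using close by blast
      show ?thesis
      proof (cases "T (g_gev \<gamma> y) = 0 \<and> T (?\<rho> y) = 0")
        case False
        have "\<alpha> / 2 \<le> ?\<rho> y \<and> ?\<rho> y \<le> \<beta> + 1"
        proof (cases "T (?\<rho> y) = 0")
          case True
          then have "\<alpha> \<le> g_gev \<gamma> y \<and> g_gev \<gamma> y \<le> \<beta>" using False supp by blast
          then show ?thesis using c \<eta> by linarith
        next
          case False
          then have "\<alpha> \<le> ?\<rho> y \<and> ?\<rho> y \<le> \<beta>" by (rule supp)
          then show ?thesis using \<alpha> by linarith
        qed
        moreover have "\<bar>T (g_gev \<gamma> y) - T (?\<rho> y)\<bar> < \<epsilon>" using \<delta>(2) c \<eta>(2) by (simp add: abs_minus_commute)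
        ultimately show ?thesis using True by (simp add: indicator_def)
      qed (use \<epsilon> in \<open>simp add: indicator_def\<close>)
    next
      case False
      have "T (g_gev \<gamma> y) = 0" if "y \<in> supp_gev \<gamma>"
      proof (rule ccontr)
        assume "T (g_gev \<gamma> y) \<noteq> 0"
        then have "\<alpha> \<le> g_gev \<gamma> y \<and> g_gev \<gamma> y \<le> \<beta>" by (rule supp)
        then have "u 0 \<le> g_gev \<gamma> y" "g_gev \<gamma> y \<le> u K" using uK \<eta>(1) by (auto simp: u_def)
        then show False using False that by blast
      qed
      then have "(if y \<in> supp_gev \<gamma> then T (g_gev \<gamma> y) else 0) = 0" by simp
      moreover have "T (?\<rho> y) = 0"
      proof (rule ccontr)
        assume "T (?\<rho> y) \<noteq> 0"
        then have \<rho>: "\<alpha> \<le> ?\<rho> y" "?\<rho> y \<le> \<beta>" using supp by auto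
        have "?y 0 \<le> y"
        proof (rule ccontr)
          assume "\<not> ?y 0 \<le> y"
          then have "?\<rho> y \<le> ?\<rho> (?y 0)" using grid by (intro \<rho>mono) auto
          moreover have "\<bar>?\<rho> (?y 0) - u 0\<bar> < \<eta>" using grid by auto
          moreover have "u 0 = \<alpha> - 2 * \<eta>" by (simp add: u_def)
          ultimately show False using \<rho> \<eta>(1) by linarith
        qed
        moreover have "y \<le> ?y K"
        proof (rule ccontr)
          assume "\<not> y \<le> ?y K"
          then have "?\<rho> (?y K) \<le> ?\<rho> y" by (intro \<rho>mono Fy) auto
          moreover have "\<bar>?\<rho> (?y K) - u K\<bar> < \<eta>" using grid by auto
          ultimately show False using \<rho> uK by linarith
        qed
        ultimately have "y \<in> g_band \<gamma> (u 0) (u K)" by (simp add: g_band_eq[OF u0 u0])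
        then show False using False by (simp add: g_band_def)
      qed
      ultimately show ?thesis using \<epsilon> by (simp add: indicator_def)
    qed
  qed
qed

definition accepted_sum :: "nat \<Rightarrow> (nat \<Rightarrow> real) \<Rightarrow> (real \<Rightarrow> real) \<Rightarrow> real" where
  "accepted_sum r e T = (\<Sum>n. if n \<in> accepted r e then T (real r * e n) else 0)"

lemma accepted_sum_finite:
  assumes "finite A" "A \<subseteq> accepted r e" "\<And>n. n \<in> accepted r e \<Longrightarrow> T (real r * e n) \<noteq> 0 \<Longrightarrow> n \<in> A"
  shows "accepted_sum r e T = (\<Sum>n\<in>A. T (real r * e n))"
proof -
  have "accepted_sum r e T = (\<Sum>n\<in>A. if n \<in> accepted r e then T (real r * e n) else 0)"
    unfolding accepted_sum_def using assms by (intro suminf_finite) auto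
  also have "\<dots> = (\<Sum>n\<in>A. T (real r * e n))" using assms(2) by (intro sum.cong) auto
  finally show ?thesis .
qed

lemma measurable_accepted_sum:
  assumes [measurable]: "\<And>i. (\<lambda>\<omega>. e \<omega> i) \<in> borel_measurable M" "T \<in> borel_measurable borel"
  shows "(\<lambda>\<omega>. accepted_sum r (e \<omega>) T) \<in> borel_measurable M"
proof -
  have [measurable]: "(\<lambda>\<omega>. exceed (e \<omega>) n (e \<omega> n)) \<in> measurable M (count_space UNIV)" for n
    by (intro measurable_exceed) auto
  show ?thesis unfolding accepted_sum_def accepted_def mem_Collect_eq by measurable
qed

text \<open>The accepted exponential values, scaled by \<open>r\<close> and moved by the inverse of \<open>g_gev \<gamma>\<close>, form a
  Radon point measure on the support to which the discretization by occupied cells applies.\<close>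

lemma regular_sample_points:
  fixes \<gamma> :: real
  assumes reg: "regular_sample F x" and r: "1 \<le> r"
  defines "e \<equiv> \<lambda>i. hazard F (x i)"
  defines "Q \<equiv> (\<lambda>n. g_inv \<gamma> (real r * e n)) ` accepted r e"
  shows "Q \<subseteq> supp_gev \<gamma>" and "\<And>t. finite {n \<in> accepted r e. real r * e n \<le> t}"
    and "\<And>t. finite {q \<in> Q. g_gev \<gamma> q \<le> t}"
    and "point_measure_on (supp_gev \<gamma>) Q \<in> radon_measures (supp_gev \<gamma>)"
    and "eventually_simple \<gamma> (point_measure_on (supp_gev \<gamma>) Q)"
    and "(\<integral>q. tent m k (g_gev \<gamma> q) \<partial>point_measure_on (supp_gev \<gamma>) Q) = accepted_sum r e (tent m k)"
    and "emeasure (point_measure_on (supp_gev \<gamma>) Q) (g_cell \<gamma> m j) = 0 \<longleftrightarrow>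
      (\<forall>n\<in>accepted r e. e n \<notin> {real j * (1 / (real r * 2 ^ m))<..real (Suc j) * (1 / (real r * 2 ^ m))})"
proof -
  have pos: "0 < real r * e n" for n using reg r by (simp add: regular_sample_def e_def)
  have inj: "inj e" using reg by (simp add: regular_sample_def e_def)
  have injQ: "inj (\<lambda>n. g_inv \<gamma> (real r * e n))"
  proof (rule injI)
    fix n n' assume "g_inv \<gamma> (real r * e n) = g_inv \<gamma> (real r * e n')"
    then have "real r * e n = real r * e n'" using g_gev_g_inv[OF pos] by metis
    then show "n = n'" using r inj by (auto dest: injD)
  qed
  show QS: "Q \<subseteq> supp_gev \<gamma>" using pos by (auto simp: Q_def g_inv_in_supp)
  show finn: "finite {n \<in> accepted r e. real r * e n \<le> t}" for t
  proof -
    obtain N where "r \<le> exceed e N (t / real r)" using reg unfolding regular_sample_def e_def by blast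
    then have "finite {n \<in> accepted r e. e n \<le> t / real r}" by (rule finite_accepted_below)
    moreover have "e n \<le> t / real r \<longleftrightarrow> real r * e n \<le> t" for n using r by (simp add: field_simps)
    ultimately show ?thesis by simp
  qed
  have "{q \<in> Q. g_gev \<gamma> q \<le> t} = (\<lambda>n. g_inv \<gamma> (real r * e n)) ` {n \<in> accepted r e. real r * e n \<le> t}" for t
    using pos by (auto simp: Q_def)
  then show finQ: "finite {q \<in> Q. g_gev \<gamma> q \<le> t}" for t using finn by simp
  show "point_measure_on (supp_gev \<gamma>) Q \<in> radon_measures (supp_gev \<gamma>)"
  proof (rule point_measure_radon)
    fix \<alpha> \<beta> :: real
    show "finite (Q \<inter> g_band \<gamma> \<alpha> \<beta>)" by (rule finite_subset[OF _ finQ[of \<beta>]]) (auto simp: g_band_def)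
  qed
  show "eventually_simple \<gamma> (point_measure_on (supp_gev \<gamma>) Q)"
    by (rule eventually_simple_point_measure[OF finQ QS])
  show "(\<integral>q. tent m k (g_gev \<gamma> q) \<partial>point_measure_on (supp_gev \<gamma>) Q) = accepted_sum r e (tent m k)"
  proof -
    let ?A = "{n \<in> accepted r e. tent m k (real r * e n) \<noteq> 0}"
    have finA: "finite ?A"
      by (rule finite_subset[OF _ finn[of "real (k + 3) / 2 ^ m"]]) (use tent_support in blast)
    have eq: "{q \<in> Q. tent m k (g_gev \<gamma> q) \<noteq> 0} = (\<lambda>n. g_inv \<gamma> (real r * e n)) ` ?A"
      using pos by (auto simp: Q_def)
    have "(\<integral>q. tent m k (g_gev \<gamma> q) \<partial>point_measure_on (supp_gev \<gamma>) Q) = (\<Sum>q\<in>{q \<in> Q. tent m k (g_gev \<gamma> q) \<noteq> 0}. tent m k (g_gev \<gamma> q))"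
    proof (rule integral_point_measure[OF QS])
      show "(\<lambda>q. tent m k (g_gev \<gamma> q)) \<in> borel_measurable (restrict_space borel (supp_gev \<gamma>))"
        by (rule measurable_compose[OF measurable_g_gev borel_measurable_continuous_onI[OF continuous_tent]])
      show "finite {q \<in> Q. tent m k (g_gev \<gamma> q) \<noteq> 0}" unfolding eq using finA by simp
    qed
    also have "\<dots> = (\<Sum>n\<in>?A. tent m k (g_gev \<gamma> (g_inv \<gamma> (real r * e n))))"
      unfolding eq by (rule sum.reindex_cong[OF inj_on_subset[OF injQ subset_UNIV]]) auto
    also have "\<dots> = (\<Sum>n\<in>?A. tent m k (real r * e n))" using pos by simp
    also have "\<dots> = accepted_sum r e (tent m k)" by (rule accepted_sum_finite[OF finA, symmetric]) auto
    finally show ?thesis .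
  qed
  show "emeasure (point_measure_on (supp_gev \<gamma>) Q) (g_cell \<gamma> m j) = 0 \<longleftrightarrow>
      (\<forall>n\<in>accepted r e. e n \<notin> {real j * (1 / (real r * 2 ^ m))<..real (Suc j) * (1 / (real r * 2 ^ m))})"
  proof -
    have c: "g_inv \<gamma> (real r * e n) \<in> g_cell \<gamma> m j \<longleftrightarrow>
        e n \<in> {real j * (1 / (real r * 2 ^ m))<..real (Suc j) * (1 / (real r * 2 ^ m))}" for n
      using pos[of n] r by (simp add: g_cell_def g_inv_in_supp field_simps del: of_nat_Suc)
    have "emeasure (point_measure_on (supp_gev \<gamma>) Q) (g_cell \<gamma> m j) = 0 \<longleftrightarrow> Q \<inter> g_cell \<gamma> m j = {}"
      unfolding emeasure_point_measure_on[OF sets_g_cell] by (simp add: emeasure_count_space_eq_0)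
    also have "\<dots> \<longleftrightarrow> (\<forall>n\<in>accepted r e. g_inv \<gamma> (real r * e n) \<notin> g_cell \<gamma> m j)"
      by (auto simp: Q_def)
    finally show ?thesis unfolding c .
  qed
qed

abbreviation tents :: "nat \<Rightarrow> real \<Rightarrow> real" where
  "tents i \<equiv> tent (fst (prod_decode i)) (snd (prod_decode i))"

lemma occupied_cells_limit_tents:
  assumes "\<mu> \<in> radon_measures (supp_gev \<gamma>)" "eventually_simple \<gamma> \<mu>"
  shows "(\<lambda>m. \<Sum>j\<in>{1..<m * 2 ^ m}. if emeasure \<mu> (g_cell \<gamma> m j) = 0 then 0 else tents i (real j / 2 ^ m))
    \<longlonglongrightarrow> tent_integral \<gamma> \<mu> i"
  unfolding tent_integral_def
  by (rule occupied_cells_limit[OF assms continuous_tent _ tent_support]) simp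

text \<open>A dyadic cell of width \<open>1 / 2 ^ m\<close> for the scaled values is one of width \<open>1 / (r * 2 ^ m)\<close> for the
  exponential variables. The factor \<open>r\<close> in the void probability of the accepted values cancels,
  leaving those of the Poisson random measure.\<close>

lemma (in prob_space) law_accepted_sums:
  fixes X :: "nat \<Rightarrow> 'a \<Rightarrow> real" and P :: "'b measure" and H :: "(nat \<Rightarrow> real) \<Rightarrow> real" and B :: real
  assumes ind: "indep_vars (\<lambda>_. borel) (\<lambda>i \<omega>. hazard F (X i \<omega>)) UNIV"
    and tail: "\<And>i t. 0 \<le> t \<Longrightarrow> prob {\<omega>\<in>space M. t < hazard F (X i \<omega>)} = exp (- t)"
    and reg: "AE \<omega> in M. regular_sample F (\<lambda>i. X i \<omega>)"
    and PRM: "poisson_random_measure (supp_gev \<gamma>) (m_gev \<gamma>) P \<eta>"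
    and r: "1 \<le> r" and H: "continuous_on UNIV H" "\<And>y. \<bar>H y\<bar> \<le> B"
  shows "expectation (\<lambda>\<omega>. H (\<lambda>i. accepted_sum r (\<lambda>n. hazard F (X n \<omega>)) (tents i))) = (\<integral>\<omega>. H (tent_integral \<gamma> (\<eta> \<omega>)) \<partial>P)"
proof -
  let ?e = "\<lambda>\<omega> n. hazard F (X n \<omega>)"
  have [measurable]: "(\<lambda>\<omega>. hazard F (X n \<omega>)) \<in> borel_measurable M" for n using ind by (auto simp: indep_vars_def)
  define w where "w m = 1 / (real r * 2 ^ m)" for m :: nat
  define V where "V m j = {\<omega>\<in>space M. \<forall>n\<in>accepted r (?e \<omega>). ?e \<omega> n \<notin> {real j * w m<..real (Suc j) * w m}}" for m j
  define U where "U m j = {\<omega>\<in>space P. emeasure (\<eta> \<omega>) (g_cell \<gamma> m j) = 0}" for m j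
  have w: "0 < w m" for m using r by (simp add: w_def)
  have io: "AE \<omega> in M. \<forall>t. \<exists>n. r \<le> exceed (?e \<omega>) n t"
    using reg by eventually_elim (simp add: regular_sample_def)
  show ?thesis
  proof (rule equal_expectation_from_voids[where V=V and U=U and \<tau>=tents and B=B and H=H
      and Y="\<lambda>\<omega> i. accepted_sum r (?e \<omega>) (tents i)" and Z="\<lambda>\<omega>. tent_integral \<gamma> (\<eta> \<omega>)"])
    show "prob_space M" by (rule prob_space_axioms)
    show "prob_space P" by (rule PRM_prob_space[OF PRM])
    show "V m j \<in> sets M" for m j
    proof -
      have [measurable]: "(\<lambda>\<omega>. exceed (?e \<omega>) n (?e \<omega> n)) \<in> measurable M (count_space UNIV)" for n
        by (intro measurable_exceed) auto
      have "V m j = {\<omega>\<in>space M. \<forall>n. exceed (?e \<omega>) n (?e \<omega> n) < r \<longrightarrow> \<not> (real j * w m < ?e \<omega> n \<and> ?e \<omega> n \<le> real (Suc j) * w m)}"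
        by (auto simp: V_def accepted_def)
      also have "\<dots> \<in> sets M" by measurable
      finally show ?thesis .
    qed
    show "U m j \<in> sets P" for m j
    proof -
      note PRM_measurable[OF PRM, measurable]
      show ?thesis unfolding U_def by measurable
    qed
    show "prob {x\<in>space M. \<forall>j\<in>J. x \<in> V m j} = measure P {x\<in>space P. \<forall>j\<in>J. x \<in> U m j}" if J: "finite J" "J \<subseteq> {1..}" for m J
    proof -
      have "{x\<in>space M. \<forall>j\<in>J. x \<in> V m j} = {\<omega>\<in>space M. \<forall>j\<in>J. \<forall>n\<in>accepted r (?e \<omega>). ?e \<omega> n \<notin> {real j * w m<..real (Suc j) * w m}}"
        by (auto simp: V_def)
      then have "prob {x\<in>space M. \<forall>j\<in>J. x \<in> V m j} = exp (- w m * real r * real (card J))"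
        using void_probability[OF ind tail io w J(1)] by simp
      also have "- w m * real r * real (card J) = - real (card J) / 2 ^ m" using r by (simp add: w_def)
      also have "exp \<dots> = measure P {\<omega>\<in>space P. \<forall>j\<in>J. emeasure (\<eta> \<omega>) (g_cell \<gamma> m j) = 0}"
        using PRM_void_probability[OF PRM J] by simp
      also have "{\<omega>\<in>space P. \<forall>j\<in>J. emeasure (\<eta> \<omega>) (g_cell \<gamma> m j) = 0} = {x\<in>space P. \<forall>j\<in>J. x \<in> U m j}"
        by (auto simp: U_def)
      finally show ?thesis .
    qed
    show "(\<lambda>\<omega> i. accepted_sum r (?e \<omega>) (tents i)) \<in> borel_measurable M"
      by (rule measurable_coordinatewise_then_product, rule measurable_accepted_sum)
         (auto intro!: borel_measurable_continuous_onI continuous_tent)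
    have \<eta>: "\<eta> \<in> measurable P (borel_of (vague_topology (supp_gev \<gamma>)))" by (rule PRM_unfolded(2)[OF PRM])
    show "(\<lambda>\<omega>. tent_integral \<gamma> (\<eta> \<omega>)) \<in> borel_measurable P"
      by (rule measurable_compose[OF \<eta> measurable_tent_integral_vague])
    show "AE x in M. \<forall>i. (\<lambda>m. \<Sum>j\<in>{1..<m * 2^m}. if x \<in> V m j then 0 else tents i (real j / 2^m)) \<longlonglongrightarrow> accepted_sum r (?e x) (tents i)"
      using reg AE_space
    proof (eventually_elim, intro allI)
      fix \<omega> i assume reg: "regular_sample F (\<lambda>i. X i \<omega>)" and \<omega>: "\<omega> \<in> space M"
      note pts = regular_sample_points[OF reg r]
      let ?\<mu> = "point_measure_on (supp_gev \<gamma>) ((\<lambda>n. g_inv \<gamma> (real r * ?e \<omega> n)) ` accepted r (?e \<omega>))"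
      have "\<omega> \<in> V m j \<longleftrightarrow> emeasure ?\<mu> (g_cell \<gamma> m j) = 0" for m j
        unfolding pts(7) using \<omega> by (simp add: V_def w_def)
      moreover have "tent_integral \<gamma> ?\<mu> i = accepted_sum r (?e \<omega>) (tents i)"
        unfolding tent_integral_def by (rule pts(6))
      ultimately show "(\<lambda>m. \<Sum>j\<in>{1..<m * 2^m}. if \<omega> \<in> V m j then 0 else tents i (real j / 2^m)) \<longlonglongrightarrow> accepted_sum r (?e \<omega>) (tents i)"
        using occupied_cells_limit_tents[where i=i and \<gamma>=\<gamma>, OF pts(4,5)] by simp
    qed
    show "AE x in P. \<forall>i. (\<lambda>m. \<Sum>j\<in>{1..<m * 2^m}. if x \<in> U m j then 0 else tents i (real j / 2^m)) \<longlonglongrightarrow> tent_integral \<gamma> (\<eta> x) i"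
      using PRM_eventually_simple[OF PRM] AE_space
    proof (eventually_elim, intro allI)
      fix \<omega> i assume "eventually_simple \<gamma> (\<eta> \<omega>)" and \<omega>: "\<omega> \<in> space P"
      from occupied_cells_limit_tents[where i=i and \<gamma>=\<gamma>, OF PRM_radon[OF PRM \<omega>] this(1)]
      show "(\<lambda>m. \<Sum>j\<in>{1..<m * 2^m}. if \<omega> \<in> U m j then 0 else tents i (real j / 2^m)) \<longlonglongrightarrow> tent_integral \<gamma> (\<eta> \<omega>) i"
        using \<omega> by (simp add: U_def)
    qed
  qed (fact H)+
qed

text \<open>The metric on sequences enumerates the index type by \<open>from_nat\<close>, which need not be the identity on
  the natural numbers.\<close>

lemma dist_fun_le_partial_sum:
  fixes x y :: "nat \<Rightarrow> real"
  shows "dist x y \<le> (\<Sum>n<N. min 1 \<bar>x (from_nat n) - y (from_nat n)\<bar>) + 2 * (1 / 2) ^ N"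
proof -
  let ?f = "\<lambda>n. (1 / 2) ^ n * min (dist (x (from_nat n)) (y (from_nat n))) 1 :: real"
  have f: "0 \<le> ?f n" "?f n \<le> (1 / 2) ^ n" for n by (auto intro!: mult_left_le)
  have geo: "summable (\<lambda>n. (1 / 2 :: real) ^ n)" by (intro summable_geometric) simp
  have sum: "summable ?f" by (rule summable_comparison_test'[OF geo]) (use f in simp)
  have "dist x y = (\<Sum>n. ?f (n + N)) + (\<Sum>n<N. ?f n)"
    unfolding dist_fun_def by (rule suminf_split_initial_segment[OF sum])
  also have "(\<Sum>n. ?f (n + N)) \<le> (\<Sum>n. (1 / 2) ^ N * (1 / 2) ^ n)"
  proof (rule suminf_le)
    show "?f (n + N) \<le> (1 / 2) ^ N * (1 / 2) ^ n" for n
      using f(2)[of "n + N"] by (simp add: power_add mult.commute)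
    show "summable (\<lambda>n. ?f (n + N))" using sum by (rule summable_ignore_initial_segment)
    show "summable (\<lambda>n. (1 / 2 :: real) ^ N * (1 / 2) ^ n)" using geo by (rule summable_mult)
  qed
  also have "(\<Sum>n. (1 / 2 :: real) ^ N * (1 / 2) ^ n) = 2 * (1 / 2) ^ N"
    using suminf_mult[OF geo, of "(1 / 2) ^ N"] suminf_geometric[of "1 / 2 :: real"] by simp
  also have "(\<Sum>n<N. ?f n) \<le> (\<Sum>n<N. min 1 \<bar>x (from_nat n) - y (from_nat n)\<bar>)"
  proof (rule sum_mono)
    fix n
    have "?f n \<le> 1 * min (dist (x (from_nat n)) (y (from_nat n))) 1"
      by (intro mult_right_mono power_le_one) auto
    then show "?f n \<le> min 1 \<bar>x (from_nat n) - y (from_nat n)\<bar>" by (simp add: dist_real_def min.commute)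
  qed
  finally show ?thesis by simp
qed

lemma (in prob_space) Lipschitz_expectation_close:
  fixes Y Z :: "nat \<Rightarrow> 'a \<Rightarrow> nat \<Rightarrow> real" and H :: "(nat \<Rightarrow> real) \<Rightarrow> real"
  assumes Y: "\<And>r. Y r \<in> borel_measurable M" and Z: "\<And>r. Z r \<in> borel_measurable M"
    and close: "\<And>i. (\<lambda>r. expectation (\<lambda>\<omega>. min 1 \<bar>Y r \<omega> i - Z r \<omega> i\<bar>)) \<longlonglongrightarrow> 0"
    and H: "continuous_on UNIV H" "\<And>y z. \<bar>H y - H z\<bar> \<le> L * dist y z" "\<And>y. \<bar>H y\<bar> \<le> B" and L: "0 \<le> L"
  shows "(\<lambda>r. expectation (\<lambda>\<omega>. H (Y r \<omega>)) - expectation (\<lambda>\<omega>. H (Z r \<omega>))) \<longlonglongrightarrow> 0"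
proof (rule LIMSEQ_I)
  fix e :: real assume e: "0 < e"
  have coord: "(\<lambda>\<omega>. W r \<omega> i) \<in> borel_measurable M" if "\<And>r. W r \<in> borel_measurable M" for W :: "nat \<Rightarrow> 'a \<Rightarrow> nat \<Rightarrow> real" and r i
    by (rule measurable_product_then_coordinatewise[OF that])
  have [measurable]: "(\<lambda>\<omega>. Y r \<omega> i) \<in> borel_measurable M" "(\<lambda>\<omega>. Z r \<omega> i) \<in> borel_measurable M" for r i
    using coord[of Y] coord[of Z] Y Z by auto
  have Hm: "(\<lambda>\<omega>. H (W \<omega>)) \<in> borel_measurable M" if "W \<in> borel_measurable M" for W
    by (rule measurable_compose[OF that borel_measurable_continuous_onI[OF H(1)]])
  have iH: "integrable M (\<lambda>\<omega>. H (W \<omega>))" if "W \<in> borel_measurable M" for W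
    using H(3) by (intro integrable_const_bound[of _ B] Hm that) auto
  have im: "integrable M (\<lambda>\<omega>. min 1 \<bar>Y r \<omega> i - Z r \<omega> i\<bar>)" for r i
    by (intro integrable_const_bound[of _ 1]) auto
  obtain N where N: "(1 / 2 :: real) ^ N < e / (4 * (L + 1))"
    using real_arch_pow_inv[of "e / (4 * (L + 1))" "1 / 2"] e L by auto
  have "(\<lambda>r. \<Sum>n<N. expectation (\<lambda>\<omega>. min 1 \<bar>Y r \<omega> (from_nat n) - Z r \<omega> (from_nat n)\<bar>)) \<longlonglongrightarrow> (\<Sum>n<N. 0)"
    by (intro tendsto_sum close)
  then have "\<forall>\<^sub>F r in sequentially. (\<Sum>n<N. expectation (\<lambda>\<omega>. min 1 \<bar>Y r \<omega> (from_nat n) - Z r \<omega> (from_nat n)\<bar>)) < e / (2 * (L + 1))"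
    using e L by (intro order_tendstoD(2)) auto
  then have "\<forall>\<^sub>F r in sequentially. \<bar>expectation (\<lambda>\<omega>. H (Y r \<omega>)) - expectation (\<lambda>\<omega>. H (Z r \<omega>))\<bar> < e"
  proof eventually_elim
    case (elim r)
    let ?s = "\<lambda>\<omega>. L * ((\<Sum>n<N. min 1 \<bar>Y r \<omega> (from_nat n) - Z r \<omega> (from_nat n)\<bar>) + 2 * (1 / 2) ^ N)"
    have "\<bar>expectation (\<lambda>\<omega>. H (Y r \<omega>)) - expectation (\<lambda>\<omega>. H (Z r \<omega>))\<bar> = \<bar>expectation (\<lambda>\<omega>. H (Y r \<omega>) - H (Z r \<omega>))\<bar>"
      using iH Y Z by simp
    also have "\<dots> \<le> expectation (\<lambda>\<omega>. \<bar>H (Y r \<omega>) - H (Z r \<omega>)\<bar>)" by (rule integral_abs_bound)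
    also have "\<dots> \<le> expectation ?s"
    proof (rule integral_mono)
      show "integrable M (\<lambda>\<omega>. \<bar>H (Y r \<omega>) - H (Z r \<omega>)\<bar>)" using iH Y Z by simp
      show "integrable M ?s"
        by (intro integrable_mult_right Bochner_Integration.integrable_add Bochner_Integration.integrable_sum im integrable_const)
      show "\<bar>H (Y r \<omega>) - H (Z r \<omega>)\<bar> \<le> ?s \<omega>" for \<omega>
        using H(2) mult_left_mono[OF dist_fun_le_partial_sum L] by (rule order_trans)
    qed
    also have "expectation ?s = L * ((\<Sum>n<N. expectation (\<lambda>\<omega>. min 1 \<bar>Y r \<omega> (from_nat n) - Z r \<omega> (from_nat n)\<bar>)) + 2 * (1 / 2) ^ N)"
      using im by (simp add: prob_space)
    also have "\<dots> \<le> L * (e / (2 * (L + 1)) + 2 * (e / (4 * (L + 1))))"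
      using elim N L by (intro mult_left_mono add_mono) auto
    also have "\<dots> = L / (L + 1) * e"
    proof -
      have "e / (2 * D) + 2 * (e / (4 * D)) = e / D" if "D \<noteq> 0" for D :: real using that by (simp add: field_simps)
      from this[of "L + 1"] show ?thesis using L by simp
    qed
    also have "\<dots> < 1 * e" using L e by (intro mult_strict_right_mono) (auto simp: field_simps)
    finally show ?case by simp
  qed
  then show "\<exists>no. \<forall>n\<ge>no. norm (expectation (\<lambda>\<omega>. H (Y n \<omega>)) - expectation (\<lambda>\<omega>. H (Z n \<omega>)) - 0) < e"
    by (simp add: eventually_sequentially)
qed

lemma integral_eq_on:
  fixes f :: "'x \<Rightarrow> real"
  assumes sets: "sets \<mu> = sets \<nu>" and K: "K \<in> sets \<mu>"
    and eq: "\<And>A. A \<in> sets \<mu> \<Longrightarrow> A \<subseteq> K \<Longrightarrow> emeasure \<mu> A = emeasure \<nu> A"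
    and f: "\<And>x. x \<in> space \<mu> \<Longrightarrow> x \<notin> K \<Longrightarrow> f x = 0"
  shows "(\<integral>x. f x \<partial>\<mu>) = (\<integral>x. f x \<partial>\<nu>)"
proof -
  have sp: "space \<mu> = space \<nu>" using sets by (rule sets_eq_imp_space_eq)
  have K\<nu>: "K \<in> sets \<nu>" using K sets by simp
  have Ksp: "K \<inter> space \<mu> \<in> sets \<mu>" "K \<inter> space \<nu> \<in> sets \<nu>" using K K\<nu> by auto
  have "restrict_space \<mu> K = restrict_space \<nu> K"
  proof (rule measure_eqI)
    show s: "sets (restrict_space \<mu> K) = sets (restrict_space \<nu> K)" using sets by (simp add: sets_restrict_space)
    fix A assume A: "A \<in> sets (restrict_space \<mu> K)"
    then have "A \<in> sets \<mu>" "A \<subseteq> K" using K by (auto simp: sets_restrict_space_iff)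
    then show "emeasure (restrict_space \<mu> K) A = emeasure (restrict_space \<nu> K) A"
      using eq Ksp by (simp add: emeasure_restrict_space)
  qed
  then have "(\<integral>x. f x \<partial>restrict_space \<mu> K) = (\<integral>x. f x \<partial>restrict_space \<nu> K)" by simp
  then have "(\<integral>x. indicator K x *\<^sub>R f x \<partial>\<mu>) = (\<integral>x. indicator K x *\<^sub>R f x \<partial>\<nu>)"
    using Ksp by (simp add: integral_restrict_space)
  moreover have "(\<integral>x. indicator K x *\<^sub>R f x \<partial>\<mu>) = (\<integral>x. f x \<partial>\<mu>)"
    by (rule Bochner_Integration.integral_cong) (use f in \<open>auto simp: indicator_def\<close>)
  moreover have "(\<integral>x. indicator K x *\<^sub>R f x \<partial>\<nu>) = (\<integral>x. f x \<partial>\<nu>)"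
    by (rule Bochner_Integration.integral_cong) (use f sp in \<open>auto simp: indicator_def\<close>)
  ultimately show ?thesis by simp
qed

lemma point_measure_on_Int: "point_measure_on S (Q \<inter> S) = point_measure_on S Q"
  by (simp add: point_measure_on_def Int_assoc)

lemma regular_sample_accepted:
  assumes reg: "regular_sample F x" and mono: "\<And>x y. x \<le> y \<Longrightarrow> F x \<le> F y"
  shows "accepted r (\<lambda>i. hazard F (x i)) = accepted r x" and "inj x"
proof -
  have inj: "inj (\<lambda>i. hazard F (x i))" and F: "\<And>i. F (x i) < 1" using reg by (auto simp: regular_sample_def)
  then show "inj x" by (auto simp: inj_def)
  have le: "hazard F (x i) \<le> hazard F (x j)" if "x i \<le> x j" for i j
    by (rule hazard_mono[where F=F, OF mono that F])
  have "hazard F (x i) < hazard F (x j) \<longleftrightarrow> x i < x j" for i j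
  proof
    assume "hazard F (x i) < hazard F (x j)" then show "x i < x j" using le[of j i] by linarith
  next
    assume "x i < x j"
    then have "hazard F (x i) \<le> hazard F (x j)" "i \<noteq> j" using le by auto
    then show "hazard F (x i) < hazard F (x j)" using inj by (auto simp: less_le dest: injD)
  qed
  then show "accepted r (\<lambda>i. hazard F (x i)) = accepted r x" by (rule accepted_cong)
qed

lemma regular_sample_range:
  assumes reg: "regular_sample F x" and mono: "\<And>x y. x \<le> y \<Longrightarrow> F x \<le> F y" and r: "1 \<le> r"
  shows "range_rth_maxima r x = x ` accepted r x"
proof (rule range_rth_maxima_eq[OF regular_sample_accepted(2)[OF reg mono] r])
  fix j
  obtain n where n: "r \<le> exceed (\<lambda>i. hazard F (x i)) n (hazard F (x j))"
    using reg unfolding regular_sample_def by blast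
  have "{i. i < n \<and> hazard F (x j) < hazard F (x i)} \<subseteq> {i. i < n \<and> x j < x i}"
  proof (rule Collect_mono, intro impI conjI)
    fix i assume "i < n \<and> hazard F (x j) < hazard F (x i)"
    then have "\<not> hazard F (x i) \<le> hazard F (x j)" by simp
    moreover have "F (x j) < 1" using reg by (simp add: regular_sample_def)
    ultimately show "x j < x i" using hazard_mono[where F=F and x="x i" and y="x j", OF mono] by fastforce
  qed simp
  then have "exceed (\<lambda>i. hazard F (x i)) n (hazard F (x j)) \<le> exceed x n (x j)"
    unfolding exceed_def by (intro card_mono) auto
  then show "\<exists>n. r \<le> exceed x n (x j)" using n by (intro exI[of _ n]) simp
qed

lemma integral_scaled_points:
  assumes inj: "inj x" and a: "0 < a" and T: "T \<in> borel_measurable borel"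
    and A: "finite A" "A \<subseteq> I"
    and supp: "\<And>n. n \<in> I \<Longrightarrow> (x n + b) / a \<in> supp_gev \<gamma> \<Longrightarrow> T (g_gev \<gamma> ((x n + b) / a)) \<noteq> 0 \<Longrightarrow> n \<in> A"
  shows "(\<integral>q. T (g_gev \<gamma> q) \<partial>point_measure_on (supp_gev \<gamma>) ((\<lambda>x. (x + b) / a) ` x ` I)) =
    (\<Sum>n\<in>A. if (x n + b) / a \<in> supp_gev \<gamma> then T (g_gev \<gamma> ((x n + b) / a)) else (0::real))"
proof -
  let ?y = "\<lambda>n. (x n + b) / a"
  let ?Q = "(\<lambda>x. (x + b) / a) ` x ` I \<inter> supp_gev \<gamma>"
  let ?B = "{n \<in> A. ?y n \<in> supp_gev \<gamma> \<and> T (g_gev \<gamma> (?y n)) \<noteq> 0}"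
  have injy: "inj ?y" using a by (auto simp: inj_def dest: injD[OF inj])
  have eq: "{q \<in> ?Q. T (g_gev \<gamma> q) \<noteq> 0} = ?y ` ?B" using supp A(2) by auto
  have "(\<integral>q. T (g_gev \<gamma> q) \<partial>point_measure_on (supp_gev \<gamma>) ?Q) = (\<Sum>q\<in>{q \<in> ?Q. T (g_gev \<gamma> q) \<noteq> 0}. T (g_gev \<gamma> q))"
  proof (rule integral_point_measure)
    show "(\<lambda>q. T (g_gev \<gamma> q)) \<in> borel_measurable (restrict_space borel (supp_gev \<gamma>))"
      by (rule measurable_compose[OF measurable_g_gev T])
    show "finite {q \<in> ?Q. T (g_gev \<gamma> q) \<noteq> 0}" unfolding eq using A(1) by simp
  qed simp
  also have "\<dots> = (\<Sum>n\<in>?B. T (g_gev \<gamma> (?y n)))"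
    unfolding eq by (rule sum.reindex_cong[OF inj_on_subset[OF injy subset_UNIV]]) auto
  also have "\<dots> = (\<Sum>n\<in>A. if ?y n \<in> supp_gev \<gamma> then T (g_gev \<gamma> (?y n)) else 0)"
    using A(1) by (intro sum.mono_neutral_cong_left) auto
  finally show ?thesis by (simp add: point_measure_on_Int)
qed

text \<open>Point by point, the two integrands differ by at most \<open>\<epsilon>\<close>, and only at points whose scaled
  exponential value lies in a fixed compact interval. A sum of tents counts these points, so the
  bound is itself a function of the process of fixed law.\<close>

lemma coupled_integrals:
  assumes reg: "regular_sample F x" and mono: "\<And>x y. x \<le> y \<Longrightarrow> F x \<le> F y" and r: "1 \<le> r"
    and a: "0 < a" and T: "T \<in> borel_measurable borel"
    and coupling: "\<And>y. F (a * y - b) < 1 \<Longrightarrow>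
      \<bar>(if y \<in> supp_gev \<gamma> then T (g_gev \<gamma> y) else 0) - T (real r * hazard F (a * y - b))\<bar>
        \<le> \<epsilon> * indicator {\<alpha> / 2..\<beta> + 1} (real r * hazard F (a * y - b))"
    and supp: "\<And>u. T u \<noteq> 0 \<Longrightarrow> u \<le> \<beta>" and \<epsilon>: "0 \<le> \<epsilon>"
    and cover: "\<And>u. \<alpha> / 2 \<le> u \<Longrightarrow> u \<le> \<beta> + 1 \<Longrightarrow> 1 \<le> (\<Sum>k<N0. tent m0 k u)"
  shows "\<bar>(\<integral>q. T (g_gev \<gamma> q) \<partial>point_measure_on (supp_gev \<gamma>) ((\<lambda>x. (x + b) / a) ` range_rth_maxima r x))
      - accepted_sum r (\<lambda>i. hazard F (x i)) T\<bar>
    \<le> \<epsilon> * (\<Sum>k<N0. accepted_sum r (\<lambda>i. hazard F (x i)) (tent m0 k))"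
proof -
  let ?e = "\<lambda>i. hazard F (x i)"
  let ?I = "accepted r ?e"
  let ?y = "\<lambda>n. (x n + b) / a"
  let ?T = "\<lambda>n. if ?y n \<in> supp_gev \<gamma> then T (g_gev \<gamma> (?y n)) else 0"
  let ?\<rho> = "\<lambda>n. real r * ?e n"
  have F: "F (x n) < 1" for n using reg by (simp add: regular_sample_def)
  have ay: "a * ?y n - b = x n" for n using a by (simp add: field_simps)
  have cpl: "\<bar>?T n - T (?\<rho> n)\<bar> \<le> \<epsilon> * indicator {\<alpha> / 2..\<beta> + 1} (?\<rho> n)" for n
    using coupling[of "?y n"] F unfolding ay by simp
  \<comment> \<open>A level beyond which none of the functions involved has a contribution.\<close>
  define t where "t = Max (insert (\<beta> + 1) ((\<lambda>k. real (k + 3) / 2 ^ m0) ` {..<N0}))"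
  have t: "\<beta> + 1 \<le> t" "\<And>k. k < N0 \<Longrightarrow> real (k + 3) / 2 ^ m0 \<le> t" by (auto simp: t_def intro!: Max_ge)
  define A where "A = {n \<in> ?I. ?\<rho> n \<le> t}"
  have finA: "finite A" unfolding A_def by (rule regular_sample_points(2)[OF reg r])
  have AI: "A \<subseteq> ?I" by (auto simp: A_def)
  have in_A: "n \<in> A" if "n \<in> ?I" "?T n \<noteq> 0 \<or> T (?\<rho> n) \<noteq> 0" for n
  proof -
    have "?\<rho> n \<le> \<beta> + 1"
    proof (cases "T (?\<rho> n) = 0")
      case True
      then have "?T n \<noteq> 0" using that by blast
      with True have "0 < \<bar>?T n - T (?\<rho> n)\<bar>" by linarith
      then have "\<epsilon> * indicator {\<alpha> / 2..\<beta> + 1} (?\<rho> n) \<noteq> (0::real)" using cpl[of n] by linarith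
      then show ?thesis by (auto simp: indicator_def split: if_splits)
    next
      case False then show ?thesis using supp[OF False] by simp
    qed
    then show ?thesis using that t by (simp add: A_def)
  qed
  have N: "(\<integral>q. T (g_gev \<gamma> q) \<partial>point_measure_on (supp_gev \<gamma>) ((\<lambda>x. (x + b) / a) ` range_rth_maxima r x)) = (\<Sum>n\<in>A. ?T n)"
  proof -
    have acc: "accepted r ?e = accepted r x" and inj: "inj x"
      by (rule regular_sample_accepted[OF reg], rule mono, assumption)+
    have "range_rth_maxima r x = x ` accepted r x"
      by (rule regular_sample_range[OF reg _ r]) (rule mono)
    then have range: "range_rth_maxima r x = x ` ?I" unfolding acc .
    show ?thesis unfolding range
      using in_A by (intro integral_scaled_points[OF inj a T finA AI]) auto
  qed
  have Y: "accepted_sum r ?e T = (\<Sum>n\<in>A. T (?\<rho> n))"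
    using in_A by (intro accepted_sum_finite[OF finA AI]) auto
  have tents: "accepted_sum r ?e (tent m0 k) = (\<Sum>n\<in>A. tent m0 k (?\<rho> n))" if "k < N0" for k
  proof (rule accepted_sum_finite[OF finA AI])
    fix n assume "n \<in> ?I" "tent m0 k (?\<rho> n) \<noteq> 0"
    then show "n \<in> A" using tent_support[of m0 k "?\<rho> n"] t(2)[OF that] by (simp add: A_def)
  qed
  have "\<bar>(\<Sum>n\<in>A. ?T n) - (\<Sum>n\<in>A. T (?\<rho> n))\<bar> \<le> (\<Sum>n\<in>A. \<bar>?T n - T (?\<rho> n)\<bar>)"
    by (simp add: sum_subtractf[symmetric] sum_abs)
  also have "\<dots> \<le> (\<Sum>n\<in>A. \<epsilon> * (\<Sum>k<N0. tent m0 k (?\<rho> n)))"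
  proof (rule sum_mono)
    fix n
    have "indicator {\<alpha> / 2..\<beta> + 1} (?\<rho> n) \<le> (\<Sum>k<N0. tent m0 k (?\<rho> n))"
      using cover by (auto simp: indicator_def intro!: sum_nonneg tent_nonneg)
    then show "\<bar>?T n - T (?\<rho> n)\<bar> \<le> \<epsilon> * (\<Sum>k<N0. tent m0 k (?\<rho> n))"
      using cpl[of n] mult_left_mono[OF _ \<epsilon>] by (meson order_trans)
  qed
  also have "\<dots> = \<epsilon> * (\<Sum>k<N0. accepted_sum r ?e (tent m0 k))"
    using tents by (simp add: sum_distrib_left sum.swap[of _ A])
  finally show ?thesis unfolding N Y .
qed

section \<open>Convergence of the rescaled ranges\<close>

context
  fixes M :: "'a measure" and X :: "nat \<Rightarrow> 'a \<Rightarrow> real" and F :: "real \<Rightarrow> real"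
    and a b :: "nat \<Rightarrow> real" and \<gamma> :: real
  assumes M: "prob_space M"
    and ind: "prob_space.indep_vars M (\<lambda>_. borel) X UNIV"
    and cdf: "\<And>i. cdf (distr M borel (X i)) = F"
    and cont: "continuous_on UNIV F"
    and a: "\<And>r. r \<ge> 1 \<Longrightarrow> a r > 0"
    and lim: "\<And>x. x \<in> supp_gev \<gamma> \<Longrightarrow>
           (\<lambda>r. ereal (real r) * cum_hazard F (a r * x - b r)) \<longlonglongrightarrow> ereal (g_gev \<gamma> x)"
begin

interpretation prob_space M by (rule M)

lemma X_measurable [measurable]: "X i \<in> borel_measurable M"
  using ind by (auto simp: indep_vars_def)

lemma F_mono: "x \<le> y \<Longrightarrow> F x \<le> F y" and F_le_1: "F x \<le> 1"
proof -
  interpret D: real_distribution "distr M borel (X 0)" by (rule real_distribution_distr) simp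
  show "x \<le> y \<Longrightarrow> F x \<le> F y" using D.cdf_nondecreasing[of x y] by (simp add: cdf)
  show "F x \<le> 1" using D.cdf_bounded_prob[of x] by (simp add: cdf)
qed

lemma hazard_measurable [measurable]: "hazard F \<in> borel_measurable borel"
proof -
  have [measurable]: "F \<in> borel_measurable borel" by (rule borel_measurable_continuous_onI[OF cont])
  show ?thesis unfolding hazard_def[abs_def] by measurable
qed

lemma hazard_indep: "indep_vars (\<lambda>_. borel) (\<lambda>i \<omega>. hazard F (X i \<omega>)) UNIV"
  by (rule indep_vars_compose2[OF ind]) simp

lemma hazard_tail: "0 \<le> t \<Longrightarrow> prob {\<omega>\<in>space M. t < hazard F (X i \<omega>)} = exp (- t)"
  by (rule prob_hazard_greater[OF X_measurable cdf cont])

lemma AE_regular: "AE \<omega> in M. regular_sample F (\<lambda>i. X i \<omega>)"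
proof -
  have "AE \<omega> in M. \<forall>i. F (X i \<omega>) < 1"
    unfolding AE_all_countable using AE_cdf_transform_less_1[OF X_measurable cdf cont] by blast
  moreover have "AE \<omega> in M. \<forall>i. 0 < hazard F (X i \<omega>)"
    unfolding AE_all_countable
  proof
    fix i
    have "prob {\<omega>\<in>space M. 0 < hazard F (X i \<omega>)} = 1" using hazard_tail[of 0 i] by simp
    then have "AE \<omega> in M. \<omega> \<in> {\<omega>\<in>space M. 0 < hazard F (X i \<omega>)}" by (rule AE_prob_1)
    then show "AE \<omega> in M. 0 < hazard F (X i \<omega>)" by auto
  qed
  moreover have "AE \<omega> in M. inj (\<lambda>i. hazard F (X i \<omega>))"
    by (rule AE_distinct[OF hazard_indep]) (rule hazard_tail)
  moreover have "AE \<omega> in M. \<forall>t r. \<exists>n. r \<le> exceed (\<lambda>i. hazard F (X i \<omega>)) n t"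
    by (rule AE_exceed_unbounded[OF hazard_indep]) (rule hazard_tail)
  ultimately show ?thesis
    by eventually_elim (simp add: regular_sample_def)
qed

abbreviation exp_sample :: "'a \<Rightarrow> nat \<Rightarrow> real" where
  "exp_sample \<omega> \<equiv> \<lambda>i. hazard F (X i \<omega>)"

lemma exceedance_level_eventually:
  assumes "0 < u"
  shows "\<forall>\<^sub>F r in sequentially. F (a r * g_inv \<gamma> u - b r) < 1"
proof -
  have "(\<lambda>r. ereal (real r) * cum_hazard F (a r * g_inv \<gamma> u - b r)) \<longlonglongrightarrow> ereal u"
    using lim[OF g_inv_in_supp[OF assms]] assms by simp
  from cum_hazard_limit_bounds[OF F_le_1 this zero_less_one]
  show ?thesis by eventually_elim simp
qed

lemma accepted_sums_measurable:
  "(\<lambda>\<omega> i. accepted_sum r (exp_sample \<omega>) (tents i)) \<in> borel_measurable M"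
  by (rule measurable_coordinatewise_then_product, rule measurable_accepted_sum)
     (auto intro!: borel_measurable_continuous_onI continuous_tent)

text \<open>The bound of \<open>coupled_integrals\<close> is \<open>\<epsilon>\<close> times a random variable whose law does not depend on \<open>r\<close>.
  Truncated at 1, its mean can be computed under the Poisson random measure and tends to 0 with \<open>\<epsilon>\<close>,
  by dominated convergence.\<close>

lemma coupling_in_mean:
  fixes P :: "'b measure"
  assumes PRM: "poisson_random_measure (supp_gev \<gamma>) (m_gev \<gamma>) P \<eta>"
    and \<xi>: "radon_version (supp_gev \<gamma>) M (range_process (supp_gev \<gamma>) a b X) \<xi>"
  shows "(\<lambda>r. expectation (\<lambda>\<omega>. min 1 \<bar>tent_integral \<gamma> (\<xi> r \<omega>) i - accepted_sum r (exp_sample \<omega>) (tents i)\<bar>)) \<longlonglongrightarrow> 0"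
proof (rule LIMSEQ_I)
  fix e :: real assume e: "0 < e"
  interpret P: prob_space P by (rule PRM_prob_space[OF PRM])
  obtain m k where mk: "prod_decode i = (m, k)" by (cases "prod_decode i")
  let ?T = "tent m k"
  let ?\<alpha> = "1 / 2 ^ m :: real" and ?\<beta> = "real (k + 3) / 2 ^ m"
  have \<alpha>: "0 < ?\<alpha>" by simp
  obtain m0 N0 where cover: "\<And>u. ?\<alpha> / 2 \<le> u \<Longrightarrow> u \<le> ?\<beta> + 1 \<Longrightarrow> (\<Sum>k<N0. tent m0 k u) = 1"
  proof (rule tent_cover[OF half_gt_zero[OF \<alpha>], of "?\<beta> + 1"])
    fix m0 N0 assume "\<And>u. ?\<alpha> / 2 \<le> u \<Longrightarrow> u \<le> ?\<beta> + 1 \<Longrightarrow> (\<Sum>k<N0. tent m0 k u) = 1"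
    then show thesis by (rule that)
  qed
  define S where "S y = (\<Sum>k<N0. y (prod_encode (m0, k)))" for y :: "nat \<Rightarrow> real"
  have S_cont: "continuous_on UNIV S" unfolding S_def by (intro continuous_intros continuous_coordinate)
  define H where "H \<epsilon> y = min 1 (\<epsilon> * \<bar>S y\<bar>)" for \<epsilon> y
  have H_cont: "continuous_on UNIV (H \<epsilon>)" for \<epsilon> unfolding H_def by (intro continuous_intros S_cont)
  have H_bnd: "\<bar>H \<epsilon> y\<bar> \<le> 1" if "0 \<le> \<epsilon>" for \<epsilon> y using that by (simp add: H_def abs_le_iff)
  have \<eta>m: "(\<lambda>\<omega>. tent_integral \<gamma> (\<eta> \<omega>)) \<in> borel_measurable P"
    by (rule measurable_compose[OF PRM_unfolded(2)[OF PRM] measurable_tent_integral_vague])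
  have "(\<lambda>l. \<integral>\<omega>. H (1 / real (Suc l)) (tent_integral \<gamma> (\<eta> \<omega>)) \<partial>P) \<longlonglongrightarrow> (\<integral>\<omega>. 0 \<partial>P)"
  proof (rule integral_dominated_convergence[where w="\<lambda>_. 1"])
    show "AE \<omega> in P. (\<lambda>l. H (1 / real (Suc l)) (tent_integral \<gamma> (\<eta> \<omega>))) \<longlonglongrightarrow> 0"
    proof (rule AE_I2)
      fix \<omega>
      have "(\<lambda>l. min 1 (1 / real (Suc l) * \<bar>S (tent_integral \<gamma> (\<eta> \<omega>))\<bar>)) \<longlonglongrightarrow> min 1 (0 * \<bar>S (tent_integral \<gamma> (\<eta> \<omega>))\<bar>)"
        by (intro tendsto_intros LIMSEQ_Suc lim_1_over_n)
      then show "(\<lambda>l. H (1 / real (Suc l)) (tent_integral \<gamma> (\<eta> \<omega>))) \<longlonglongrightarrow> 0" by (simp add: H_def)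
    qed
    show "(\<lambda>\<omega>. H (1 / real (Suc l)) (tent_integral \<gamma> (\<eta> \<omega>))) \<in> borel_measurable P" for l
      by (rule measurable_compose[OF \<eta>m borel_measurable_continuous_onI[OF H_cont]])
    show "AE \<omega> in P. norm (H (1 / real (Suc l)) (tent_integral \<gamma> (\<eta> \<omega>))) \<le> 1" for l
      using H_bnd by simp
  qed auto
  then have "\<forall>\<^sub>F l in sequentially. (\<integral>\<omega>. H (1 / real (Suc l)) (tent_integral \<gamma> (\<eta> \<omega>)) \<partial>P) < e"
    using e by (intro order_tendstoD(2)) auto
  then obtain l where l: "(\<integral>\<omega>. H (1 / real (Suc l)) (tent_integral \<gamma> (\<eta> \<omega>)) \<partial>P) < e"
    by (auto simp: eventually_sequentially)
  define \<epsilon> where "\<epsilon> = 1 / real (Suc l)"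
  have \<epsilon>: "0 < \<epsilon>" by (simp add: \<epsilon>_def)
  let ?K = "g_band \<gamma> ?\<alpha> ?\<beta>"
  have "\<forall>\<^sub>F r in sequentially. AE \<omega> in M. \<forall>A\<in>sets borel. A \<subseteq> ?K \<longrightarrow>
      emeasure (\<xi> r \<omega>) A = emeasure (range_process (supp_gev \<gamma>) a b X r \<omega>) A"
    using conjunct2[OF \<xi>[unfolded radon_version_def], rule_format, OF conjI[OF compact_g_band[OF \<alpha>] g_band_subset]] .
  moreover have "\<forall>\<^sub>F r in sequentially. \<forall>y. F (a r * y - b r) < 1 \<longrightarrow>
    \<bar>(if y \<in> supp_gev \<gamma> then ?T (g_gev \<gamma> y) else 0) - ?T (real r * hazard F (a r * y - b r))\<bar>
      \<le> \<epsilon> * indicator {?\<alpha> / 2..?\<beta> + 1} (real r * hazard F (a r * y - b r))"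
    by (rule uniform_coupling[OF F_mono F_le_1 a lim continuous_tent \<alpha> tent_support \<epsilon>])
  ultimately have "\<forall>\<^sub>F r in sequentially.
      expectation (\<lambda>\<omega>. min 1 \<bar>tent_integral \<gamma> (\<xi> r \<omega>) i - accepted_sum r (exp_sample \<omega>) (tents i)\<bar>) < e"
    using eventually_ge_at_top[of 1]
  proof eventually_elim
    case (elim r)
    note cpl = elim(2)
    have \<xi>m: "\<xi> r \<in> measurable M (borel_of (vague_topology (supp_gev \<gamma>)))" using \<xi> by (simp add: radon_version_def)
    have "AE \<omega> in M. \<bar>tent_integral \<gamma> (\<xi> r \<omega>) i - accepted_sum r (exp_sample \<omega>) (tents i)\<bar>
        \<le> \<epsilon> * \<bar>S (\<lambda>i. accepted_sum r (exp_sample \<omega>) (tents i))\<bar>"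
      using elim(1) AE_regular AE_space
    proof eventually_elim
      case (elim \<omega>)
      note agree = elim(1) and reg = elim(2)
      have rad: "\<xi> r \<omega> \<in> radon_measures (supp_gev \<gamma>)"
        using measurable_space[OF \<xi>m elim(3)] by (simp add: space_borel_of topspace_vague_topology)
      let ?N = "range_process (supp_gev \<gamma>) a b X r \<omega>"
      have sets\<xi>: "sets (\<xi> r \<omega>) = sets (restrict_space borel (supp_gev \<gamma>))" using rad by (simp add: radon_measures_def)
      have "tent_integral \<gamma> (\<xi> r \<omega>) i = (\<integral>x. ?T (g_gev \<gamma> x) \<partial>\<xi> r \<omega>)" by (simp add: tent_integral_def mk)
      also have "\<dots> = (\<integral>x. ?T (g_gev \<gamma> x) \<partial>?N)"
      proof (rule integral_eq_on[where K="?K"])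
        show "sets (\<xi> r \<omega>) = sets ?N" by (simp add: sets\<xi> range_process_def point_measure_on_def)
        show "?K \<in> sets (\<xi> r \<omega>)" unfolding sets\<xi> by (rule sets_g_band)
        show "emeasure (\<xi> r \<omega>) A = emeasure ?N A" if "A \<in> sets (\<xi> r \<omega>)" "A \<subseteq> ?K" for A
          using agree that unfolding sets\<xi> by (simp add: sets_restrict_space_iff)
        show "?T (g_gev \<gamma> x) = 0" if "x \<in> space (\<xi> r \<omega>)" "x \<notin> ?K" for x
          using that tent_support[of m k "g_gev \<gamma> x"] by (auto simp: g_band_def space_radon[OF rad])
      qed
      finally have 1: "tent_integral \<gamma> (\<xi> r \<omega>) i = (\<integral>x. ?T (g_gev \<gamma> x) \<partial>?N)" .
      have "\<bar>(\<integral>x. ?T (g_gev \<gamma> x) \<partial>?N) - accepted_sum r (exp_sample \<omega>) ?T\<bar>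
          \<le> \<epsilon> * (\<Sum>k<N0. accepted_sum r (exp_sample \<omega>) (tent m0 k))"
        unfolding range_process_def
      proof (rule coupled_integrals[OF reg F_mono \<open>1 \<le> r\<close> a[OF \<open>1 \<le> r\<close>]])
        show "?T \<in> borel_measurable borel" by (rule borel_measurable_continuous_onI[OF continuous_tent])
        show "u \<le> ?\<beta>" if "?T u \<noteq> 0" for u using tent_support[OF that] by simp
        show "1 \<le> (\<Sum>k<N0. tent m0 k u)" if "?\<alpha> / 2 \<le> u" "u \<le> ?\<beta> + 1" for u using cover[OF that] by simp
        show "0 \<le> \<epsilon>" using \<epsilon> by simp
        show "\<bar>(if y \<in> supp_gev \<gamma> then ?T (g_gev \<gamma> y) else 0) - ?T (real r * hazard F (a r * y - b r))\<bar>
          \<le> \<epsilon> * indicator {?\<alpha> / 2..?\<beta> + 1} (real r * hazard F (a r * y - b r))" if "F (a r * y - b r) < 1" for y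
          by (rule cpl[rule_format, OF that])
      qed
      also have "\<dots> \<le> \<epsilon> * \<bar>S (\<lambda>i. accepted_sum r (exp_sample \<omega>) (tents i))\<bar>"
        using \<epsilon> by (intro mult_left_mono) (auto simp: S_def)
      finally show ?case unfolding 1 by (simp add: mk)
    qed
    then have AE: "AE \<omega> in M. min 1 \<bar>tent_integral \<gamma> (\<xi> r \<omega>) i - accepted_sum r (exp_sample \<omega>) (tents i)\<bar>
        \<le> H \<epsilon> (\<lambda>i. accepted_sum r (exp_sample \<omega>) (tents i))"
      by eventually_elim (simp add: H_def min_le_iff_disj)
    have [measurable]: "(\<lambda>\<omega>. tent_integral \<gamma> (\<xi> r \<omega>) i) \<in> borel_measurable M"
      by (rule measurable_product_then_coordinatewise[OF measurable_compose[OF \<xi>m measurable_tent_integral_vague]])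
    have [measurable]: "(\<lambda>\<omega>. accepted_sum r (exp_sample \<omega>) (tents i)) \<in> borel_measurable M"
      by (rule measurable_product_then_coordinatewise[OF accepted_sums_measurable])
    have "expectation (\<lambda>\<omega>. min 1 \<bar>tent_integral \<gamma> (\<xi> r \<omega>) i - accepted_sum r (exp_sample \<omega>) (tents i)\<bar>)
        \<le> expectation (\<lambda>\<omega>. H \<epsilon> (\<lambda>i. accepted_sum r (exp_sample \<omega>) (tents i)))"
    proof (rule integral_mono_AE[OF _ _ AE])
      show "integrable M (\<lambda>\<omega>. min 1 \<bar>tent_integral \<gamma> (\<xi> r \<omega>) i - accepted_sum r (exp_sample \<omega>) (tents i)\<bar>)"
        by (intro integrable_const_bound[of _ 1]) auto
      show "integrable M (\<lambda>\<omega>. H \<epsilon> (\<lambda>i. accepted_sum r (exp_sample \<omega>) (tents i)))"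
        using H_bnd \<epsilon> by (intro integrable_const_bound[of _ 1]
          measurable_compose[OF accepted_sums_measurable borel_measurable_continuous_onI[OF H_cont]]) auto
    qed
    also have "\<dots> = (\<integral>\<omega>. H \<epsilon> (tent_integral \<gamma> (\<eta> \<omega>)) \<partial>P)"
      using \<epsilon> by (intro law_accepted_sums[OF hazard_indep hazard_tail AE_regular PRM \<open>1 \<le> r\<close> H_cont H_bnd]) auto
    also have "\<dots> < e" using l by (simp add: \<epsilon>_def)
    finally show ?case .
  qed
  moreover have "0 \<le> expectation (\<lambda>\<omega>. min 1 \<bar>tent_integral \<gamma> (\<xi> r \<omega>) i - accepted_sum r (exp_sample \<omega>) (tents i)\<bar>)" for r
    by simp
  ultimately show "\<exists>no. \<forall>r\<ge>no. norm (expectation (\<lambda>\<omega>. min 1 \<bar>tent_integral \<gamma> (\<xi> r \<omega>) i - accepted_sum r (exp_sample \<omega>) (tents i)\<bar>) - 0) < e"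
    by (simp add: eventually_sequentially)
qed

lemma radon_version_converges:
  fixes P :: "'b measure"
  assumes PRM: "poisson_random_measure (supp_gev \<gamma>) (m_gev \<gamma>) P \<eta>"
    and \<xi>: "radon_version (supp_gev \<gamma>) M (range_process (supp_gev \<gamma>) a b X) \<xi>"
  shows "converges_weakly (vague_topology (supp_gev \<gamma>)) M \<xi> P \<eta>"
  unfolding converges_weakly_def
proof (intro conjI allI impI)
  let ?T = "vague_topology (supp_gev \<gamma>)"
  show \<xi>m: "\<xi> r \<in> measurable M (borel_of ?T)" for r using \<xi> by (simp add: radon_version_def)
  show \<eta>m: "\<eta> \<in> measurable P (borel_of ?T)" by (rule PRM_unfolded(2)[OF PRM])
  fix h assume h: "continuous_map ?T euclideanreal h \<and> bounded (h ` topspace ?T)"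
  then have hc: "continuous_map ?T euclideanreal h" by simp
  obtain c where c: "\<And>\<mu>. \<mu> \<in> radon_measures (supp_gev \<gamma>) \<Longrightarrow> \<bar>h \<mu>\<bar> \<le> c"
    using h unfolding bounded_iff topspace_vague_topology by auto
  note hm = continuous_map_measurable_borel_of[OF hc]
  show "(\<lambda>r. \<integral>\<omega>. h (\<xi> r \<omega>) \<partial>M) \<longlonglongrightarrow> (\<integral>\<omega>. h (\<eta> \<omega>) \<partial>P)"
  proof (rule weak_convergence_from_Lipschitz[where A="radon_measures (supp_gev \<gamma>)" and \<Phi>="tent_integral \<gamma>" and c=c])
    show "\<xi> r \<omega> \<in> radon_measures (supp_gev \<gamma>)" if "\<omega> \<in> space M" for r \<omega>
      using measurable_space[OF \<xi>m that] by (simp add: space_borel_of topspace_vague_topology)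
    show "\<exists>\<delta>>0. \<forall>\<nu>\<in>radon_measures (supp_gev \<gamma>). dist (tent_integral \<gamma> \<nu>) (tent_integral \<gamma> \<mu>) < \<delta> \<longrightarrow> \<bar>h \<nu> - h \<mu>\<bar> < \<epsilon>"
      if "\<mu> \<in> radon_measures (supp_gev \<gamma>)" "0 < \<epsilon>" for \<mu> \<epsilon>
      by (rule continuous_vague_metric[OF hc that])
    fix H :: "(nat \<Rightarrow> real) \<Rightarrow> real" and L B :: real
    assume Lip: "\<And>y z. \<bar>H y - H z\<bar> \<le> L * dist y z" and B: "\<And>y. \<bar>H y\<bar> \<le> B"
    have Lip': "\<bar>H y - H z\<bar> \<le> \<bar>L\<bar> * dist y z" for y z
      using Lip[of y z] by (rule order_trans) (simp add: mult_right_mono)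
    have "\<bar>L\<bar>-lipschitz_on UNIV H" using Lip' by (intro lipschitz_onI) (auto simp: dist_real_def)
    then have Hc: "continuous_on UNIV H" by (rule lipschitz_on_continuous_on)
    have "(\<lambda>r. expectation (\<lambda>\<omega>. H (tent_integral \<gamma> (\<xi> r \<omega>))) -
        expectation (\<lambda>\<omega>. H (\<lambda>i. accepted_sum r (exp_sample \<omega>) (tents i)))) \<longlonglongrightarrow> 0"
      by (rule Lipschitz_expectation_close[OF measurable_compose[OF \<xi>m measurable_tent_integral_vague]
            accepted_sums_measurable coupling_in_mean[OF PRM \<xi>] Hc Lip' B]) simp
    moreover have "\<forall>\<^sub>F r in sequentially. expectation (\<lambda>\<omega>. H (tent_integral \<gamma> (\<xi> r \<omega>))) -
        expectation (\<lambda>\<omega>. H (\<lambda>i. accepted_sum r (exp_sample \<omega>) (tents i))) =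
        expectation (\<lambda>\<omega>. H (tent_integral \<gamma> (\<xi> r \<omega>))) - (\<integral>\<omega>. H (tent_integral \<gamma> (\<eta> \<omega>)) \<partial>P)"
      using eventually_ge_at_top[of 1]
      by eventually_elim (simp add: law_accepted_sums[OF hazard_indep hazard_tail AE_regular PRM _ Hc B])
    ultimately have "(\<lambda>r. expectation (\<lambda>\<omega>. H (tent_integral \<gamma> (\<xi> r \<omega>))) - (\<integral>\<omega>. H (tent_integral \<gamma> (\<eta> \<omega>)) \<partial>P)) \<longlonglongrightarrow> 0"
      by (rule Lim_transform_eventually)
    then show "(\<lambda>r. expectation (\<lambda>\<omega>. H (tent_integral \<gamma> (\<xi> r \<omega>)))) \<longlonglongrightarrow> (\<integral>\<omega>. H (tent_integral \<gamma> (\<eta> \<omega>)) \<partial>P)"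
      by (simp add: LIM_zero_iff)
  qed (use c in \<open>auto intro!: M PRM_prob_space[OF PRM] PRM_radon[OF PRM]
        measurable_compose[OF \<xi>m hm] measurable_compose[OF \<eta>m hm]
        measurable_compose[OF \<xi>m measurable_tent_integral_vague] measurable_compose[OF \<eta>m measurable_tent_integral_vague]\<close>)
qed

text \<open>For fixed \<open>r\<close> the points can accumulate only at levels that the variables never exceed.
  Restricting them to the bands \<open>band j\<close> with \<open>j \<le> r\<close> whose upper end corresponds to a level
  \<open>z\<close> with \<open>F z < 1\<close> leaves finitely many points, and each compact set is contained in such a band
  for all large \<open>r\<close>. On the exceptional null set, and for \<open>r = 0\<close>, the null measure is taken.\<close>

lemma ex_radon_version: "\<exists>\<xi>. radon_version (supp_gev \<gamma>) M (range_process (supp_gev \<gamma>) a b X) \<xi>"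
proof -
  let ?S = "supp_gev \<gamma>"
  obtain N where N: "{\<omega>\<in>space M. \<not> regular_sample F (\<lambda>i. X i \<omega>)} \<subseteq> N" "emeasure M N = 0" "N \<in> sets M"
    using AE_regular by (rule AE_E)
  define band where "band j = g_band \<gamma> (1 / real (Suc j)) (real (Suc j))" for j
  define J where "J r = {j. j \<le> r \<and> F (a r * g_inv \<gamma> (real (Suc j)) - b r) < 1}" for r
  define D where "D r = (\<Union>j\<in>J r. band j)" for r
  define y where "y r \<omega> n = (X n \<omega> + b r) / a r" for r \<omega> n
  define I where "I r \<omega> = {n \<in> accepted r (\<lambda>i. X i \<omega>). y r \<omega> n \<in> D r}" for r \<omega>
  define Q where "Q r \<omega> = (\<lambda>x. (x + b r) / a r) ` (\<lambda>i. X i \<omega>) ` I r \<omega>" for r \<omega>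
  define \<xi> where "\<xi> r \<omega> = (if r = 0 \<or> \<omega> \<in> N then null_measure (restrict_space borel ?S) else point_measure_on ?S (Q r \<omega>))" for r \<omega>
  have D_sub: "D r \<subseteq> ?S" for r using g_band_subset by (auto simp: D_def band_def)
  have D_sets: "D r \<in> sets borel" for r
  proof -
    have "finite (J r)" by (simp add: J_def)
    moreover have "band j \<in> sets borel" for j
      unfolding band_def by (intro borel_closed compact_imp_closed compact_g_band) simp
    ultimately show ?thesis unfolding D_def by (intro sets.finite_UN) auto
  qed
  have good: "regular_sample F (\<lambda>i. X i \<omega>)" if "\<omega> \<in> space M" "\<omega> \<notin> N" for \<omega> using N(1) that by blast
  have finI: "finite (I r \<omega>)" if reg: "regular_sample F (\<lambda>i. X i \<omega>)" and r: "1 \<le> r" for r \<omega>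
  proof -
    have acc: "accepted r (exp_sample \<omega>) = accepted r (\<lambda>i. X i \<omega>)"
      by (rule regular_sample_accepted(1)[OF reg]) (rule F_mono)
    have "finite {n \<in> accepted r (\<lambda>i. X i \<omega>). y r \<omega> n \<in> band j}" if j: "j \<in> J r" for j
    proof (rule finite_subset)
      let ?z = "a r * g_inv \<gamma> (real (Suc j)) - b r"
      obtain n where "r \<le> exceed (exp_sample \<omega>) n (hazard F ?z)" using reg unfolding regular_sample_def by blast
      from finite_accepted_below[OF this]
      show "finite {n \<in> accepted r (exp_sample \<omega>). exp_sample \<omega> n \<le> hazard F ?z}" .
      show "{n \<in> accepted r (\<lambda>i. X i \<omega>). y r \<omega> n \<in> band j} \<subseteq> {n \<in> accepted r (exp_sample \<omega>). exp_sample \<omega> n \<le> hazard F ?z}"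
      proof (clarsimp simp: acc)
        fix n assume "y r \<omega> n \<in> band j"
        then have "(X n \<omega> + b r) / a r \<le> g_inv \<gamma> (real (Suc j))" unfolding band_def y_def by (subst (asm) g_band_eq) auto
        then have "X n \<omega> \<le> ?z" using a[OF r] by (simp add: field_simps)
        then show "hazard F (X n \<omega>) \<le> hazard F (a r * g_inv \<gamma> (1 + real j) - b r)"
          using j F_mono by (intro hazard_mono[where F=F]) (auto simp: J_def)
      qed
    qed
    moreover have "I r \<omega> = (\<Union>j\<in>J r. {n \<in> accepted r (\<lambda>i. X i \<omega>). y r \<omega> n \<in> band j})" by (auto simp: I_def D_def)
    moreover have "finite (J r)" by (simp add: J_def)
    ultimately show ?thesis by simp
  qed
  have rad: "\<xi> r \<omega> \<in> radon_measures ?S" if "\<omega> \<in> space M" for r \<omega>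
  proof (cases "r = 0 \<or> \<omega> \<in> N")
    case True then show ?thesis by (simp add: \<xi>_def radon_measures_def)
  next
    case False
    then have "finite (Q r \<omega>)" using finI[OF good[OF that]] by (simp add: Q_def)
    then have "point_measure_on ?S (Q r \<omega>) \<in> radon_measures ?S" by (intro point_measure_radon) simp
    then show ?thesis using False by (simp add: \<xi>_def)
  qed
  have coord: "(\<lambda>\<omega>. \<integral>x. tent m k (g_gev \<gamma> x) \<partial>\<xi> r \<omega>) \<in> borel_measurable M" for m k r
  proof (cases "r = 0")
    case True then show ?thesis by (simp add: \<xi>_def)
  next
    case False
    then have r: "1 \<le> r" by simp
    let ?f = "\<lambda>\<omega> n. if n \<in> I r \<omega> then tent m k (g_gev \<gamma> (y r \<omega> n)) else 0"
    have "(\<integral>x. tent m k (g_gev \<gamma> x) \<partial>\<xi> r \<omega>) = (if \<omega> \<in> N then 0 else \<Sum>n. ?f \<omega> n)" if \<omega>: "\<omega> \<in> space M" for \<omega>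
    proof (cases "\<omega> \<in> N")
      case True then show ?thesis by (simp add: \<xi>_def)
    next
      case False
      note reg = good[OF \<omega> False]
      have inj: "inj (\<lambda>i. X i \<omega>)" by (rule regular_sample_accepted(2)[OF reg]) (rule F_mono)
      have "(\<integral>x. tent m k (g_gev \<gamma> x) \<partial>\<xi> r \<omega>) = (\<integral>x. tent m k (g_gev \<gamma> x) \<partial>point_measure_on ?S (Q r \<omega>))"
        using False r by (simp add: \<xi>_def)
      also have "\<dots> = (\<Sum>n\<in>I r \<omega>. if (X n \<omega> + b r) / a r \<in> ?S then tent m k (g_gev \<gamma> ((X n \<omega> + b r) / a r)) else 0)"
        unfolding Q_def
        by (rule integral_scaled_points[OF inj a[OF r] borel_measurable_continuous_onI[OF continuous_tent] finI[OF reg r] order_refl])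
      also have "\<dots> = (\<Sum>n\<in>I r \<omega>. ?f \<omega> n)"
        using D_sub by (intro sum.cong) (auto simp: I_def y_def)
      also have "\<dots> = (\<Sum>n. ?f \<omega> n)" by (rule suminf_finite[OF finI[OF reg r], symmetric]) simp
      finally show ?thesis using False by simp
    qed
    moreover have "(\<lambda>\<omega>. if \<omega> \<in> N then 0 else \<Sum>n. ?f \<omega> n) \<in> borel_measurable M"
    proof -
      have [measurable]: "(\<lambda>\<omega>. exceed (\<lambda>i. X i \<omega>) n (X n \<omega>)) \<in> measurable M (count_space UNIV)" for n
        by (intro measurable_exceed) auto
      have [measurable]: "g_gev \<gamma> \<in> borel_measurable borel" unfolding g_gev_eq[abs_def] by measurable
      have [measurable]: "tent m k \<in> borel_measurable borel" by (rule borel_measurable_continuous_onI[OF continuous_tent])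
      note D_sets[measurable] N(3)[measurable]
      show ?thesis unfolding I_def accepted_def y_def mem_Collect_eq by measurable
    qed
    ultimately show ?thesis by (subst measurable_cong) auto
  qed
  have "radon_version ?S M (range_process ?S a b X) \<xi>"
    unfolding radon_version_def
  proof (intro conjI allI impI)
    show "\<xi> r \<in> measurable M (borel_of (vague_topology ?S))" for r
      by (rule measurable_into_vague[OF rad coord])
    fix K assume K: "compact K \<and> K \<subseteq> ?S"
    then obtain \<alpha> \<beta> where \<alpha>\<beta>: "0 < \<alpha>" "K \<subseteq> g_band \<gamma> \<alpha> \<beta>" using compact_subset_g_band by metis
    obtain j :: nat where j: "max (1 / \<alpha>) \<beta> \<le> real j" using real_arch_simple by blast
    have "1 / real (Suc j) \<le> \<alpha>"
    proof -
      have "1 / \<alpha> \<le> real (Suc j)" using j by simp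
      then show ?thesis using \<alpha>\<beta>(1) by (simp add: field_simps)
    qed
    then have Kj: "K \<subseteq> band j" using \<alpha>\<beta>(2) j by (force simp: band_def g_band_def)
    have "\<forall>\<^sub>F r in sequentially. F (a r * g_inv \<gamma> (real (Suc j)) - b r) < 1"
      by (rule exceedance_level_eventually) simp
    then show "\<forall>\<^sub>F r in sequentially. AE \<omega> in M. \<forall>A\<in>sets borel. A \<subseteq> K \<longrightarrow>
        emeasure (\<xi> r \<omega>) A = emeasure (range_process ?S a b X r \<omega>) A"
      using eventually_ge_at_top[of "max 1 j"]
    proof eventually_elim
      case (elim r)
      then have r: "1 \<le> r" and KD: "K \<subseteq> D r" using Kj by (auto simp: D_def J_def)
      have "AE \<omega> in M. \<omega> \<notin> N" using N by (intro AE_not_in) auto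
      then show ?case using AE_space
      proof (eventually_elim, intro ballI impI)
        fix \<omega> A assume \<omega>: "\<omega> \<notin> N" "\<omega> \<in> space M" and A: "A \<in> sets borel" "A \<subseteq> K"
        note reg = good[OF \<omega>(2,1)]
        have range: "range_rth_maxima r (\<lambda>i. X i \<omega>) = (\<lambda>i. X i \<omega>) ` accepted r (\<lambda>i. X i \<omega>)"
          by (rule regular_sample_range[OF reg _ r]) (rule F_mono)
        have As: "A \<in> sets (restrict_space borel ?S)" using A K by (auto simp: sets_restrict_space_iff)
        have "Q r \<omega> \<inter> A = (\<lambda>x. (x + b r) / a r) ` range_rth_maxima r (\<lambda>i. X i \<omega>) \<inter> A"
          using A KD unfolding range by (auto simp: Q_def I_def y_def)
        then show "emeasure (\<xi> r \<omega>) A = emeasure (range_process ?S a b X r \<omega>) A"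
          using \<omega>(1) r by (simp add: \<xi>_def range_process_def emeasure_point_measure_on[OF As])
      qed
    qed
  qed
  then show ?thesis by blast
qed

end

theorem mainTheorem3:
  fixes M :: "'a measure" and X :: "nat \<Rightarrow> 'a \<Rightarrow> real" and F :: "real \<Rightarrow> real"
    and a b :: "nat \<Rightarrow> real" and \<gamma> :: real
    and P :: "'b measure" and \<eta> :: "'b \<Rightarrow> real measure"
  assumes "prob_space M"
    and "prob_space.indep_vars M (\<lambda>_. borel) X UNIV"
    and "\<And>i. cdf (distr M borel (X i)) = F"
    and "continuous_on UNIV F"
    and "\<And>r. r \<ge> 1 \<Longrightarrow> a r > 0"
    and "\<And>x. x \<in> supp_gev \<gamma> \<Longrightarrow>
           (\<lambda>r. ereal (real r) * cum_hazard F (a r * x - b r)) \<longlonglongrightarrow> ereal (g_gev \<gamma> x)"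
    and "poisson_random_measure (supp_gev \<gamma>) (m_gev \<gamma>) P \<eta>"
  shows "converges_weakly_vaguely (supp_gev \<gamma>) M
           (range_process (supp_gev \<gamma>) a b X) P \<eta>"
  unfolding converges_weakly_vaguely_def
  using ex_radon_version[OF assms(1-6)] radon_version_converges[OF assms(1-6) assms(7)] by blast

end
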